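(* Let $\mathbb{K}$ be a field containing $\mathbb{Q}$. (Associative version.) Let $(A,\mu_0)$ be an associative $\mathbb{K}$-algebra that is formal, meaning that its Hochschild cochain complex $C=\mathrm{CHoch}(A,A)$, with cohomology $H=\mathrm{Hoch}(A,A)$, is formal in the sense given in the context. Let $\pi=\sum_{r\ge 0}\lambda^r\pi_r\in H^2[[\lambda]]$ satisfy $[\pi,\pi]_s=0$. Then there exist $\mu_r\in C^2$ ($r\ge 1$) such that $\mu=\mu_0+\sum_{r\ge 1}\lambda^r\mu_r$ is an associative product on $A[[\lambda]]$ (a formal associative deformation of $(A,\mu_0)$), $\mu_1$ is a cocycle, and its cohomology class is $[\mu_1]=\pi_0$. (Commutative version.) Let $(A,\mu_0)$ be a commutative associative $\mathbb{K}$-algebra that is formal as a commutative algebra, meaning that its Harrison cochain complex $C=\mathrm{CHarr}(A,A)$, with cohomology $H=\mathrm{Harr}(A,A)$, is formal in the sense given in the context. Let $\pi=\sum_{r\ge 0}\lambda^r\pi_r\in H^2[[\lambda]]$ satisfy $[\pi,\pi]_s=0$. Then there exist $\mu_r\in C^2$ ($r\ge 1$) such that $\mu=\mu_0+\sum_{r\ge 1}\lambda^r\mu_r$ is an associative and commutative product on $A[[\lambda]]$ (a formal commutative deformation of $(A,\mu_0)$), $\mu_1$ is a cocycle, and its cohomology class is $[\mu_1]=\pi_0$.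
   Context: Cochains. $\mathrm{CHoch}^k(A,A)=\mathrm{Hom}_{\mathbb{K}}(A^{\otimes k},A)$. When $A$ is commutative, $\mathrm{CHarr}^k(A,A)\subset \mathrm{CHoch}^k(A,A)$ is the subspace of maps vanishing on all signed shuffles $$\sum_{\sigma\in Sh_{p,q}}\mathrm{sgn}(\sigma)\,a_{\sigma^{-1}(1)}\otimes\dots\otimes a_{\sigma^{-1}(p+q)},\qquad p+q=k,\ p,q\ge 1,$$ where $Sh_{p,q}$ is the set of $\sigma\in\mathfrak{S}_{p+q}$ with $\sigma(1)<\dots<\sigma(p)$ and $\sigma(p+1)<\dots<\sigma(p+q)$. In particular $\mathrm{CHarr}^2(A,A)$ consists of the symmetric bilinear maps. Gerstenhaber bracket. For $f\in \mathrm{CHoch}^k(A,A)$ and $g\in\mathrm{CHoch}^l(A,A)$, put $$(f\circ g)(a_1,\dots,a_{k+l-1})=\sum_{i=0}^{k-1}(-1)^{i(l-1)}f(a_1,\dots,a_i,g(a_{i+1},\dots,a_{i+l}),a_{i+l+1},\dots,a_{k+l-1})$$ and $[f,g]_G=f\circ g-(-1)^{(k-1)(l-1)}g\circ f$. With the differential $b=[\mu_0,\cdot]_G$ (equal to the Hochschild coboundary up to a global sign), $\mathrm{CHoch}(A,A)[1]$ is a differential graded Lie algebra. When $A$ is commutative, $\mathrm{CHarr}(A,A)[1]$ is a differential graded Lie subalgebra. Let $C$ denote either $\mathrm{CHoch}(A,A)$ or $\mathrm{CHarr}(A,A)$, and let $H$ be its cohomology with respect to $b$ (Hochschild cohomology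 $\mathrm{Hoch}(A,A)$, respectively Harrison cohomology $\mathrm{Harr}(A,A)$). The bracket induced by $[\cdot,\cdot]_G$ on $H[1]$ is denoted $[\cdot,\cdot]_s$; it is extended $\mathbb{K}[[\lambda]]$-bilinearly to $H[[\lambda]]$. Shifts. $V[j]^i=V^{i+j}$, so $C[2]^0=C^2$. The shifted brackets $D=[\cdot,\cdot]_G[1]$ on $C[2]$ and $d=[\cdot,\cdot]_s[1]$ on $H[2]$ are the graded symmetric degree-$1$ maps given by $D(x,y)=(-1)^{k}[x,y]_G$ for $x\in C^k$, and $d(x,y)=(-1)^{k}[x,y]_s$ for $x\in H^k$. Symmetric coalgebras. For a graded vector space $V$, $\mathcal{S}V$ is the graded symmetric algebra with unit $\mathbf{1}$, regarded as a coalgebra with the comultiplication $\Delta_{\mathcal{S}V}$ that is the algebra morphism determined by $v\mapsto v\otimes \mathbf{1}+\mathbf{1}\otimes v$ for $v\in V$. $\overline{b+D}$ denotes the unique coderivation of $\mathcal{S}(C[2])$ whose projection to $C[2]$ is $b$ on $\mathcal{S}^1$, $D$ on $\mathcal{S}^2$ and $0$ on the other symmetric powers. $\overline{d}$ denotes the unique coderivation of $\mathcal{S}(H[2])$ whose projection to $H[2]$ is $d$ on $\mathcal{S}^2$ and $0$ on the other symmetric powers. Both square to zero. Formality. $C$ is called formal if there is an $L_\infty$-quasi-isomorphism $\Phi:\mathcal{S}(H[2])\to\mathcal{S}(C[2])$, i.e. a degree-$0$ morphism of differential graded (counital, coaugmented) coalgebras, so that $$(\Phi\otimes\Phi)\circ\Delta_{\mathcal{S}(H[2])}=\Delta_{\mathcal{S}(C[2])}\circ\Phi,\qquad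 \overline{b+D}\circ\Phi=\Phi\circ\overline{d},$$ such that the restriction $\Phi_1$ of $\Phi$ to $H[2]$ is a section: $\Phi_1$ takes each cohomology class to a cocycle representing it. Deformations. $A[[\lambda]]$ is the space of formal power series in $\lambda$ with coefficients in $A$. A series $\mu=\sum_{r\ge0}\lambda^r\mu_r$ of bilinear maps $\mu_r:A\otimes A\to A$ defines a product on $A[[\lambda]]$ by $\mathbb{K}[[\lambda]]$-bilinear extension. *)

theory Defs
  imports
    "HOL-Library.Poly_Mapping"
    "HOL-Library.Set_Algebras"
    "HOL-Library.Function_Algebras"
    "HOL-Combinatorics.Permutations"
    "HOL-Computational_Algebra.Formal_Power_Series"
begin

section \<open>Vector spaces with carrier, quotients, free spaces\<close>

text \<open>
  Addition is always the type class addition: pointwise on functions, and elementwise on sets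
  (\<^theory>\<open>HOL-Library.Set_Algebras\<close>), which is the addition of cosets in a quotient.
  The zero vector of a quotient by \<open>R\<close> is \<open>R\<close> itself, not the type class \<open>0\<close>.
\<close>

record ('k, 'v) vspace =
  carr :: "'v set"
  scl :: "'k \<Rightarrow> 'v \<Rightarrow> 'v"

definition linear_on ::
  "('k, 'v::plus) vspace \<Rightarrow> ('k, 'w::plus) vspace \<Rightarrow> ('v \<Rightarrow> 'w) \<Rightarrow> bool" where
  "linear_on V W f \<longleftrightarrow>
     (\<forall>x\<in>carr V. f x \<in> carr W) \<and>
     (\<forall>x\<in>carr V. \<forall>y\<in>carr V. f (x + y) = f x + f y) \<and>
     (\<forall>c. \<forall>x\<in>carr V. f (scl V c x) = scl W c (f x))"

text \<open>The quotient of the subspace \<open>W\<close> by its subspace \<open>R\<close>. Functions on a quotient are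
  given on representatives, in the form \<open>the_elem (g ` X)\<close> for a coset \<open>X\<close>.\<close>

definition quot ::
  "('k \<Rightarrow> 'v \<Rightarrow> 'v) \<Rightarrow> 'v set \<Rightarrow> 'v set \<Rightarrow> ('k, 'v::ab_group_add set) vspace" where
  "quot s W R = \<lparr>carr = (\<lambda>x. x +o R) ` W, scl = (\<lambda>c X. s c ` X + R)\<rparr>"

text \<open>The free vector space on the type \<open>'x\<close> is \<open>'x \<Rightarrow>\<^sub>0 'k\<close>.\<close>

definition fscale :: "'k::field \<Rightarrow> ('x \<Rightarrow>\<^sub>0 'k) \<Rightarrow> ('x \<Rightarrow>\<^sub>0 'k)" where
  "fscale c = Poly_Mapping.map ((*) c)"

lemma lookup_fscale: "Poly_Mapping.lookup (fscale c f) x = c * Poly_Mapping.lookup f x"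
  by (simp add: fscale_def Poly_Mapping.map.rep_eq when_def)

lemma vector_space_fscale: "vector_space fscale"
  by unfold_locales
    (auto intro!: poly_mapping_eqI simp: lookup_fscale lookup_add algebra_simps)

definition lin_ext ::
  "('x \<Rightarrow> ('y \<Rightarrow>\<^sub>0 'k)) \<Rightarrow> ('x \<Rightarrow>\<^sub>0 'k::field) \<Rightarrow> ('y \<Rightarrow>\<^sub>0 'k)" where
  "lin_ext g f = (\<Sum>x\<in>Poly_Mapping.keys f. fscale (Poly_Mapping.lookup f x) (g x))"


section \<open>Tensor products\<close>

definition tensor_rel ::
  "('k::field, 'v::plus) vspace \<Rightarrow> ('k, 'w::plus) vspace \<Rightarrow> ('v \<times> 'w \<Rightarrow>\<^sub>0 'k) set" where
  "tensor_rel V W = module.span fscale (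
     {Poly_Mapping.single (x + x', y) 1 - Poly_Mapping.single (x, y) 1
        - Poly_Mapping.single (x', y) 1 | x x' y. x \<in> carr V \<and> x' \<in> carr V \<and> y \<in> carr W} \<union>
     {Poly_Mapping.single (x, y + y') 1 - Poly_Mapping.single (x, y) 1
        - Poly_Mapping.single (x, y') 1 | x y y'. x \<in> carr V \<and> y \<in> carr W \<and> y' \<in> carr W} \<union>
     {Poly_Mapping.single (scl V c x, y) 1 - Poly_Mapping.single (x, y) c
        | c x y. x \<in> carr V \<and> y \<in> carr W} \<union>
     {Poly_Mapping.single (x, scl W c y) 1 - Poly_Mapping.single (x, y) c
        | c x y. x \<in> carr V \<and> y \<in> carr W})"

definition tensor ::
  "('k::field, 'v::plus) vspace \<Rightarrow> ('k, 'w::plus) vspace \<Rightarrow> ('k, ('v \<times> 'w \<Rightarrow>\<^sub>0 'k) set) vspace" where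
  "tensor V W = quot fscale {t. Poly_Mapping.keys t \<subseteq> carr V \<times> carr W} (tensor_rel V W)"

text \<open>\<open>tensor_map V' W' f g\<close> is \<open>f \<otimes> g\<close> without any Koszul sign; \<open>V'\<close> and \<open>W'\<close> are the codomains.\<close>

definition tensor_map ::
  "('k::field, 'v'::plus) vspace \<Rightarrow> ('k, 'w'::plus) vspace \<Rightarrow> ('v \<Rightarrow> 'v') \<Rightarrow> ('w \<Rightarrow> 'w') \<Rightarrow>
   ('v \<times> 'w \<Rightarrow>\<^sub>0 'k) set \<Rightarrow> ('v' \<times> 'w' \<Rightarrow>\<^sub>0 'k) set" where
  "tensor_map V' W' f g T =
     the_elem ((\<lambda>t. lin_ext (\<lambda>(x, y). Poly_Mapping.single (f x, g y) 1) t +o tensor_rel V' W') ` T)"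


section \<open>The graded symmetric coalgebra\<close>

text \<open>
  A graded vector space is a family \<open>V :: int \<Rightarrow> ('k, 'v) vspace\<close>. The symmetric algebra is the
  free vector space on words of homogeneous elements, each tagged with its degree, modulo
  multilinearity (which gives the tensor algebra) and graded commutativity.
\<close>

type_synonym ('k, 'v) gvspace = "int \<Rightarrow> ('k, 'v) vspace"
type_synonym 'v word = "(int \<times> 'v) list"
type_synonym ('k, 'v) sym = "('v word \<Rightarrow>\<^sub>0 'k) set"

definition sg :: "int \<Rightarrow> 'k::field" where
  "sg n = (if even n then 1 else - 1)"

definition shift :: "int \<Rightarrow> ('k, 'v) gvspace \<Rightarrow> ('k, 'v) gvspace" where
  "shift j V = (\<lambda>i. V (i + j))"

definition wdeg :: "'v word \<Rightarrow> int" where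
  "wdeg w = (\<Sum>(i, v)\<leftarrow>w. i)"

definition words :: "('k, 'v) gvspace \<Rightarrow> 'v word set" where
  "words V = {w. \<forall>(i, v)\<in>set w. v \<in> carr (V i)}"

definition sym_rel :: "('k::field, 'v::plus) gvspace \<Rightarrow> ('v word \<Rightarrow>\<^sub>0 'k) set" where
  "sym_rel V = module.span fscale (
     {Poly_Mapping.single (xs @ (i, u + v) # ys) 1 - Poly_Mapping.single (xs @ (i, u) # ys) 1
        - Poly_Mapping.single (xs @ (i, v) # ys) 1
        | xs ys i u v. xs \<in> words V \<and> ys \<in> words V \<and> u \<in> carr (V i) \<and> v \<in> carr (V i)} \<union>
     {Poly_Mapping.single (xs @ (i, scl (V i) c u) # ys) 1 - Poly_Mapping.single (xs @ (i, u) # ys) c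
        | xs ys i u c. xs \<in> words V \<and> ys \<in> words V \<and> u \<in> carr (V i)} \<union>
     {Poly_Mapping.single (xs @ (i, u) # (j, v) # ys) 1
        - Poly_Mapping.single (xs @ (j, v) # (i, u) # ys) (sg (i * j))
        | xs ys i u j v. xs \<in> words V \<and> ys \<in> words V \<and> u \<in> carr (V i) \<and> v \<in> carr (V j)})"

definition Sym :: "('k::field, 'v::plus) gvspace \<Rightarrow> ('k, ('k, 'v) sym) vspace" where
  "Sym V = quot fscale {f. Poly_Mapping.keys f \<subseteq> words V} (sym_rel V)"

text \<open>The product \<open>v\<^sub>1 \<dots> v\<^sub>n\<close> in the symmetric algebra; the empty product is the unit.\<close>

definition monomial :: "('k::field, 'v::plus) gvspace \<Rightarrow> 'v word \<Rightarrow> ('k, 'v) sym" where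
  "monomial V w = Poly_Mapping.single w 1 +o sym_rel V"

definition Sym_deg :: "('k::field, 'v::plus) gvspace \<Rightarrow> int \<Rightarrow> ('k, 'v) sym set" where
  "Sym_deg V n = (\<lambda>f. f +o sym_rel V) ` {f. Poly_Mapping.keys f \<subseteq> {w \<in> words V. wdeg w = n}}"

definition has_degree ::
  "int \<Rightarrow> ('k::field, 'v::plus) gvspace \<Rightarrow> ('k, 'w::plus) gvspace \<Rightarrow>
   (('k, 'v) sym \<Rightarrow> ('k, 'w) sym) \<Rightarrow> bool" where
  "has_degree d V W F \<longleftrightarrow> (\<forall>n. F ` Sym_deg V n \<subseteq> Sym_deg W (n + d))"

text \<open>The linear endomorphism of \<open>Sym V\<close> multiplying the monomial of each word \<open>w\<close> by \<open>c w\<close>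
  (for suitable \<open>c\<close>): the projection onto \<open>Sym\<^sup>1 V = V\<close>, and \<open>x \<mapsto> (-1)\<^bsup>deg x\<^esup> x\<close>.\<close>

definition diag_map ::
  "('k::field, 'v::plus) gvspace \<Rightarrow> ('v word \<Rightarrow> 'k) \<Rightarrow> ('k, 'v) sym \<Rightarrow> ('k, 'v) sym" where
  "diag_map V c X = the_elem ((\<lambda>f. lin_ext (\<lambda>w. Poly_Mapping.single w (c w)) f +o sym_rel V) ` X)"

definition proj1 :: "('k::field, 'v::plus) gvspace \<Rightarrow> ('k, 'v) sym \<Rightarrow> ('k, 'v) sym" where
  "proj1 V = diag_map V (\<lambda>w. if length w = 1 then 1 else 0)"

definition parity :: "('k::field, 'v::plus) gvspace \<Rightarrow> ('k, 'v) sym \<Rightarrow> ('k, 'v) sym" where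
  "parity V = diag_map V (\<lambda>w. sg (wdeg w))"

definition counit :: "('k::field, 'v) sym \<Rightarrow> 'k" where
  "counit X = the_elem ((\<lambda>f. Poly_Mapping.lookup f []) ` X)"

text \<open>The product of \<open>TV \<otimes> TV\<close> for the tensor algebra \<open>TV\<close>,
  \<open>(a \<otimes> b) (a' \<otimes> b') = (-1)\<^bsup>deg b * deg a'\<^esup> a a' \<otimes> b b'\<close>, on linear combinations of pairs of words.
  The comultiplication of \<open>Sym V\<close> is induced by the algebra morphism \<open>TV \<rightarrow> TV \<otimes> TV\<close>
  with \<open>v \<mapsto> v \<otimes> 1 + 1 \<otimes> v\<close>.\<close>

definition tmult ::
  "('v word \<times> 'v word \<Rightarrow>\<^sub>0 'k::field) \<Rightarrow> ('v word \<times> 'v word \<Rightarrow>\<^sub>0 'k) \<Rightarrow>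
   ('v word \<times> 'v word \<Rightarrow>\<^sub>0 'k)" where
  "tmult p q =
     lin_ext (\<lambda>(a, b). lin_ext (\<lambda>(a', b').
       Poly_Mapping.single (a @ a', b @ b') (sg (wdeg b * wdeg a'))) q) p"

fun comult_word :: "'v word \<Rightarrow> ('v word \<times> 'v word \<Rightarrow>\<^sub>0 'k::field)" where
  "comult_word [] = Poly_Mapping.single ([], []) 1"
| "comult_word (v # w) =
     tmult (Poly_Mapping.single ([v], []) 1 + Poly_Mapping.single ([], [v]) 1) (comult_word w)"

definition comult ::
  "('k::field, 'v::plus) gvspace \<Rightarrow> ('k, 'v) sym \<Rightarrow> (('k, 'v) sym \<times> ('k, 'v) sym \<Rightarrow>\<^sub>0 'k) set" where
  "comult V X = the_elem ((\<lambda>f.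
     lin_ext (\<lambda>(a, b). Poly_Mapping.single (monomial V a, monomial V b) 1) (lin_ext comult_word f)
       +o tensor_rel (Sym V) (Sym V)) ` X)"

text \<open>Coderivations of degree 1. The Koszul sign in
  \<open>(id \<otimes> Q) (x \<otimes> y) = (-1)\<^bsup>deg x\<^esup> x \<otimes> Q y\<close> is produced by \<^const>\<open>parity\<close>.\<close>

definition coderivation ::
  "('k::field, 'v::plus) gvspace \<Rightarrow> (('k, 'v) sym \<Rightarrow> ('k, 'v) sym) \<Rightarrow> bool" where
  "coderivation V Q \<longleftrightarrow>
     linear_on (Sym V) (Sym V) Q \<and> has_degree 1 V V Q \<and>
     (\<forall>X\<in>carr (Sym V). comult V (Q X) =
        tensor_map (Sym V) (Sym V) Q id (comult V X) +
        tensor_map (Sym V) (Sym V) (parity V) Q (comult V X))"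

text \<open>The projection of \<open>Q\<close> to \<open>V = Sym\<^sup>1 V\<close> is \<open>q1\<close> on \<open>Sym\<^sup>1 V\<close>, \<open>q2\<close> on \<open>Sym\<^sup>2 V\<close> and \<open>0\<close> on the
  other symmetric powers. The integer arguments of \<open>q1\<close> and \<open>q2\<close> are the degrees in \<open>V\<close> of the
  elements to which they are applied; \<open>sym_rel V\<close> is the zero of \<open>Sym V\<close>.\<close>

definition has_projection ::
  "('k::field, 'v::plus) gvspace \<Rightarrow> (int \<Rightarrow> 'v \<Rightarrow> 'v) \<Rightarrow> (int \<Rightarrow> int \<Rightarrow> 'v \<Rightarrow> 'v \<Rightarrow> 'v) \<Rightarrow>
   (('k, 'v) sym \<Rightarrow> ('k, 'v) sym) \<Rightarrow> bool" where
  "has_projection V q1 q2 Q \<longleftrightarrow>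
     (\<forall>i. \<forall>u\<in>carr (V i). proj1 V (Q (monomial V [(i, u)])) = monomial V [(i + 1, q1 i u)]) \<and>
     (\<forall>i j. \<forall>u\<in>carr (V i). \<forall>v\<in>carr (V j).
        proj1 V (Q (monomial V [(i, u), (j, v)])) = monomial V [(i + j + 1, q2 i j u v)]) \<and>
     (\<forall>w\<in>words V. length w \<notin> {1, 2} \<longrightarrow> proj1 V (Q (monomial V w)) = sym_rel V)"

definition coalgebra_morphism ::
  "('k::field, 'v::plus) gvspace \<Rightarrow> ('k, 'w::plus) gvspace \<Rightarrow>
   (('k, 'v) sym \<Rightarrow> ('k, 'w) sym) \<Rightarrow> bool" where
  "coalgebra_morphism V W F \<longleftrightarrow>
     linear_on (Sym V) (Sym W) F \<and> has_degree 0 V W F \<and>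
     (\<forall>X\<in>carr (Sym V). tensor_map (Sym W) (Sym W) F F (comult V X) = comult W (F X)) \<and>
     (\<forall>X\<in>carr (Sym V). counit (F X) = counit X) \<and>
     F (monomial V []) = monomial W []"


section \<open>Hochschild and Harrison cochains\<close>

definition bilinear_map ::
  "('k::field \<Rightarrow> 'a::ab_group_add \<Rightarrow> 'a) \<Rightarrow> ('a \<Rightarrow> 'a \<Rightarrow> 'a) \<Rightarrow> bool" where
  "bilinear_map s m \<longleftrightarrow>
     (\<forall>x. Vector_Spaces.linear s s (\<lambda>y. m x y)) \<and> (\<forall>y. Vector_Spaces.linear s s (\<lambda>x. m x y))"

locale assoc_algebra = vector_space s
  for s :: "'k::field \<Rightarrow> 'a::ab_group_add \<Rightarrow> 'a" +
  fixes m :: "'a \<Rightarrow> 'a \<Rightarrow> 'a"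
  assumes bilinear: "bilinear_map s m"
    and assoc: "m (m x y) z = m x (m y z)"

locale comm_assoc_algebra = assoc_algebra +
  assumes commute: "m x y = m y x"

text \<open>A \<open>k\<close>-cochain is a function on lists which is multilinear on lists of length \<open>k\<close> and zero on
  all other lists. Degrees are integers, so that cochain spaces of negative degree are zero.\<close>

type_synonym 'a cochain = "'a list \<Rightarrow> 'a"

definition CHoch :: "('k::field \<Rightarrow> 'a::ab_group_add \<Rightarrow> 'a) \<Rightarrow> int \<Rightarrow> 'a cochain set" where
  "CHoch s k = {f.
     (\<forall>xs. int (length xs) \<noteq> k \<longrightarrow> f xs = 0) \<and>
     (\<forall>xs ys u v. f (xs @ (u + v) # ys) = f (xs @ u # ys) + f (xs @ v # ys)) \<and>
     (\<forall>xs ys c u. f (xs @ s c u # ys) = s c (f (xs @ u # ys)))}"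

definition Sh :: "nat \<Rightarrow> nat \<Rightarrow> (nat \<Rightarrow> nat) set" where
  "Sh p q = {\<sigma>. \<sigma> permutes {..<p + q} \<and>
     strict_mono_on {..<p} \<sigma> \<and> strict_mono_on {p..<p + q} \<sigma>}"

definition CHarr :: "('k::field \<Rightarrow> 'a::ab_group_add \<Rightarrow> 'a) \<Rightarrow> int \<Rightarrow> 'a cochain set" where
  "CHarr s k = {f \<in> CHoch s k.
     \<forall>p q xs. 1 \<le> p \<and> 1 \<le> q \<and> int (p + q) = k \<and> length xs = p + q \<longrightarrow>
       (\<Sum>\<sigma>\<in>Sh p q. s (of_int (sign \<sigma>)) (f (permute_list (inv \<sigma>) xs))) = 0}"

definition cochain2 :: "('a \<Rightarrow> 'a \<Rightarrow> 'a) \<Rightarrow> 'a::zero cochain" where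
  "cochain2 m xs = (case xs of [x, y] \<Rightarrow> m x y | _ \<Rightarrow> 0)"

definition cscale :: "('k \<Rightarrow> 'a \<Rightarrow> 'a) \<Rightarrow> 'k \<Rightarrow> 'a cochain \<Rightarrow> 'a cochain" where
  "cscale s c f = (\<lambda>xs. s c (f xs))"

text \<open>In the following, \<open>k\<close> and \<open>l\<close> are the degrees of \<open>f\<close> and \<open>g\<close>.\<close>

definition gcirc ::
  "('k::field \<Rightarrow> 'a::ab_group_add \<Rightarrow> 'a) \<Rightarrow> int \<Rightarrow> int \<Rightarrow> 'a cochain \<Rightarrow> 'a cochain \<Rightarrow> 'a cochain" where
  "gcirc s k l f g = (\<lambda>xs.
     if int (length xs) = k + l - 1 then
       \<Sum>i<nat k. s (sg (int i * (l - 1)))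
         (f (take i xs @ g (take (nat l) (drop i xs)) # drop (i + nat l) xs))
     else 0)"

definition gbracket ::
  "('k::field \<Rightarrow> 'a::ab_group_add \<Rightarrow> 'a) \<Rightarrow> int \<Rightarrow> int \<Rightarrow> 'a cochain \<Rightarrow> 'a cochain \<Rightarrow> 'a cochain" where
  "gbracket s k l f g = gcirc s k l f g - cscale s (sg ((k - 1) * (l - 1))) (gcirc s l k g f)"

definition hdiff ::
  "('k::field \<Rightarrow> 'a::ab_group_add \<Rightarrow> 'a) \<Rightarrow> ('a \<Rightarrow> 'a \<Rightarrow> 'a) \<Rightarrow> int \<Rightarrow> 'a cochain \<Rightarrow> 'a cochain" where
  "hdiff s m k f = gbracket s 2 k (cochain2 m) f"


section \<open>Cohomology and formality\<close>

text \<open>Below, \<open>C\<close> stands for \<^term>\<open>CHoch s\<close> or \<^term>\<open>CHarr s\<close>.\<close>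

definition cocycles ::
  "('k::field \<Rightarrow> 'a::ab_group_add \<Rightarrow> 'a) \<Rightarrow> ('a \<Rightarrow> 'a \<Rightarrow> 'a) \<Rightarrow> (int \<Rightarrow> 'a cochain set) \<Rightarrow>
   int \<Rightarrow> 'a cochain set" where
  "cocycles s m C k = {f \<in> C k. hdiff s m k f = 0}"

definition coboundaries ::
  "('k::field \<Rightarrow> 'a::ab_group_add \<Rightarrow> 'a) \<Rightarrow> ('a \<Rightarrow> 'a \<Rightarrow> 'a) \<Rightarrow> (int \<Rightarrow> 'a cochain set) \<Rightarrow>
   int \<Rightarrow> 'a cochain set" where
  "coboundaries s m C k = hdiff s m (k - 1) ` C (k - 1)"

definition cochain_complex ::
  "('k::field \<Rightarrow> 'a::ab_group_add \<Rightarrow> 'a) \<Rightarrow> (int \<Rightarrow> 'a cochain set) \<Rightarrow> ('k, 'a cochain) gvspace" where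
  "cochain_complex s C k = \<lparr>carr = C k, scl = cscale s\<rparr>"

definition cohomology ::
  "('k::field \<Rightarrow> 'a::ab_group_add \<Rightarrow> 'a) \<Rightarrow> ('a \<Rightarrow> 'a \<Rightarrow> 'a) \<Rightarrow> (int \<Rightarrow> 'a cochain set) \<Rightarrow>
   ('k, 'a cochain set) gvspace" where
  "cohomology s m C k = quot (cscale s) (cocycles s m C k) (coboundaries s m C k)"

definition sbracket ::
  "('k::field \<Rightarrow> 'a::ab_group_add \<Rightarrow> 'a) \<Rightarrow> ('a \<Rightarrow> 'a \<Rightarrow> 'a) \<Rightarrow> (int \<Rightarrow> 'a cochain set) \<Rightarrow>
   int \<Rightarrow> int \<Rightarrow> 'a cochain set \<Rightarrow> 'a cochain set \<Rightarrow> 'a cochain set" where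
  "sbracket s m C k l X Y =
     the_elem ((\<lambda>(x, y). gbracket s k l x y +o coboundaries s m C (k + l - 1)) ` (X \<times> Y))"

text \<open>An element of degree \<open>i\<close> in \<open>C[2]\<close> or \<open>H[2]\<close> has cochain degree \<open>i + 2\<close>.\<close>

definition codiff_C ::
  "('k::field \<Rightarrow> 'a::ab_group_add \<Rightarrow> 'a) \<Rightarrow> ('a \<Rightarrow> 'a \<Rightarrow> 'a) \<Rightarrow> (int \<Rightarrow> 'a cochain set) \<Rightarrow>
   (('k, 'a cochain) sym \<Rightarrow> ('k, 'a cochain) sym) \<Rightarrow> bool" where
  "codiff_C s m C Q \<longleftrightarrow>
     coderivation (shift 2 (cochain_complex s C)) Q \<and>
     has_projection (shift 2 (cochain_complex s C))
       (\<lambda>i f. hdiff s m (i + 2) f)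
       (\<lambda>i j f g. cscale s (sg (i + 2)) (gbracket s (i + 2) (j + 2) f g)) Q"

definition codiff_H ::
  "('k::field \<Rightarrow> 'a::ab_group_add \<Rightarrow> 'a) \<Rightarrow> ('a \<Rightarrow> 'a \<Rightarrow> 'a) \<Rightarrow> (int \<Rightarrow> 'a cochain set) \<Rightarrow>
   (('k, 'a cochain set) sym \<Rightarrow> ('k, 'a cochain set) sym) \<Rightarrow> bool" where
  "codiff_H s m C Q \<longleftrightarrow>
     coderivation (shift 2 (cohomology s m C)) Q \<and>
     has_projection (shift 2 (cohomology s m C))
       (\<lambda>i X. coboundaries s m C (i + 3))
       (\<lambda>i j X Y. scl (cohomology s m C (i + j + 3)) (sg (i + 2))
          (sbracket s m C (i + 2) (j + 2) X Y)) Q"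

text \<open>The coderivations \<open>QH\<close> and \<open>QC\<close> are uniquely determined on the carriers by \<^const>\<open>codiff_H\<close>
  and \<^const>\<open>codiff_C\<close>. The last condition says that \<open>\<Phi>\<close> sends the class \<open>X\<close> to one of its
  representing cocycles.\<close>

definition formal ::
  "('k::field \<Rightarrow> 'a::ab_group_add \<Rightarrow> 'a) \<Rightarrow> ('a \<Rightarrow> 'a \<Rightarrow> 'a) \<Rightarrow> (int \<Rightarrow> 'a cochain set) \<Rightarrow> bool" where
  "formal s m C \<longleftrightarrow>
     (\<exists>QH QC \<Phi>. codiff_H s m C QH \<and> codiff_C s m C QC \<and>
        coalgebra_morphism (shift 2 (cohomology s m C)) (shift 2 (cochain_complex s C)) \<Phi> \<and>
        (\<forall>X\<in>carr (Sym (shift 2 (cohomology s m C))). QC (\<Phi> X) = \<Phi> (QH X)) \<and>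
        (\<forall>i. \<forall>X\<in>carr (shift 2 (cohomology s m C) i). \<exists>z\<in>X.
           \<Phi> (monomial (shift 2 (cohomology s m C)) [(i, X)]) = monomial (shift 2 (cochain_complex s C)) [(i, z)]))"


section \<open>Formal deformations\<close>

text \<open>\<open>\<pi> = (\<Sum>r. \<lambda>\<^sup>r \<pi> r)\<close> is an element of \<open>H\<^sup>2[[\<lambda>]]\<close> with \<open>[\<pi>, \<pi>]\<^sub>s = 0\<close>; the coboundaries are the
  zero class.\<close>

definition maurer_cartan ::
  "('k::field \<Rightarrow> 'a::ab_group_add \<Rightarrow> 'a) \<Rightarrow> ('a \<Rightarrow> 'a \<Rightarrow> 'a) \<Rightarrow> (int \<Rightarrow> 'a cochain set) \<Rightarrow>
   (nat \<Rightarrow> 'a cochain set) \<Rightarrow> bool" where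
  "maurer_cartan s m C \<pi> \<longleftrightarrow>
     (\<forall>r. \<pi> r \<in> carr (cohomology s m C 2)) \<and>
     (\<forall>n. (\<Sum>i\<le>n. sbracket s m C 2 2 (\<pi> i) (\<pi> (n - i))) = coboundaries s m C 3)"

text \<open>The product on \<open>A[[\<lambda>]]\<close> defined by \<open>\<mu> = (\<Sum>r. \<lambda>\<^sup>r \<mu> r)\<close>.\<close>

definition star ::
  "(nat \<Rightarrow> 'a \<Rightarrow> 'a \<Rightarrow> 'a::comm_monoid_add) \<Rightarrow> 'a fps \<Rightarrow> 'a fps \<Rightarrow> 'a fps" where
  "star \<mu> x y = Abs_fps (\<lambda>n. \<Sum>r\<le>n. \<Sum>i\<le>n - r. \<mu> r (fps_nth x i) (fps_nth y (n - r - i)))"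

end

theory Submission
  imports Defs
begin

text \<open>
  The coefficients \<open>e\<^sub>n\<close> of \<open>exp (\<lambda> \<pi>)\<close> form a grouplike sequence of even elements of \<open>\<S>(H[2])\<close>.
  A coderivation maps it to \<open>0\<close> as soon as the projection to \<open>\<S>\<^sup>1\<close> of the image vanishes, because a
  primitive element \<open>y\<close> satisfies \<open>mult (\<Delta> y) = 2 y\<close>, while \<open>mult \<circ> \<Delta> = 2\<^sup>k\<close> on \<open>\<S>\<^sup>k\<close>; by
  \<open>[\<pi>, \<pi>]\<^sub>s = 0\<close> this applies to the codifferential of \<open>\<S>(H[2])\<close>. The image \<open>x\<^sub>n = \<Phi> e\<^sub>n\<close> is
  grouplike again and is annihilated by the codifferential of \<open>\<S>(C[2])\<close>. If \<open>\<nu>\<close> is its component in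
  \<open>\<S>\<^sup>1\<close>, then its component in \<open>\<S>\<^sup>2\<close> is \<open>\<nu>\<^sup>2 / 2\<close>, and projecting to \<open>\<S>\<^sup>1\<close> gives the Maurer-Cartan
  equation \<open>b \<nu> + [\<nu>, \<nu>] / 2 = 0\<close>, which is associativity of \<open>\<mu>\<^sub>0 + \<nu>\<close>.
\<close>

section \<open>Linear extension\<close>

text \<open>A power series never appears as one object: it is the sequence of its coefficients. The
  factor \<lambda> in the exponent makes every coefficient of the exponential a finite sum and puts
  \<pi>_0 at order one, where \<mu>_1 sits. The obstacle is that \<open>Sym V\<close> is a bare
  quotient of a free space, with neither a basis nor a direct sum decomposition at hand. Computation
  therefore takes place on combinations of words modulo \<open>sym_rel\<close>, and one family of
  operators does the work: comultiply, then multiply back with a weight h(p, q) that depends on the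
  lengths of the two factors. Modulo relations this acts on words of length k as the scalar sum over
  p + q = k of binom(k, p) h(p, q). The weight 1 gives the eigenvalues 2^k that detect primitive
  elements. The indicator of (1, 1) extracts the Sym^2 component of a grouplike sequence, with the
  factor binom(2, 1) = 2; this is the origin of the 1/2 in the Maurer-Cartan equation. Classes in
  H^2 have degree 0 in H[2], so the exponential meets no Koszul signs.\<close>

interpretation fs: vector_space "fscale :: 'k::field \<Rightarrow> ('x \<Rightarrow>\<^sub>0 'k) \<Rightarrow> _"
  by (rule vector_space_fscale)

text \<open>The universal property of the free space with an arbitrary target.
  \<open>lin_ext\<close> is the case of a free target; cochains as values are needed for
  \<open>vpart\<close>.\<close>

definition lift :: "('k \<Rightarrow> 'v \<Rightarrow> 'v) \<Rightarrow> ('x \<Rightarrow> 'v) \<Rightarrow> ('x \<Rightarrow>\<^sub>0 'k::field) \<Rightarrow> 'v::ab_group_add" where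
  "lift sc g f = (\<Sum>x\<in>Poly_Mapping.keys f. sc (Poly_Mapping.lookup f x) (g x))"

lemma (in vector_space) lift_superset:
  assumes "finite A" "Poly_Mapping.keys f \<subseteq> A"
  shows "lift scale g f = (\<Sum>x\<in>A. scale (Poly_Mapping.lookup f x) (g x))"
  unfolding lift_def using assms
  by (intro sum.mono_neutral_left) (auto simp: in_keys_iff)

lemma (in vector_space) lift_linear: "Vector_Spaces.linear fscale scale (lift scale g)"
proof -
  have "lift scale g (f + h) = lift scale g f + lift scale g h" for f h
  proof -
    let ?A = "Poly_Mapping.keys f \<union> Poly_Mapping.keys h"
    have "lift scale g (f + h) = (\<Sum>x\<in>?A. scale (Poly_Mapping.lookup (f + h) x) (g x))"
      using keys_add[of f h] by (intro lift_superset) auto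
    then show ?thesis
      by (simp add: lift_superset[of ?A f] lift_superset[of ?A h] lookup_add
          scale_left_distrib sum.distrib)
  qed
  moreover have "lift scale g (fscale c f) = scale c (lift scale g f)" for c f
  proof -
    have "lift scale g (fscale c f) =
      (\<Sum>x\<in>Poly_Mapping.keys f. scale (Poly_Mapping.lookup (fscale c f) x) (g x))"
      by (intro lift_superset) (auto simp: in_keys_iff lookup_fscale)
    then show ?thesis
      by (simp add: lift_def lookup_fscale scale_sum_right)
  qed
  ultimately show ?thesis
    by unfold_locales auto
qed

lemma (in vector_space) lift_single: "lift scale g (Poly_Mapping.single x c) = scale c (g x)"
  by (simp add: lift_def)

lemma lin_ext_linear: "Vector_Spaces.linear fscale fscale (lin_ext g)"
  using fs.lift_linear[of g] unfolding lift_def[abs_def] lin_ext_def[abs_def] .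

interpretation le: Vector_Spaces.linear fscale fscale "lin_ext g" for g
  by (rule lin_ext_linear)

lemma lin_ext_single: "lin_ext g (Poly_Mapping.single x c) = fscale c (g x)"
  by (simp add: lin_ext_def)

lemma fscale_single: "fscale c (Poly_Mapping.single x d) = Poly_Mapping.single x (c * d)"
  by (auto intro!: poly_mapping_eqI simp: lookup_fscale lookup_single when_def)

lemmas lin_simps =
  le.add le.diff le.neg le.zero le.sum le.scale lin_ext_single fscale_single
  fs.scale_right_distrib fs.scale_right_diff_distrib fs.scale_sum_right

lemma lin_ext_fun_add: "lin_ext (\<lambda>x. g x + h x) f = lin_ext g f + lin_ext h f"
  by (simp add: lin_ext_def sum.distrib fs.scale_right_distrib)

lemma sum_singles: "(\<Sum>x\<in>Poly_Mapping.keys f. Poly_Mapping.single x (Poly_Mapping.lookup f x)) = f"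
proof (rule poly_mapping_eqI)
  fix k
  show "Poly_Mapping.lookup (\<Sum>x\<in>Poly_Mapping.keys f.
      Poly_Mapping.single x (Poly_Mapping.lookup f x)) k = Poly_Mapping.lookup f k"
    by (cases "k \<in> Poly_Mapping.keys f")
      (auto simp: lookup_sum lookup_single when_def in_keys_iff)
qed

text \<open>Reduces claims that are additive in \<open>f\<close> to single basis elements; the set
  \<open>A\<close> keeps track of the carrier condition on words.\<close>

lemma supp_induct [consumes 1, case_names zero single add]:
  fixes f :: "'x \<Rightarrow>\<^sub>0 'k::field"
  assumes "Poly_Mapping.keys f \<subseteq> A" "P 0" "\<And>x c. x \<in> A \<Longrightarrow> P (Poly_Mapping.single x c)"
    "\<And>f g. P f \<Longrightarrow> P g \<Longrightarrow> P (f + g)"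
  shows "P f"
proof -
  have "P (\<Sum>x\<in>B. Poly_Mapping.single x (Poly_Mapping.lookup f x))" if "finite B" "B \<subseteq> A" for B
    using that by (induction B rule: finite_induct) (auto intro: assms)
  from this[of "Poly_Mapping.keys f"] show ?thesis
    using assms(1) by (simp add: sum_singles)
qed

lemma lin_ext_id: "lin_ext (\<lambda>x. Poly_Mapping.single x 1) f = f"
  by (simp add: lin_ext_def fscale_single sum_singles)

lemma lin_ext_in_subspace:
  assumes "fs.subspace T" "\<And>x. x \<in> Poly_Mapping.keys f \<Longrightarrow> g x \<in> T"
  shows "lin_ext g f \<in> T"
  unfolding lin_ext_def using assms by (intro fs.subspace_sum fs.subspace_scale) auto

lemma subspace_supp: "fs.subspace {f :: 'x \<Rightarrow>\<^sub>0 'k::field. Poly_Mapping.keys f \<subseteq> A}"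
proof (rule fs.subspaceI, simp_all)
  fix f g :: "'x \<Rightarrow>\<^sub>0 'k" and c
  assume f: "Poly_Mapping.keys f \<subseteq> A"
  then show "Poly_Mapping.keys (fscale c f) \<subseteq> A"
    by (auto simp: subset_iff in_keys_iff lookup_fscale)
  assume "Poly_Mapping.keys g \<subseteq> A"
  then show "Poly_Mapping.keys (f + g) \<subseteq> A"
    using f keys_add[of f g] by blast
qed

lemma keys_add_subset:
  "Poly_Mapping.keys f \<subseteq> A \<Longrightarrow> Poly_Mapping.keys g \<subseteq> A \<Longrightarrow> Poly_Mapping.keys (f + g) \<subseteq> A"
  using keys_add[of f g] by blast

lemma lin_span:
  assumes L: "Vector_Spaces.linear fscale fscale L" and T: "fs.subspace T"
    and "\<And>g. g \<in> S \<Longrightarrow> L g \<in> T" and "x \<in> fs.span S"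
  shows "L x \<in> T"
proof -
  interpret L: Vector_Spaces.linear fscale fscale L by fact
  show ?thesis using assms(4)
  proof (induction rule: fs.span_induct_alt)
    case base then show ?case by (simp add: L.zero fs.subspace_0[OF T])
  next
    case (step c x y) then show ?case
      using assms(3) T by (simp add: L.add L.scale fs.subspace_add fs.subspace_scale)
  qed
qed

section \<open>Cosets\<close>

text \<open>Equality and addition of cosets use only the additive group, so one predicate serves
  both the relations in free spaces and the coboundaries, whose scalar multiplications
  differ.\<close>

definition subgrp :: "'v::ab_group_add set \<Rightarrow> bool" where
  "subgrp R \<longleftrightarrow> 0 \<in> R \<and> (\<forall>x\<in>R. \<forall>y\<in>R. x - y \<in> R)"

lemma subgrpD: assumes "subgrp R" shows "0 \<in> R"
    "\<And>x. x \<in> R \<Longrightarrow> - x \<in> R" "\<And>x y. x \<in> R \<Longrightarrow> y \<in> R \<Longrightarrow> x - y \<in> R"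
    "\<And>x y. x \<in> R \<Longrightarrow> y \<in> R \<Longrightarrow> x + y \<in> R"
proof -
  show 0: "0 \<in> R" and d: "\<And>x y. x \<in> R \<Longrightarrow> y \<in> R \<Longrightarrow> x - y \<in> R"
    using assms by (auto simp: subgrp_def)
  show n: "- x \<in> R" if "x \<in> R" for x using d[OF 0 that] by simp
  show "x + y \<in> R" if "x \<in> R" "y \<in> R" for x y using d[OF that(1) n[OF that(2)]] by simp
qed

lemma subspace_subgrp: "fs.subspace R \<Longrightarrow> subgrp R"
  by (simp add: subgrp_def fs.subspace_0 fs.subspace_diff)

lemma mem_coset: "x \<in> a +o R \<longleftrightarrow> x - a \<in> R" for a :: "'v::ab_group_add"
  by (auto simp: elt_set_plus_def intro: bexI[of _ "x - a"])

lemma coset_eq_iff: assumes "subgrp R" shows "a +o R = b +o R \<longleftrightarrow> a - b \<in> R"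
proof
  assume "a +o R = b +o R"
  moreover have "a \<in> a +o R" using assms by (simp add: mem_coset subgrp_def)
  ultimately show "a - b \<in> R" by (simp add: mem_coset)
next
  assume *: "a - b \<in> R"
  have "x - a \<in> R \<longleftrightarrow> x - b \<in> R" for x
    using subgrpD(4)[OF assms _ *, of "x - a"] subgrpD(3)[OF assms _ *, of "x - b"] by auto
  then show "a +o R = b +o R" by (auto simp: mem_coset)
qed

lemma coset_zero_iff: "subgrp R \<Longrightarrow> a +o R = R \<longleftrightarrow> a \<in> R"
  using coset_eq_iff[of R a 0] by simp

lemma coset_add:
  fixes a :: "'v::ab_group_add"
  assumes "subgrp R"
  shows "(a +o R) + (b +o R) = (a + b) +o R"
proof -
  have "R + R = R" using subgrpD[OF assms] by (force simp: set_plus_def)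
  then show ?thesis by (simp add: set_plus_rearrange)
qed

text \<open>The summand \<open>R\<close> repairs the case of the scalar 0, in which the image of the
  coset alone is a single point.\<close>

lemma coset_scale:
  assumes "Vector_Spaces.linear s s (s c)" "subgrp R" "\<And>x. x \<in> R \<Longrightarrow> s c x \<in> R"
  shows "s c ` (a +o R) + R = s c a +o R"
proof -
  interpret L: Vector_Spaces.linear s s "s c" by fact
  show ?thesis
  proof (intro set_eqI iffI)
    fix x assume "x \<in> s c ` (a +o R) + R"
    then obtain r r' where "r \<in> R" "r' \<in> R" "x = s c (a + r) + r'"
      by (auto simp: set_plus_def elt_set_plus_def)
    then show "x \<in> s c a +o R" using assms(2,3)
      by (auto simp: mem_coset L.add subgrpD)
  next
    fix x assume "x \<in> s c a +o R"
    then have "x - s c a \<in> R" "a \<in> a +o R" using assms(2) by (auto simp: mem_coset subgrpD)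
    then show "x \<in> s c ` (a +o R) + R"
      by (metis add.commute diff_add_cancel imageI set_plus_intro)
  qed
qed

text \<open>The map is constant on the coset, so its image is a singleton. This evaluates
  \<open>tensor_map\<close>, \<open>comult\<close> and \<open>diag_map\<close> on
  representatives.\<close>

lemma the_elem_coset:
  assumes "subgrp R" "subgrp R'" "\<And>x y. L (x + y) = L x + L y" "\<And>x. x \<in> R \<Longrightarrow> L x \<in> R'"
  shows "the_elem ((\<lambda>f. L f +o R') ` (a +o R)) = L a +o R'"
proof -
  have "L x +o R' = L a +o R'" if "x \<in> a +o R" for x
  proof -
    from that obtain r where "r \<in> R" "x = a + r" by (auto simp: elt_set_plus_def)
    then show ?thesis using assms(4)[of r] by (simp add: assms(3) coset_eq_iff[OF assms(2)])
  qed
  moreover have "a \<in> a +o R" using assms(1) by (simp add: mem_coset subgrpD)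
  ultimately have "(\<lambda>f. L f +o R') ` (a +o R) = {L a +o R'}" by blast
  then show ?thesis by simp
qed

section \<open>Tensor products\<close>

lemma tensor_rel_subgrp: "subgrp (tensor_rel V W)"
  unfolding tensor_rel_def by (intro subspace_subgrp fs.subspace_span)

lemma tensor_rel_subspace: "fs.subspace (tensor_rel V W)"
  unfolding tensor_rel_def by (rule fs.subspace_span)

text \<open>The universal property of the tensor product. Bilinearity of \<beta> is asked only
  modulo a subspace \<open>T\<close>, so the target may be a quotient.\<close>

lemma tensor_rel_lift:
  assumes T: "fs.subspace T"
    and "\<And>x x' y. x \<in> carr V \<Longrightarrow> x' \<in> carr V \<Longrightarrow> y \<in> carr W \<Longrightarrow>
      \<beta> (x + x', y) - \<beta> (x, y) - \<beta> (x', y) \<in> T"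
    and "\<And>x y y'. x \<in> carr V \<Longrightarrow> y \<in> carr W \<Longrightarrow> y' \<in> carr W \<Longrightarrow>
      \<beta> (x, y + y') - \<beta> (x, y) - \<beta> (x, y') \<in> T"
    and "\<And>c x y. x \<in> carr V \<Longrightarrow> y \<in> carr W \<Longrightarrow> \<beta> (scl V c x, y) - fscale c (\<beta> (x, y)) \<in> T"
    and "\<And>c x y. x \<in> carr V \<Longrightarrow> y \<in> carr W \<Longrightarrow> \<beta> (x, scl W c y) - fscale c (\<beta> (x, y)) \<in> T"
    and "t \<in> tensor_rel V W"
  shows "lin_ext \<beta> t \<in> T"
proof (rule lin_span[OF lin_ext_linear T _ assms(6)[unfolded tensor_rel_def]], elim UnE CollectE exE conjE)
qed (simp_all add: le.diff lin_ext_single assms)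

lemma tensor_rel_add_left:
  "\<lbrakk>x \<in> carr V; x' \<in> carr V; y \<in> carr W\<rbrakk> \<Longrightarrow> Poly_Mapping.single (x + x', y) 1 - Poly_Mapping.single (x, y) 1 - Poly_Mapping.single (x', y) 1 \<in> tensor_rel V W"
  unfolding tensor_rel_def
  by (rule fs.span_base, rule UnI1, rule UnI1, rule UnI1, blast)

lemma tensor_rel_add_right:
  "\<lbrakk>x \<in> carr V; y \<in> carr W; y' \<in> carr W\<rbrakk> \<Longrightarrow> Poly_Mapping.single (x, y + y') 1 - Poly_Mapping.single (x, y) 1 - Poly_Mapping.single (x, y') 1 \<in> tensor_rel V W"
  unfolding tensor_rel_def
  by (rule fs.span_base, rule UnI1, rule UnI1, rule UnI2, blast)

lemma tensor_rel_scl_left: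
  "\<lbrakk>x \<in> carr V; y \<in> carr W\<rbrakk> \<Longrightarrow> Poly_Mapping.single (scl V c x, y) 1 - Poly_Mapping.single (x, y) c \<in> tensor_rel V W"
  unfolding tensor_rel_def
  by (rule fs.span_base, rule UnI1, rule UnI2, blast)

lemma tensor_rel_scl_right:
  "\<lbrakk>x \<in> carr V; y \<in> carr W\<rbrakk> \<Longrightarrow> Poly_Mapping.single (x, scl W c y) 1 - Poly_Mapping.single (x, y) c \<in> tensor_rel V W"
  unfolding tensor_rel_def
  by (rule fs.span_base, rule UnI2, blast)

text \<open>The generators of \<open>tensor_rel\<close> have entries in the carriers, so linearity
  of \<open>f\<close> and \<open>g\<close> on the carriers sends generators to generators.\<close>

lemma tensor_map_coset:
  assumes f: "linear_on V V' f" and g: "linear_on W W' g"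
  shows "tensor_map V' W' f g (t +o tensor_rel V W) =
    lin_ext (\<lambda>(x, y). Poly_Mapping.single (f x, g y) 1) t +o tensor_rel V' W'"
  unfolding tensor_map_def
proof (rule the_elem_coset)
  show "lin_ext (\<lambda>(x, y). Poly_Mapping.single (f x, g y) 1) u \<in> tensor_rel V' W'"
    if u: "u \<in> tensor_rel V W" for u
  proof (rule tensor_rel_lift[OF tensor_rel_subspace _ _ _ _ u])
    note fg = f[unfolded linear_on_def] g[unfolded linear_on_def]
    fix x x' y assume "x \<in> carr V" "x' \<in> carr V" "y \<in> carr W"
    with fg show "(case (x + x', y) of (x, y) \<Rightarrow> Poly_Mapping.single (f x, g y) 1) -
        (case (x, y) of (x, y) \<Rightarrow> Poly_Mapping.single (f x, g y) 1) -
        (case (x', y) of (x, y) \<Rightarrow> Poly_Mapping.single (f x, g y) 1) \<in> tensor_rel V' W'"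
      by (simp add: tensor_rel_add_left)
  next
    note fg = f[unfolded linear_on_def] g[unfolded linear_on_def]
    fix x y y' assume "x \<in> carr V" "y \<in> carr W" "y' \<in> carr W"
    with fg show "(case (x, y + y') of (x, y) \<Rightarrow> Poly_Mapping.single (f x, g y) 1) -
        (case (x, y) of (x, y) \<Rightarrow> Poly_Mapping.single (f x, g y) 1) -
        (case (x, y') of (x, y) \<Rightarrow> Poly_Mapping.single (f x, g y) 1) \<in> tensor_rel V' W'"
      by (simp add: tensor_rel_add_right)
  next
    note fg = f[unfolded linear_on_def] g[unfolded linear_on_def]
    fix c x y assume "x \<in> carr V" "y \<in> carr W"
    with fg show "(case (scl V c x, y) of (x, y) \<Rightarrow> Poly_Mapping.single (f x, g y) 1) -
        fscale c (case (x, y) of (x, y) \<Rightarrow> Poly_Mapping.single (f x, g y) 1) \<in> tensor_rel V' W'"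
      by (simp add: fscale_single tensor_rel_scl_left)
  next
    note fg = f[unfolded linear_on_def] g[unfolded linear_on_def]
    fix c x y assume "x \<in> carr V" "y \<in> carr W"
    with fg show "(case (x, scl W c y) of (x, y) \<Rightarrow> Poly_Mapping.single (f x, g y) 1) -
        fscale c (case (x, y) of (x, y) \<Rightarrow> Poly_Mapping.single (f x, g y) 1) \<in> tensor_rel V' W'"
      by (simp add: fscale_single tensor_rel_scl_right)
  qed
qed (simp_all add: tensor_rel_subgrp le.add)

section \<open>The symmetric relations\<close>

definition sym_gens :: "('k::field, 'v::plus) gvspace \<Rightarrow> ('v word \<Rightarrow>\<^sub>0 'k) set" where
  "sym_gens V =
     {Poly_Mapping.single (xs @ (i, u + v) # ys) 1 - Poly_Mapping.single (xs @ (i, u) # ys) 1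
        - Poly_Mapping.single (xs @ (i, v) # ys) 1
        | xs ys i u v. xs \<in> words V \<and> ys \<in> words V \<and> u \<in> carr (V i) \<and> v \<in> carr (V i)} \<union>
     {Poly_Mapping.single (xs @ (i, scl (V i) c u) # ys) 1 - Poly_Mapping.single (xs @ (i, u) # ys) c
        | xs ys i u c. xs \<in> words V \<and> ys \<in> words V \<and> u \<in> carr (V i)} \<union>
     {Poly_Mapping.single (xs @ (i, u) # (j, v) # ys) 1
        - Poly_Mapping.single (xs @ (j, v) # (i, u) # ys) (sg (i * j))
        | xs ys i u j v. xs \<in> words V \<and> ys \<in> words V \<and> u \<in> carr (V i) \<and> v \<in> carr (V j)}"

lemma sym_rel_span: "sym_rel V = fs.span (sym_gens V)"
  by (simp only: sym_rel_def sym_gens_def)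

lemma gen_add:
  "\<lbrakk>xs \<in> words V; ys \<in> words V; u \<in> carr (V i); v \<in> carr (V i)\<rbrakk> \<Longrightarrow>
    Poly_Mapping.single (xs @ (i, u + v) # ys) 1 - Poly_Mapping.single (xs @ (i, u) # ys) 1
        - Poly_Mapping.single (xs @ (i, v) # ys) 1 \<in> sym_gens V"
  unfolding sym_gens_def by (rule UnI1, rule UnI1, blast)

lemma gen_scl:
  "\<lbrakk>xs \<in> words V; ys \<in> words V; u \<in> carr (V i)\<rbrakk> \<Longrightarrow>
    Poly_Mapping.single (xs @ (i, scl (V i) c u) # ys) 1 - Poly_Mapping.single (xs @ (i, u) # ys) c
      \<in> sym_gens V"
  unfolding sym_gens_def by (rule UnI1, rule UnI2, blast)

lemma gen_swap:
  "\<lbrakk>xs \<in> words V; ys \<in> words V; u \<in> carr (V i); v \<in> carr (V j)\<rbrakk> \<Longrightarrow>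
    Poly_Mapping.single (xs @ (i, u) # (j, v) # ys) 1
        - Poly_Mapping.single (xs @ (j, v) # (i, u) # ys) (sg (i * j)) \<in> sym_gens V"
  unfolding sym_gens_def by (rule UnI2, blast)

lemma sym_gens_cases [consumes 1, case_names add scl swap]:
  assumes "g \<in> sym_gens V"
    and "\<And>xs ys i u v. \<lbrakk>g = Poly_Mapping.single (xs @ (i, u + v) # ys) 1
        - Poly_Mapping.single (xs @ (i, u) # ys) 1 - Poly_Mapping.single (xs @ (i, v) # ys) 1;
      xs \<in> words V; ys \<in> words V; u \<in> carr (V i); v \<in> carr (V i)\<rbrakk> \<Longrightarrow> P"
    and "\<And>xs ys i u c. \<lbrakk>g = Poly_Mapping.single (xs @ (i, scl (V i) c u) # ys) 1
        - Poly_Mapping.single (xs @ (i, u) # ys) c;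
      xs \<in> words V; ys \<in> words V; u \<in> carr (V i)\<rbrakk> \<Longrightarrow> P"
    and "\<And>xs ys i u j v. \<lbrakk>g = Poly_Mapping.single (xs @ (i, u) # (j, v) # ys) 1
        - Poly_Mapping.single (xs @ (j, v) # (i, u) # ys) (sg (i * j));
      xs \<in> words V; ys \<in> words V; u \<in> carr (V i); v \<in> carr (V j)\<rbrakk> \<Longrightarrow> P"
  shows P
  using assms(1) unfolding sym_gens_def
  by (elim UnE CollectE exE conjE) (erule (4) assms(2), erule (3) assms(3), erule (4) assms(4))

lemma wdeg_simps [simp]:
  "wdeg [] = 0" "wdeg (l # w) = fst l + wdeg w" "wdeg (w @ w') = wdeg w + wdeg w'"
  by (auto simp: wdeg_def split_def)

lemma words_simps [simp]:
  "[] \<in> words V" "l # w \<in> words V \<longleftrightarrow> snd l \<in> carr (V (fst l)) \<and> w \<in> words V"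
  "w @ w' \<in> words V \<longleftrightarrow> w \<in> words V \<and> w' \<in> words V"
  by (auto simp: words_def)

lemma sg_simps [simp]:
  "sg 0 = 1" "sg (a + b) = sg a * sg b" "sg a * sg a = 1" "sg a * (sg a * x) = x"
  by (auto simp: sg_def)

text \<open>Multiplication in the tensor algebra by a word from the left and a word from the
  right.\<close>

definition pad :: "'l list \<Rightarrow> 'l list \<Rightarrow> ('l list \<Rightarrow>\<^sub>0 'k::field) \<Rightarrow> ('l list \<Rightarrow>\<^sub>0 'k)" where
  "pad xs ys = lin_ext (\<lambda>w. Poly_Mapping.single (xs @ w @ ys) 1)"

definition wt :: "('x \<Rightarrow> 'k) \<Rightarrow> ('x \<Rightarrow>\<^sub>0 'k::field) \<Rightarrow> ('x \<Rightarrow>\<^sub>0 'k)" where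
  "wt c = lin_ext (\<lambda>w. Poly_Mapping.single w (c w))"

lemma lookup_wt: "Poly_Mapping.lookup (wt c f) w = c w * Poly_Mapping.lookup f w"
proof -
  have "Poly_Mapping.lookup (wt c f) w = (\<Sum>x\<in>Poly_Mapping.keys f.
    Poly_Mapping.lookup f x * (c x when x = w))"
    by (simp add: wt_def lin_ext_def lookup_sum lookup_fscale lookup_single)
  also have "\<dots> = (\<Sum>x\<in>Poly_Mapping.keys f. if x = w then c w * Poly_Mapping.lookup f w else 0)"
    by (intro sum.cong) (auto simp: when_def)
  also have "\<dots> = c w * Poly_Mapping.lookup f w"
    by (simp add: in_keys_iff)
  finally show ?thesis .
qed

lemma pad_single: "pad xs ys (Poly_Mapping.single w c) = Poly_Mapping.single (xs @ w @ ys) c"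
  by (simp add: pad_def lin_simps)

lemma wt_single: "wt d (Poly_Mapping.single w c) = Poly_Mapping.single w (c * d w)"
  by (simp add: wt_def lin_simps)

lemma wt_const: "(\<And>w. w \<in> Poly_Mapping.keys f \<Longrightarrow> c w = k) \<Longrightarrow> wt c f = fscale k f"
  by (intro poly_mapping_eqI) (auto simp: lookup_wt lookup_fscale in_keys_iff)

interpretation pad: Vector_Spaces.linear fscale fscale "pad xs ys" for xs ys :: "'l list"
  unfolding pad_def by (rule lin_ext_linear)

interpretation wt: Vector_Spaces.linear fscale fscale "wt c" for c
  unfolding wt_def by (rule lin_ext_linear)

text \<open>Generators already sit between arbitrary words, and padding just lengthens these. Hence
  the relations form a two-sided ideal of the tensor algebra.\<close>

lemma sym_gens_ext:
  assumes "g \<in> sym_gens V" "as \<in> words V" "bs \<in> words V"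
  shows "pad as bs g \<in> sym_gens V"
  using assms(1)
proof (cases rule: sym_gens_cases)
  case (add xs ys i u v)
  then show ?thesis using gen_add[of "as @ xs" V "ys @ bs" u i v] assms
    by (simp add: pad.diff pad_single)
next
  case (scl xs ys i u c)
  then show ?thesis using gen_scl[of "as @ xs" V "ys @ bs" u i c] assms
    by (simp add: pad.diff pad_single)
next
  case (swap xs ys i u j v)
  then show ?thesis using gen_swap[of "as @ xs" V "ys @ bs" u i v j] assms
    by (simp add: pad.diff pad_single)
qed

text \<open>The assumptions are closure properties only, because the vectors of H[2] are cosets
  under elementwise addition of sets, where the type class zero is not the zero class.\<close>

locale gvs =
  fixes V :: "('k::field_char_0, 'v::plus) gvspace"
  assumes carr_add: "u \<in> carr (V i) \<Longrightarrow> v \<in> carr (V i) \<Longrightarrow> u + v \<in> carr (V i)"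
    and carr_scl: "u \<in> carr (V i) \<Longrightarrow> scl (V i) c u \<in> carr (V i)"
begin

text \<open>Multilinearity and swaps preserve the number of letters and the total degree. This lets
  weights by length and by degree descend to \<open>Sym V\<close>.\<close>

lemma sym_gens_homogeneous:
  assumes "g \<in> sym_gens V"
  obtains n d where "Poly_Mapping.keys g \<subseteq> {w \<in> words V. length w = n \<and> wdeg w = d}"
  using assms
proof (cases rule: sym_gens_cases)
  case (add xs ys i u v)
  show ?thesis
    by (rule that[of "length xs + length ys + 1" "wdeg xs + wdeg ys + i"], unfold add(1),
      intro subspace_supp[THEN fs.subspace_diff, unfolded mem_Collect_eq])
      (use add carr_add in auto)
next
  case (scl xs ys i u c)
  show ?thesis
    by (rule that[of "length xs + length ys + 1" "wdeg xs + wdeg ys + i"], unfold scl(1),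
      intro subspace_supp[THEN fs.subspace_diff, unfolded mem_Collect_eq])
      (use scl carr_scl in auto)
next
  case (swap xs ys i u j v)
  show ?thesis
    by (rule that[of "length xs + length ys + 2" "wdeg xs + wdeg ys + i + j"], unfold swap(1),
      intro subspace_supp[THEN fs.subspace_diff, unfolded mem_Collect_eq])
      (use swap in auto)
qed

lemma sym_rel_subspace: "fs.subspace (sym_rel V)"
  unfolding sym_rel_span by (rule fs.subspace_span)

lemmas sym_rel_add = fs.subspace_add[OF sym_rel_subspace]
  and sym_rel_diff = fs.subspace_diff[OF sym_rel_subspace]
  and sym_rel_scale = fs.subspace_scale[OF sym_rel_subspace]
  and sym_rel_sum = fs.subspace_sum[OF sym_rel_subspace]
  and sym_rel_0 [simp] = fs.subspace_0[OF sym_rel_subspace]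
  and sym_rel_neg = fs.subspace_neg[OF sym_rel_subspace]

lemma sym_rel_subgrp [simp]: "subgrp (sym_rel V)"
  by (rule subspace_subgrp[OF sym_rel_subspace])

lemma sym_rel_gen: "g \<in> sym_gens V \<Longrightarrow> g \<in> sym_rel V"
  unfolding sym_rel_span by (rule fs.span_base)

lemma sym_rel_words: "f \<in> sym_rel V \<Longrightarrow> Poly_Mapping.keys f \<subseteq> words V"
  using fs.span_minimal[of "sym_gens V" "{f. Poly_Mapping.keys f \<subseteq> words V}", OF _ subspace_supp]
    sym_gens_homogeneous unfolding sym_rel_span by blast

lemma sym_rel_ext:
  assumes "f \<in> sym_rel V" "as \<in> words V" "bs \<in> words V" shows "pad as bs f \<in> sym_rel V"
  using assms(1) unfolding sym_rel_span
  by (rule lin_span[OF _ fs.subspace_span, rotated -1])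
    (auto intro: fs.span_base sym_gens_ext assms pad.linear_axioms)

lemma sym_gens_wt:
  assumes "g \<in> sym_gens V"
  obtains k where "wt (\<lambda>w. c (length w) (wdeg w)) g = fscale k g"
proof -
  from sym_gens_homogeneous[OF assms] obtain n d
    where "Poly_Mapping.keys g \<subseteq> {w \<in> words V. length w = n \<and> wdeg w = d}" .
  then have "wt (\<lambda>w. c (length w) (wdeg w)) g = fscale (c n d) g"
    by (intro wt_const) auto
  then show ?thesis by (rule that)
qed

lemma sym_rel_wt:
  assumes "f \<in> sym_rel V" shows "wt (\<lambda>w. c (length w) (wdeg w)) f \<in> sym_rel V"
proof (rule lin_span[OF wt.linear_axioms sym_rel_subspace _ assms[unfolded sym_rel_span]])
  fix g assume g: "g \<in> sym_gens V"
  obtain k where "wt (\<lambda>w. c (length w) (wdeg w)) g = fscale k g"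
    using sym_gens_wt[OF g] .
  then show "wt (\<lambda>w. c (length w) (wdeg w)) g \<in> sym_rel V"
    using sym_rel_scale[OF sym_rel_gen[OF g]] by simp
qed

end

section \<open>Pairs of words\<close>

definition box :: "('x \<Rightarrow>\<^sub>0 'k::field) \<Rightarrow> ('y \<Rightarrow>\<^sub>0 'k) \<Rightarrow> ('x \<times> 'y \<Rightarrow>\<^sub>0 'k)" where
  "box f g = lin_ext (\<lambda>a. lin_ext (\<lambda>b. Poly_Mapping.single (a, b) 1) g) f"

lemma box_flip: "box f g = lin_ext (\<lambda>b. lin_ext (\<lambda>a. Poly_Mapping.single (a, b) 1) f) g"
  by (simp add: box_def lin_ext_def fs.scale_sum_right sum.swap[of _ "Poly_Mapping.keys g"]
      mult.commute)

interpretation box_left: Vector_Spaces.linear fscale fscale "\<lambda>f. box f g" for g :: "'y \<Rightarrow>\<^sub>0 'k::field"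
  unfolding box_def by (rule lin_ext_linear)

interpretation box_right: Vector_Spaces.linear fscale fscale "box f" for f :: "'x \<Rightarrow>\<^sub>0 'k::field"
  unfolding box_flip[abs_def] by (rule lin_ext_linear)

lemma box_single: "box (Poly_Mapping.single a c) (Poly_Mapping.single b d) =
    Poly_Mapping.single (a, b) (c * d)"
  by (simp add: box_def lin_simps)

lemmas box_simps = box_left.add box_right.add box_left.diff box_right.diff box_left.scale
  box_right.scale box_left.zero box_right.zero box_left.sum box_right.sum box_single

lemma lin_induct2 [case_names add_left add_right single]:
  fixes f :: "'x \<Rightarrow>\<^sub>0 'k::field" and g :: "'y \<Rightarrow>\<^sub>0 'k"
  assumes f: "Poly_Mapping.keys f \<subseteq> A" and g: "Poly_Mapping.keys g \<subseteq> B"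
    and z: "\<And>f. P f 0" "\<And>g. P 0 g"
    and "\<And>f f' g. P f g \<Longrightarrow> P f' g \<Longrightarrow> P (f + f') g"
    and "\<And>f g g'. P f g \<Longrightarrow> P f g' \<Longrightarrow> P f (g + g')"
    and "\<And>a b c d. a \<in> A \<Longrightarrow> b \<in> B \<Longrightarrow> P (Poly_Mapping.single a c) (Poly_Mapping.single b d)"
  shows "P f g"
  using f
proof (induction rule: supp_induct)
  case (single a c)
  show ?case using g by (induction rule: supp_induct) (use assms single in auto)
qed (use assms in auto)

text \<open>Multiplication by \<open>v \<otimes> 1 + 1 \<otimes> v\<close> from the left.\<close>

definition ell :: "int \<times> 'v \<Rightarrow> ('v word \<times> 'v word \<Rightarrow>\<^sub>0 'k::field) \<Rightarrow> ('v word \<times> 'v word \<Rightarrow>\<^sub>0 'k)" where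
  "ell v = lin_ext (\<lambda>(a, b). Poly_Mapping.single (v # a, b) 1
     + Poly_Mapping.single (a, v # b) (sg (fst v * wdeg a)))"

interpretation ell: Vector_Spaces.linear fscale fscale "ell v" for v :: "int \<times> 'v"
  unfolding ell_def by (rule lin_ext_linear)

lemma ell_single: "ell v (Poly_Mapping.single (a, b) c) =
  Poly_Mapping.single (v # a, b) c + Poly_Mapping.single (a, v # b) (c * sg (fst v * wdeg a))"
  by (simp add: ell_def lin_simps)

lemma comult_word_Cons: "comult_word (v # w) = ell v (comult_word w)"
  by (simp add: tmult_def lin_simps ell_def lin_ext_fun_add split_def)

declare comult_word.simps(2) [simp del] comult_word_Cons [simp]

text \<open>The letter \<open>v\<close> reaches the right factor by passing the left one; the Koszul
  sign depends on the degree of each word of \<open>f\<close>, hence the weight on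
  \<open>f\<close>.\<close>

lemma ell_box:
  "ell v (box f g) = box (pad [v] [] f) g + box (wt (\<lambda>w. sg (fst v * wdeg w)) f) (pad [v] [] g)"
  by (rule lin_induct2[of f UNIV g UNIV])
    (simp_all add: box_simps ell.zero pad.zero wt.zero ell.add pad.add wt.add ell_single
      pad_single wt_single algebra_simps)

section \<open>Comultiplication followed by weighted multiplication\<close>

text \<open>The product of the tensor algebra, weighted by the lengths of the factors: weight 1 is
  the product itself, an indicator of (p, q) first projects to the factors of these lengths.\<close>

definition mulw :: "(nat \<Rightarrow> nat \<Rightarrow> 'k) \<Rightarrow> ('l list \<times> 'l list \<Rightarrow>\<^sub>0 'k::field) \<Rightarrow> ('l list \<Rightarrow>\<^sub>0 'k)" where
  "mulw h = lin_ext (\<lambda>(a, b). Poly_Mapping.single (a @ b) (h (length a) (length b)))"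

interpretation mulw: Vector_Spaces.linear fscale fscale "mulw h" for h
  unfolding mulw_def by (rule lin_ext_linear)

lemma mulw_single: "mulw h (Poly_Mapping.single (a, b) c) =
    Poly_Mapping.single (a @ b) (c * h (length a) (length b))"
  by (simp add: mulw_def lin_simps)

text \<open>This is the sum over p + q = n of binom(n, p) h(p, q), by Pascal's rule: the first
  letter goes either to the left or to the right factor.\<close>

fun mulnum :: "(nat \<Rightarrow> nat \<Rightarrow> 'k::field) \<Rightarrow> nat \<Rightarrow> 'k" where
  "mulnum h 0 = h 0 0"
| "mulnum h (Suc n) = mulnum (\<lambda>p q. h (Suc p) q) n + mulnum (\<lambda>p q. h p (Suc q)) n"

lemma mulnum_one: "mulnum (\<lambda>p q. 1) n = 2 ^ n"
  by (induction n) auto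

lemma mulnum_zero: "mulnum (\<lambda>p q. 0) n = 0"
  by (induction n) auto

lemma mulnum_00: "mulnum (\<lambda>p q. of_bool (p = 0 \<and> q = 0)) n = of_bool (n = 0)"
  by (cases n) (auto simp: mulnum_zero)

lemma mulnum_10: "mulnum (\<lambda>p q. of_bool (p = Suc 0 \<and> q = 0)) n = of_bool (n = 1)"
  by (cases n) (auto simp: mulnum_zero mulnum_00)

lemma mulnum_01: "mulnum (\<lambda>p q. of_bool (p = 0 \<and> q = Suc 0)) n = of_bool (n = 1)"
  by (cases n) (auto simp: mulnum_zero mulnum_00)

lemma mulnum_11:
  "mulnum (\<lambda>p q. of_bool (p = Suc 0 \<and> q = Suc 0)) n = 2 * of_bool (n = 2)"
  by (cases n) (auto simp: mulnum_10 mulnum_01)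

lemma lin_ext_comult_ext:
  "lin_ext comult_word (pad (v # xs) [] g) = ell v (lin_ext comult_word (pad xs [] g))"
  using subset_refl[of "Poly_Mapping.keys g"]
  by (induction g rule: supp_induct)
    (simp_all add: pad.zero le.zero ell.zero pad.add le.add ell.add pad_single lin_simps ell.scale)

lemma pad_Nil: "pad [] [] f = f"
  by (simp add: pad_def lin_ext_id)

context gvs
begin

lemma comult_word_words: "w \<in> words V \<Longrightarrow>
  Poly_Mapping.keys (comult_word w :: _ \<Rightarrow>\<^sub>0 'k) \<subseteq> words V \<times> words V"
proof (induction w)
  case (Cons v w)
  then have IH: "Poly_Mapping.keys (comult_word w :: _ \<Rightarrow>\<^sub>0 'k) \<subseteq> words V \<times> words V" by simp
  have v: "snd v \<in> carr (V (fst v))" using Cons.prems by simp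
  have "ell v (comult_word w) \<in> {f :: _ \<Rightarrow>\<^sub>0 'k. Poly_Mapping.keys f \<subseteq> words V \<times> words V}"
    unfolding ell_def
  proof (rule lin_ext_in_subspace[OF subspace_supp])
    fix x assume "x \<in> Poly_Mapping.keys (comult_word w :: _ \<Rightarrow>\<^sub>0 'k)"
    with IH have "x \<in> words V \<times> words V" by (rule subsetD)
    then obtain a b where x: "x = (a, b)" "a \<in> words V" "b \<in> words V" by (rule SigmaE)
    show "(case x of (a, b) \<Rightarrow> Poly_Mapping.single (v # a, b) 1
      + Poly_Mapping.single (a, v # b) (sg (fst v * wdeg a)))
      \<in> {f :: _ \<Rightarrow>\<^sub>0 'k. Poly_Mapping.keys f \<subseteq> words V \<times> words V}"
      unfolding x(1) prod.case mem_Collect_eq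
      by (rule keys_add_subset) (simp_all add: x v)
  qed
  then show ?case by (simp only: comult_word_Cons mem_Collect_eq)
qed simp

text \<open>Graded commutativity, iterated: the letter passes the letters of \<open>a\<close> one
  swap at a time and collects their signs. The prefix \<open>xs\<close> serves the induction, which
  moves letters of \<open>a\<close> into it.\<close>

lemma sym_rel_move:
  assumes "v \<in> carr (V i)" "xs \<in> words V" "a \<in> words V" "b \<in> words V"
  shows "Poly_Mapping.single (xs @ a @ (i, v) # b) (sg (i * wdeg a))
    - Poly_Mapping.single (xs @ (i, v) # a @ b) 1 \<in> sym_rel V"
  using assms(2,3)
proof (induction a arbitrary: xs)
  case (Cons l a)
  obtain j x where l: "l = (j, x)" by (cases l)
  have x: "x \<in> carr (V j)" "a \<in> words V" using Cons(3) l by auto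
  have "Poly_Mapping.single (xs @ l # a @ (i, v) # b) (sg (i * wdeg a))
    - Poly_Mapping.single (xs @ l # (i, v) # a @ b) 1 \<in> sym_rel V"
    using Cons.IH[of "xs @ [l]"] Cons.prems l by simp
  from sym_rel_scale[OF this, of "sg (i * j)"]
  have 1: "Poly_Mapping.single (xs @ l # a @ (i, v) # b) (sg (i * wdeg (l # a)))
    - Poly_Mapping.single (xs @ l # (i, v) # a @ b) (sg (i * j)) \<in> sym_rel V"
    by (simp add: lin_simps l distrib_left)
  have "Poly_Mapping.single (xs @ (i, v) # l # a @ b) 1
    - Poly_Mapping.single (xs @ l # (i, v) # a @ b) (sg (i * j)) \<in> sym_rel V"
    unfolding l using Cons.prems x assms by (intro sym_rel_gen gen_swap) auto
  from sym_rel_diff[OF 1 this] show ?case by simp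
qed simp

text \<open>When \<open>v\<close> is put into the right factor, \<open>ell\<close> contributes the
  sign of passing the left factor; moving \<open>v\<close> to the front of the product contributes
  the same sign, and the two cancel.\<close>

lemma mulw_ell:
  assumes "Poly_Mapping.keys t \<subseteq> words V \<times> words V" "snd v \<in> carr (V (fst v))"
  shows "mulw h (ell v t) - pad [v] [] (mulw (\<lambda>p q. h (Suc p) q) t + mulw (\<lambda>p q. h p (Suc q)) t)
    \<in> sym_rel V"
  using assms(1)
proof (induction rule: supp_induct)
  case (single x c)
  obtain a b where x: "x = (a, b)" by (cases x)
  obtain i u where v: "v = (i, u)" by (cases v)
  have "Poly_Mapping.single (a @ v # b) (sg (i * wdeg a)) - Poly_Mapping.single (v # a @ b) 1
    \<in> sym_rel V"
    using sym_rel_move[of u i "[]" a b] assms(2) single unfolding v x by simp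
  from sym_rel_scale[OF this, of "c * h (length a) (Suc (length b))"]
  show ?case
    by (simp add: x v ell_single mulw.add mulw_single pad.add pad_single lin_simps mult_ac)
next
  case (add t t')
  from sym_rel_add[OF this] show ?case
    by (simp add: ell.add mulw.add pad.add algebra_simps)
qed (simp add: ell.zero mulw.zero pad.zero)

text \<open>Comultiplication distributes the letters over two factors, and multiplying back restores
  the word up to swaps with all signs cancelling. What is left is the weighted count of
  distributions. Each letter shifts one argument of \<open>h\<close>, so \<open>h\<close> must vary
  in the induction.\<close>

lemma mulw_comult_word:
  "w \<in> words V \<Longrightarrow>
    mulw h (comult_word w) - Poly_Mapping.single w (mulnum h (length w)) \<in> sym_rel V"
proof (induction w arbitrary: h)
  case (Cons v w)
  then have v: "snd v \<in> carr (V (fst v))" and w: "w \<in> words V" by auto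
  have "pad [v] [] (mulw (\<lambda>p q. h (Suc p) q) (comult_word w)
      - Poly_Mapping.single w (mulnum (\<lambda>p q. h (Suc p) q) (length w))
    + (mulw (\<lambda>p q. h p (Suc q)) (comult_word w)
      - Poly_Mapping.single w (mulnum (\<lambda>p q. h p (Suc q)) (length w)))) \<in> sym_rel V"
    using v by (intro sym_rel_ext sym_rel_add Cons.IH w) auto
  from sym_rel_add[OF this mulw_ell[OF comult_word_words[OF w] v, of h]]
  show ?case by (simp add: pad.add pad.diff pad_single single_add algebra_simps)
qed (simp add: mulw_single)

lemma mulw_comult:
  assumes "Poly_Mapping.keys f \<subseteq> words V"
  shows "mulw h (lin_ext comult_word f) - wt (\<lambda>w. mulnum h (length w)) f \<in> sym_rel V"
  using assms
proof (induction rule: supp_induct)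
  case (single w c)
  from sym_rel_scale[OF mulw_comult_word[OF single, of h], of c] show ?case
    by (simp add: lin_simps mulw.scale wt_single)
next
  case (add f g)
  from sym_rel_add[OF this] show ?case
    by (simp add: le.add mulw.add wt.add algebra_simps)
qed (simp add: le.zero mulw.zero wt.zero)

text \<open>For a fixed right word the weight depends only on the length of the left word, along
  which relations are homogeneous; so weighting and padding a relation gives a relation.\<close>

lemma mulw_box_left:
  assumes "f \<in> sym_rel V" "Poly_Mapping.keys g \<subseteq> words V"
  shows "mulw h (box f g) \<in> sym_rel V"
  using assms(2)
proof (induction rule: supp_induct)
  case (single b c)
  have "mulw h (box f (Poly_Mapping.single b c)) =
    fscale c (pad [] b (wt (\<lambda>w. h (length w) (length b)) f))"
    using subset_refl[of "Poly_Mapping.keys f"]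
    by (induction f rule: supp_induct) (simp_all add: box_simps mulw.zero pad.zero wt.zero
      mulw.add pad.add wt.add mulw_single pad_single wt_single lin_simps mult_ac)
  then show ?case
    using sym_rel_wt[OF assms(1), of "\<lambda>n d. h n (length b)"] single
    by (simp add: sym_rel_scale sym_rel_ext)
qed (simp_all add: box_simps mulw.zero mulw.add sym_rel_add)

lemma mulw_box_right:
  assumes "g \<in> sym_rel V" "Poly_Mapping.keys f \<subseteq> words V"
  shows "mulw h (box f g) \<in> sym_rel V"
  using assms(2)
proof (induction rule: supp_induct)
  case (single a c)
  have "mulw h (box (Poly_Mapping.single a c) g) =
    fscale c (pad a [] (wt (\<lambda>w. h (length a) (length w)) g))"
    using subset_refl[of "Poly_Mapping.keys g"]
    by (induction g rule: supp_induct) (simp_all add: box_simps mulw.zero pad.zero wt.zero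
      mulw.add pad.add wt.add mulw_single pad_single wt_single lin_simps mult_ac)
  then show ?case
    using sym_rel_wt[OF assms(1), of "\<lambda>n d. h (length a) n"] single
    by (simp add: sym_rel_scale sym_rel_ext)
qed (simp_all add: box_simps mulw.zero mulw.add sym_rel_add)

section \<open>The comultiplication respects the relations\<close>

text \<open>For the ideal I of relations and words on the carriers, this is I \<otimes> T + T
  \<otimes> I, the relations of \<open>Sym V\<close> \<otimes> \<open>Sym V\<close> seen on pairs of
  words.\<close>

definition box_rel :: "('v word \<times> 'v word \<Rightarrow>\<^sub>0 'k) set" where
  "box_rel = fs.span ({box g (Poly_Mapping.single b 1) | g b. g \<in> sym_gens V \<and> b \<in> words V} \<union>
     {box (Poly_Mapping.single a 1) g | g a. g \<in> sym_gens V \<and> a \<in> words V})"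

lemma box_rel_subspace: "fs.subspace box_rel"
  unfolding box_rel_def by (rule fs.subspace_span)

lemma box_rel_gens:
  "g \<in> sym_gens V \<Longrightarrow> b \<in> words V \<Longrightarrow> box g (Poly_Mapping.single b 1) \<in> box_rel"
  "g \<in> sym_gens V \<Longrightarrow> b \<in> words V \<Longrightarrow> box (Poly_Mapping.single b 1) g \<in> box_rel"
  unfolding box_rel_def by (rule fs.span_base; blast)+

lemmas box_rel_add = fs.subspace_add[OF box_rel_subspace]
  and box_rel_scale = fs.subspace_scale[OF box_rel_subspace]

text \<open>The sign by which \<open>ell\<close> weights the left factor is one scalar on a
  homogeneous generator, so a generator in either factor stays a multiple of a generator.\<close>

lemma ell_box_rel:
  assumes v: "snd v \<in> carr (V (fst v))" and "t \<in> box_rel" shows "ell v t \<in> box_rel"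
proof (rule lin_span[OF ell.linear_axioms box_rel_subspace _ assms(2)[unfolded box_rel_def]])
  fix t :: "'v word \<times> 'v word \<Rightarrow>\<^sub>0 'k"
  assume "t \<in> {box g (Poly_Mapping.single b 1) | g b. g \<in> sym_gens V \<and> b \<in> words V} \<union>
     {box (Poly_Mapping.single a 1) g | g a. g \<in> sym_gens V \<and> a \<in> words V}"
  then consider g b where "t = box g (Poly_Mapping.single b 1)" "g \<in> sym_gens V" "b \<in> words V"
    | g a where "t = box (Poly_Mapping.single a 1) g" "g \<in> sym_gens V" "a \<in> words V" by blast
  then show "ell v t \<in> box_rel"
  proof cases
    case (1 g b)
    obtain k where "wt (\<lambda>w. sg (fst v * wdeg w)) g = fscale k g"
      using sym_gens_wt[OF 1(2), of "\<lambda>n d. sg (fst v * d)"] by auto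
    then show ?thesis using 1 v
      by (simp add: ell_box pad_single box_left.scale box_rel_add box_rel_scale box_rel_gens
          sym_gens_ext)
  next
    case (2 g a)
    have "box (Poly_Mapping.single a (sg (fst v * wdeg a))) (pad [v] [] g) =
      fscale (sg (fst v * wdeg a)) (box (Poly_Mapping.single a 1) (pad [v] [] g))"
      unfolding box_left.scale[symmetric] by (simp add: fscale_single)
    then show ?thesis using 2 v
      by (simp add: ell_box pad_single wt_single box_rel_add box_rel_scale box_rel_gens
          sym_gens_ext)
  qed
qed

text \<open>Together with the next two lemmas: \<open>ell\<close> respects each of the three kinds
  of generators at the front of a word.\<close>

lemma ell_add_rel:
  assumes "Poly_Mapping.keys t \<subseteq> words V \<times> words V" "u \<in> carr (V i)" "v \<in> carr (V i)"
  shows "ell (i, u + v) t - ell (i, u) t - ell (i, v) t \<in> box_rel"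
  using assms(1)
proof (induction rule: supp_induct)
  case (single x c)
  obtain a b where x: "x = (a, b)" by (cases x)
  let ?g = "\<lambda>w. Poly_Mapping.single ((i, u + v) # w) 1 - Poly_Mapping.single ((i, u) # w) 1
        - Poly_Mapping.single ((i, v) # w) 1 :: _ \<Rightarrow>\<^sub>0 'k"
  have "fscale c (box (?g a) (Poly_Mapping.single b 1)) +
    fscale (c * sg (i * wdeg a)) (box (Poly_Mapping.single a 1) (?g b)) \<in> box_rel"
    using single assms(2,3) gen_add[of "[]" V a u i v] gen_add[of "[]" V b u i v]
    by (intro box_rel_add box_rel_scale box_rel_gens) (auto simp: x)
  then show ?case
    by (simp add: x ell_single box_simps lin_simps algebra_simps)
next
  case (add t t')
  from box_rel_add[OF this] show ?case by (simp add: ell.add algebra_simps)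
qed (simp add: ell.zero fs.subspace_0[OF box_rel_subspace])

lemma ell_scl_rel:
  assumes "Poly_Mapping.keys t \<subseteq> words V \<times> words V" "u \<in> carr (V i)"
  shows "ell (i, scl (V i) k u) t - fscale k (ell (i, u) t) \<in> box_rel"
  using assms(1)
proof (induction rule: supp_induct)
  case (single x c)
  obtain a b where x: "x = (a, b)" by (cases x)
  let ?g = "\<lambda>w. Poly_Mapping.single ((i, scl (V i) k u) # w) 1
        - Poly_Mapping.single ((i, u) # w) k :: _ \<Rightarrow>\<^sub>0 'k"
  have "fscale c (box (?g a) (Poly_Mapping.single b 1)) +
    fscale (c * sg (i * wdeg a)) (box (Poly_Mapping.single a 1) (?g b)) \<in> box_rel"
    using single assms(2) gen_scl[of "[]" V a u i k] gen_scl[of "[]" V b u i k]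
    by (intro box_rel_add box_rel_scale box_rel_gens) (auto simp: x)
  then show ?case
    by (simp add: x ell_single box_simps lin_simps algebra_simps)
next
  case (add t t')
  from box_rel_add[OF this] show ?case by (simp add: ell.add fs.scale_right_distrib algebra_simps)
qed (simp add: ell.zero fs.subspace_0[OF box_rel_subspace])

text \<open>The mixed terms, with one of the two letters in each factor, cancel by the Koszul signs.
  What remains is a swap relation in the left factor and one in the right factor.\<close>

lemma ell_swap_rel:
  assumes "Poly_Mapping.keys t \<subseteq> words V \<times> words V" "u \<in> carr (V i)" "v \<in> carr (V j)"
  shows "ell (i, u) (ell (j, v) t) - fscale (sg (i * j)) (ell (j, v) (ell (i, u) t)) \<in> box_rel"
  using assms(1)
proof (induction rule: supp_induct)
  case (single x c)
  obtain a b where x: "x = (a, b)" by (cases x)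
  let ?g = "\<lambda>w. Poly_Mapping.single ((i, u) # (j, v) # w) 1
        - Poly_Mapping.single ((j, v) # (i, u) # w) (sg (i * j)) :: _ \<Rightarrow>\<^sub>0 'k"
  have "fscale c (box (?g a) (Poly_Mapping.single b 1)) +
    fscale (c * sg (i * wdeg a) * sg (j * wdeg a)) (box (Poly_Mapping.single a 1) (?g b)) \<in> box_rel"
    using single assms(2,3) gen_swap[of "[]" V a u i v j] gen_swap[of "[]" V b u i v j]
    by (intro box_rel_add box_rel_scale box_rel_gens) (auto simp: x)
  then show ?case
    by (simp add: x ell.add ell_single box_simps lin_simps algebra_simps)
next
  case (add t t')
  from box_rel_add[OF this] show ?case by (simp add: ell.add fs.scale_right_distrib algebra_simps)
qed (simp add: ell.zero fs.subspace_0[OF box_rel_subspace])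

lemma comult_prefix_rel:
  assumes "lin_ext comult_word g \<in> box_rel" "xs \<in> words V"
  shows "lin_ext comult_word (pad xs [] g) \<in> box_rel"
  using assms(2)
proof (induction xs)
  case Nil
  then show ?case using assms(1) by (simp add: pad_def lin_ext_id)
next
  case (Cons v xs)
  then show ?case using ell_box_rel by (simp add: lin_ext_comult_ext)
qed

text \<open>The letters that a generator relates are treated by the \<open>ell\<close> relations
  over the comultiplication of the suffix \<open>ys\<close>; the prefix \<open>xs\<close> then acts
  by further applications of \<open>ell\<close>, which preserve \<open>box_rel\<close>.\<close>

lemma comult_box_rel:
  assumes "f \<in> sym_rel V" shows "lin_ext comult_word f \<in> box_rel"
proof (rule lin_span[OF le.linear_axioms box_rel_subspace _ assms[unfolded sym_rel_span]])
  fix g :: "'v word \<Rightarrow>\<^sub>0 'k" assume "g \<in> sym_gens V"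
  then show "lin_ext comult_word g \<in> box_rel"
  proof (cases rule: sym_gens_cases)
    case (add xs ys i u v)
    have "lin_ext comult_word (Poly_Mapping.single ((i, u + v) # ys) 1
        - Poly_Mapping.single ((i, u) # ys) 1 - Poly_Mapping.single ((i, v) # ys) (1 :: 'k)) \<in> box_rel"
      using ell_add_rel[OF comult_word_words] add by (simp add: lin_simps)
    from comult_prefix_rel[OF this add(2)] show ?thesis
      by (simp add: add(1) pad.diff pad_single)
  next
    case (scl xs ys i u c)
    have "lin_ext comult_word (Poly_Mapping.single ((i, scl (V i) c u) # ys) 1
        - Poly_Mapping.single ((i, u) # ys) c) \<in> box_rel"
      using ell_scl_rel[OF comult_word_words] scl by (simp add: lin_simps)
    from comult_prefix_rel[OF this scl(2)] show ?thesis
      by (simp add: scl(1) pad.diff pad_single)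
  next
    case (swap xs ys i u j v)
    have "lin_ext comult_word (Poly_Mapping.single ((i, u) # (j, v) # ys) 1
        - Poly_Mapping.single ((j, v) # (i, u) # ys) (sg (i * j) :: 'k)) \<in> box_rel"
      using ell_swap_rel[OF comult_word_words] swap by (simp add: lin_simps)
    from comult_prefix_rel[OF this swap(2)] show ?thesis
      by (simp add: swap(1) pad.diff pad_single)
  qed
qed

section \<open>The symmetric algebra\<close>

abbreviation cl :: "('v word \<Rightarrow>\<^sub>0 'k) \<Rightarrow> ('k, 'v) sym" where
  "cl f \<equiv> f +o sym_rel V"

lemma cl_eq_iff: "cl f = cl g \<longleftrightarrow> f - g \<in> sym_rel V"
  by (rule coset_eq_iff) simp

lemma cl_add: "cl f + cl g = cl (f + g)"
  by (rule coset_add) simp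

lemma carr_Sym: "carr (Sym V) = cl ` {f. Poly_Mapping.keys f \<subseteq> words V}"
  by (simp add: Sym_def quot_def)

lemma cl_carr: "Poly_Mapping.keys f \<subseteq> words V \<Longrightarrow> cl f \<in> carr (Sym V)"
  by (simp add: carr_Sym)

lemma scl_Sym: "scl (Sym V) c (cl f) = cl (fscale c f)"
proof -
  have "Vector_Spaces.linear fscale fscale (fscale c :: ('v word \<Rightarrow>\<^sub>0 'k) \<Rightarrow> _)"
    by unfold_locales (simp_all add: fs.scale_right_distrib mult.commute)
  then show ?thesis
    by (simp add: Sym_def quot_def coset_scale sym_rel_scale)
qed

lemma cl_mem_carr_iff: "cl f \<in> carr (Sym V) \<longleftrightarrow> Poly_Mapping.keys f \<subseteq> words V"
proof
  assume "cl f \<in> carr (Sym V)"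
  then obtain g where g: "Poly_Mapping.keys g \<subseteq> words V" "f - g \<in> sym_rel V"
    by (auto simp: carr_Sym cl_eq_iff)
  have "f - g + g \<in> {f. Poly_Mapping.keys f \<subseteq> words V}"
    using g sym_rel_words by (intro fs.subspace_add[OF subspace_supp]) auto
  then show "Poly_Mapping.keys f \<subseteq> words V" by simp
qed (rule cl_carr)

lemma monomial_cl: "monomial V w = cl (Poly_Mapping.single w 1)"
  by (simp add: monomial_def)

end

text \<open>Choosing a representative of the image of each monomial lifts a map of quotients to the
  free spaces, where it can be evaluated term by term.\<close>

lemma linear_on_Sym_lift:
  fixes V :: "('k::field_char_0, 'v::plus) gvspace" and W :: "('k, 'w::plus) gvspace"
  assumes V: "gvs V" and W: "gvs W" and F: "linear_on (Sym V) (Sym W) F"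
  obtains G where
    "\<And>f. Poly_Mapping.keys f \<subseteq> words V \<Longrightarrow> F (f +o sym_rel V) = lin_ext G f +o sym_rel W"
    "\<And>f. Poly_Mapping.keys f \<subseteq> words V \<Longrightarrow> Poly_Mapping.keys (lin_ext G f) \<subseteq> words W"
proof -
  interpret V: gvs V by fact
  interpret W: gvs W by fact
  have Fc: "F X \<in> carr (Sym W)" and Fs: "F (scl (Sym V) c X) = scl (Sym W) c (F X)"
    if "X \<in> carr (Sym V)" for X c
    using F that unfolding linear_on_def by blast+
  have Fa: "F (X + Y) = F X + F Y" if "X \<in> carr (Sym V)" "Y \<in> carr (Sym V)" for X Y
    using F that unfolding linear_on_def by blast
  define G where "G w = (SOME g. Poly_Mapping.keys g \<subseteq> words W \<and> F (V.cl (Poly_Mapping.single w 1)) = W.cl g)" for w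
  have G: "Poly_Mapping.keys (G w) \<subseteq> words W \<and> F (V.cl (Poly_Mapping.single w 1)) = W.cl (G w)"
    if "w \<in> words V" for w
  proof -
    have "F (V.cl (Poly_Mapping.single w 1)) \<in> carr (Sym W)"
      using that by (intro Fc V.cl_carr) simp
    then show ?thesis
      unfolding G_def W.carr_Sym by (intro someI_ex[of "\<lambda>g. Poly_Mapping.keys g \<subseteq> words W \<and> _ = W.cl g"]) auto
  qed
  have keys: "Poly_Mapping.keys (lin_ext G f) \<subseteq> words W" if "Poly_Mapping.keys f \<subseteq> words V" for f
    using lin_ext_in_subspace[OF subspace_supp, of f G "words W"] G that
    by (simp only: mem_Collect_eq) (meson subsetD)
  have "F (V.cl f) = W.cl (lin_ext G f) \<and> Poly_Mapping.keys f \<subseteq> words V"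
    if "Poly_Mapping.keys f \<subseteq> words V" for f
    using that
  proof (induction rule: supp_induct)
    case zero
    \<comment> \<open>The zero coset is 0 times itself, so homogeneity of \<open>F\<close>
      determines its image.\<close>
    have "V.cl 0 \<in> carr (Sym V)" by (rule V.cl_carr) simp
    moreover obtain g where "F (V.cl 0) = W.cl g"
      using Fc[OF calculation] by (auto simp only: W.carr_Sym)
    ultimately show ?case
      using Fs[of "V.cl 0" 0] by (simp only: V.scl_Sym W.scl_Sym) (simp add: le.zero)
  next
    case (single w c)
    have "V.cl (Poly_Mapping.single w 1) \<in> carr (Sym V)" using single by (intro V.cl_carr) simp
    from Fs[OF this, of c] show ?case
      using single G[OF single] by (simp add: V.scl_Sym W.scl_Sym lin_simps)
  next
    case (add f g)
    then show ?case
      using Fa[OF V.cl_carr V.cl_carr, of f g] keys_add_subset[of f "words V" g]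
      by (simp add: V.cl_add W.cl_add le.add)
  qed
  then show ?thesis using keys by (intro that[of G]) simp_all
qed

lemma linear_on_comp:
  "linear_on U V f \<Longrightarrow> linear_on V W g \<Longrightarrow> linear_on U W (g \<circ> f)"
  by (simp add: linear_on_def)

section \<open>Exponentials\<close>

text \<open>Both sums run over the triples with sum \<open>N\<close>; the regrouping makes the third
  entry the outer index.\<close>

lemma triangle_rotate:
  "(\<Sum>k\<le>N. \<Sum>i\<le>N - k. g k i (N - k - i)) = (\<Sum>j\<le>N. \<Sum>k\<le>N - j. g k (N - j - k) j)"
  for g :: "nat \<Rightarrow> nat \<Rightarrow> nat \<Rightarrow> 'b::comm_monoid_add"
  unfolding sum.Sigma[OF finite_atMost, OF ballI[OF finite_atMost]]
  by (rule sum.reindex_bij_witness[of _ "\<lambda>(j, k). (k, N - j - k)" "\<lambda>(k, i). (N - k - i, k)"])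
    (auto simp: diff_diff_eq)

lemma triangle_swap:
  "(\<Sum>k\<le>N. \<Sum>i\<le>N - k. g k i (N - k - i)) = (\<Sum>i\<le>N. \<Sum>k\<le>N - i. g k i (N - i - k))"
  for g :: "nat \<Rightarrow> nat \<Rightarrow> nat \<Rightarrow> 'b::comm_monoid_add"
  unfolding sum.Sigma[OF finite_atMost, OF ballI[OF finite_atMost]]
  by (rule sum.reindex_bij_witness[of _ "\<lambda>(i, k). (k, i)" "\<lambda>(k, i). (i, k)"])
    (auto simp: diff_diff_eq add.commute)

text \<open>The coefficients of \<open>e = exp (\<Sum>k. \<lambda>\<^sup>k\<^sup>+\<^sup>1 p\<^sub>k)\<close>, computed from
  \<open>\<lambda> e' = (\<Sum>k. (k + 1) \<lambda>\<^sup>k\<^sup>+\<^sup>1 p\<^sub>k) e\<close>.\<close>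

fun expw :: "(nat \<Rightarrow> 'l) \<Rightarrow> nat \<Rightarrow> ('l list \<Rightarrow>\<^sub>0 'k::field_char_0)" where
  "expw p 0 = Poly_Mapping.single [] 1"
| "expw p (Suc n) = fscale (1 / of_nat (Suc n))
    (\<Sum>k\<le>n. fscale (of_nat (Suc k)) (pad [p k] [] (expw p (n - k))))"

declare expw.simps(2) [simp del]

lemma expw_Suc: "fscale (of_nat (Suc n)) (expw p (Suc n) :: _ \<Rightarrow>\<^sub>0 'k::field_char_0) =
    (\<Sum>k\<le>n. fscale (of_nat (Suc k)) (pad [p k] [] (expw p (n - k))))"
proof -
  have "(of_nat (Suc n) :: 'k) \<noteq> 0" by (rule of_nat_neq_0)
  then show ?thesis by (simp add: expw.simps(2) del: of_nat_Suc)
qed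

lemma ell_box_even: "ell (0, x) (box f g) = box (pad [(0, x)] [] f) g + box f (pad [(0, x)] [] g)"
  using wt_const[of f "\<lambda>w. 1" 1] by (simp add: ell_box)

text \<open>Both sides satisfy the recursion that expresses the Leibniz rule for \<lambda>
  d/d\<lambda>; characteristic 0 allows division by \<open>Suc N\<close>. The identity is exact on
  words, before any relation is imposed.\<close>

lemma comult_expw:
  "lin_ext comult_word (expw (\<lambda>k. (0, p k)) n :: _ \<Rightarrow>\<^sub>0 'k::field_char_0) =
    (\<Sum>i\<le>n. box (expw (\<lambda>k. (0, p k)) i) (expw (\<lambda>k. (0, p k)) (n - i)))"
proof (induction n rule: less_induct)
  case (less n)
  let ?e = "expw (\<lambda>k. (0, p k)) :: nat \<Rightarrow> _ \<Rightarrow>\<^sub>0 'k"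
  let ?c = "\<lambda>k. pad [(0, p k)] [] :: (_ \<Rightarrow>\<^sub>0 'k) \<Rightarrow> _"
  let ?n = "\<lambda>k. of_nat (Suc k) :: 'k"
  show ?case
  proof (cases n)
    case 0
    then show ?thesis by (simp add: lin_simps box_simps)
  next
    case (Suc N)
    have "fscale (?n N) (lin_ext comult_word (?e (Suc N))) =
      lin_ext comult_word (\<Sum>k\<le>N. fscale (?n k) (?c k (?e (N - k))))"
      unfolding le.scale[symmetric] expw_Suc ..
    also have "\<dots> = (\<Sum>k\<le>N. fscale (?n k) (ell (0, p k) (lin_ext comult_word (?e (N - k)))))"
      by (simp only: le.sum le.scale lin_ext_comult_ext pad_Nil)
    also have "\<dots> = (\<Sum>k\<le>N. \<Sum>i\<le>N - k. fscale (?n k) (ell (0, p k) (box (?e i) (?e (N - k - i)))))"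
      using less Suc by (simp add: ell.sum fs.scale_sum_right del: of_nat_Suc)
    also have "\<dots> = (\<Sum>k\<le>N. \<Sum>i\<le>N - k. fscale (?n k) (box (?c k (?e i)) (?e (N - k - i))))
      + (\<Sum>k\<le>N. \<Sum>i\<le>N - k. fscale (?n k) (box (?e i) (?c k (?e (N - k - i)))))"
      by (simp add: ell_box_even fs.scale_right_distrib sum.distrib del: of_nat_Suc)
    also have "(\<Sum>k\<le>N. \<Sum>i\<le>N - k. fscale (?n k) (box (?c k (?e i)) (?e (N - k - i)))) =
      (\<Sum>j\<le>N. box (\<Sum>k\<le>N - j. fscale (?n k) (?c k (?e (N - j - k)))) (?e j))"
      using triangle_rotate[of "\<lambda>k i j. fscale (?n k) (box (?c k (?e i)) (?e j))" N]
      by (simp add: box_simps del: of_nat_Suc)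
    also have "\<dots> = (\<Sum>j\<le>N. fscale (?n (N - j)) (box (?e (Suc (N - j))) (?e j)))"
      by (simp only: expw_Suc[symmetric] box_left.scale)
    \<comment> \<open>The new summand \<open>j = Suc N\<close> has coefficient 0.\<close>
    also have "\<dots> = (\<Sum>j\<le>Suc N. fscale (of_nat (Suc N - j)) (box (?e (Suc N - j)) (?e j)))"
      by (simp add: Suc_diff_le del: of_nat_Suc of_nat_diff)
    also have "\<dots> = (\<Sum>i\<le>Suc N. fscale (of_nat i) (box (?e i) (?e (Suc N - i))))"
      by (rule sum.reindex_bij_witness[of _ "\<lambda>i. Suc N - i" "\<lambda>i. Suc N - i"]) auto
    also have "(\<Sum>k\<le>N. \<Sum>i\<le>N - k. fscale (?n k) (box (?e i) (?c k (?e (N - k - i))))) =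
      (\<Sum>i\<le>N. box (?e i) (\<Sum>k\<le>N - i. fscale (?n k) (?c k (?e (N - i - k)))))"
      using triangle_swap[of "\<lambda>k i j. fscale (?n k) (box (?e i) (?c k (?e j)))" N]
      by (simp add: box_simps del: of_nat_Suc)
    also have "\<dots> = (\<Sum>i\<le>N. fscale (?n (N - i)) (box (?e i) (?e (Suc (N - i)))))"
      by (simp only: expw_Suc[symmetric] box_right.scale)
    also have "\<dots> = (\<Sum>i\<le>Suc N. fscale (of_nat (Suc N - i)) (box (?e i) (?e (Suc N - i))))"
      by (simp add: Suc_diff_le del: of_nat_Suc of_nat_diff)
    \<comment> \<open>Leibniz rule: differentiating the left factor gives the coefficient
      \<open>i\<close>, the right factor \<open>Suc N - i\<close>, and these add up to
      \<open>Suc N\<close>.\<close>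
    also have "(\<Sum>i\<le>Suc N. fscale (of_nat i) (box (?e i) (?e (Suc N - i)))) + \<dots> =
      (\<Sum>i\<le>Suc N. fscale (?n N) (box (?e i) (?e (Suc N - i))))"
      unfolding sum.distrib[symmetric] fs.scale_left_distrib[symmetric] of_nat_add[symmetric]
      by (rule sum.cong) simp_all
    finally have "fscale (?n N) (lin_ext comult_word (?e (Suc N))) =
      fscale (?n N) (\<Sum>i\<le>Suc N. box (?e i) (?e (Suc N - i)))"
      by (simp only: fs.scale_sum_right)
    moreover have "?n N \<noteq> 0" by (rule of_nat_neq_0)
    ultimately show ?thesis unfolding Suc by (simp only: fs.scale_cancel_left) blast
  qed
qed

lemma keys_expw:
  assumes "\<And>k. p k \<in> carr (V 0)"
  shows "Poly_Mapping.keys (expw (\<lambda>k. (0, p k)) n :: _ \<Rightarrow>\<^sub>0 'k::field_char_0)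
    \<subseteq> {w \<in> words V. wdeg w = 0}"
proof (induction n rule: less_induct)
  case (less n)
  let ?S = "{w \<in> words V. wdeg w = 0}"
  show ?case
  proof (cases n)
    case (Suc N)
    have "pad [(0 :: int, p k)] [] (expw (\<lambda>k. (0, p k)) (N - k)) \<in> {f :: _ \<Rightarrow>\<^sub>0 'k. Poly_Mapping.keys f \<subseteq> ?S}" for k
      unfolding pad_def
    proof (rule lin_ext_in_subspace[OF subspace_supp])
      fix w assume "w \<in> Poly_Mapping.keys (expw (\<lambda>k. (0 :: int, p k)) (N - k) :: _ \<Rightarrow>\<^sub>0 'k)"
      then have "w \<in> ?S" using Suc by (intro subsetD[OF less[of "N - k"]]) simp_all
      then show "Poly_Mapping.single ([(0, p k)] @ w @ []) 1 \<in> {f :: _ \<Rightarrow>\<^sub>0 'k. Poly_Mapping.keys f \<subseteq> ?S}"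
        using assms by simp
    qed
    then have "expw (\<lambda>k. (0, p k)) n \<in> {f :: _ \<Rightarrow>\<^sub>0 'k. Poly_Mapping.keys f \<subseteq> ?S}"
      unfolding Suc expw.simps(2)
      by (intro fs.subspace_scale[OF subspace_supp] fs.subspace_sum[OF subspace_supp])
    then show ?thesis by simp
  qed simp
qed

section \<open>The comultiplication on the symmetric algebra\<close>

context gvs
begin

definition pairs :: "('v word \<times> 'v word \<Rightarrow>\<^sub>0 'k) \<Rightarrow> (('k, 'v) sym \<times> ('k, 'v) sym \<Rightarrow>\<^sub>0 'k)" where
  "pairs = lin_ext (\<lambda>(a, b). Poly_Mapping.single (monomial V a, monomial V b) 1)"

interpretation pairs: Vector_Spaces.linear fscale fscale pairs
  unfolding pairs_def by (rule lin_ext_linear)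

abbreviation trel :: "(('k, 'v) sym \<times> ('k, 'v) sym \<Rightarrow>\<^sub>0 'k) set" where
  "trel \<equiv> tensor_rel (Sym V) (Sym V)"

lemmas trel_add = fs.subspace_add[OF tensor_rel_subspace[of "Sym V" "Sym V"]]
  and trel_diff = fs.subspace_diff[OF tensor_rel_subspace[of "Sym V" "Sym V"]]
  and trel_scale = fs.subspace_scale[OF tensor_rel_subspace[of "Sym V" "Sym V"]]

lemma trel_zero:
  assumes "X \<in> carr (Sym V)"
  shows "Poly_Mapping.single (cl 0, X) 1 \<in> trel" "Poly_Mapping.single (X, cl 0) 1 \<in> trel"
  using tensor_rel_scl_left[of "cl 0" "Sym V" X "Sym V" 0]
    tensor_rel_scl_right[of X "Sym V" "cl 0" "Sym V" 0] assms cl_carr[of 0]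
  by (simp_all only: scl_Sym) simp_all

lemma pairs_box_single:
  assumes "a \<in> words V" "b \<in> words V"
  shows "pairs (box (Poly_Mapping.single a c) (Poly_Mapping.single b d))
    - Poly_Mapping.single (cl (Poly_Mapping.single a c), cl (Poly_Mapping.single b d)) 1 \<in> trel"
proof -
  let ?A = "cl (Poly_Mapping.single a 1)" and ?B = "cl (Poly_Mapping.single b 1)"
  have AB: "?A \<in> carr (Sym V)" "?B \<in> carr (Sym V)" "cl (Poly_Mapping.single b d) \<in> carr (Sym V)"
    using assms by (simp_all add: cl_mem_carr_iff)
  have s: "cl (Poly_Mapping.single w e) = scl (Sym V) e (cl (Poly_Mapping.single w 1))" for w e
    by (simp add: scl_Sym fscale_single)
  have 1: "Poly_Mapping.single (cl (Poly_Mapping.single a c), cl (Poly_Mapping.single b d)) 1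
      - Poly_Mapping.single (?A, cl (Poly_Mapping.single b d)) c \<in> trel"
    unfolding s[of a c] by (rule tensor_rel_scl_left[OF AB(1) AB(3)])
  have 2: "Poly_Mapping.single (?A, cl (Poly_Mapping.single b d)) 1
      - Poly_Mapping.single (?A, ?B) d \<in> trel"
    unfolding s[of b d] by (rule tensor_rel_scl_right[OF AB(1) AB(2)])
  have "- (Poly_Mapping.single (cl (Poly_Mapping.single a c), cl (Poly_Mapping.single b d)) 1
      - Poly_Mapping.single (?A, cl (Poly_Mapping.single b d)) c +
    fscale c (Poly_Mapping.single (?A, cl (Poly_Mapping.single b d)) 1
      - Poly_Mapping.single (?A, ?B) d)) \<in> trel"
    by (intro fs.subspace_neg[OF tensor_rel_subspace] trel_add trel_scale 1 2)
  then show ?thesis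
    by (simp add: box_single pairs_def lin_simps monomial_cl)
qed

text \<open>A pure tensor of classes may be expanded bilinearly into words of its representatives,
  because \<open>trel\<close> contains the bilinearity relations.\<close>

lemma pairs_box:
  assumes "Poly_Mapping.keys f \<subseteq> words V" "Poly_Mapping.keys g \<subseteq> words V"
  shows "pairs (box f g) - Poly_Mapping.single (cl f, cl g) 1 \<in> trel"
proof -
  let ?W = "{f :: 'v word \<Rightarrow>\<^sub>0 'k. Poly_Mapping.keys f \<subseteq> words V}"
  \<comment> \<open>The supports are carried along because the bilinearity relations of the tensor
    product require classes in the carrier.\<close>
  let ?P = "\<lambda>f g. f \<in> ?W \<and> g \<in> ?W \<and>
    pairs (box f g) - Poly_Mapping.single (cl f, cl g) 1 \<in> trel"
  note W0 = fs.subspace_0[OF subspace_supp] and Wa = fs.subspace_add[OF subspace_supp]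
  have single: "?P (Poly_Mapping.single a c) g" if a: "a \<in> words V" for a c
    using assms(2)
  proof (induction rule: supp_induct)
    case zero
    show ?case using a trel_zero(2)[OF cl_carr, of "Poly_Mapping.single a c"]
      by (simp add: box_simps pairs.zero fs.subspace_neg[OF tensor_rel_subspace])
  next
    case (single b d)
    show ?case using pairs_box_single a single by simp
  next
    case (add g g')
    let ?a = "Poly_Mapping.single a c"
    have "Poly_Mapping.single (cl ?a, cl (g + g')) 1 - Poly_Mapping.single (cl ?a, cl g) 1
      - Poly_Mapping.single (cl ?a, cl g') 1 \<in> trel"
      unfolding cl_add[symmetric] using add by (intro tensor_rel_add_right cl_carr) auto
    from trel_diff[OF trel_add[OF conjunct2[OF conjunct2[OF add(1)]] conjunct2[OF conjunct2[OF add(2)]]] this]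
    show ?case using add Wa[of g "words V" g']
      by (simp add: box_simps pairs.add algebra_simps)
  qed
  have "?P f g"
    using assms(1)
  proof (induction rule: supp_induct)
    case zero
    show ?case using assms(2) trel_zero(1)[OF cl_carr, of g]
      by (simp add: box_simps pairs.zero fs.subspace_neg[OF tensor_rel_subspace])
  next
    case (add f f')
    have "Poly_Mapping.single (cl (f + f'), cl g) 1 - Poly_Mapping.single (cl f, cl g) 1
      - Poly_Mapping.single (cl f', cl g) 1 \<in> trel"
      unfolding cl_add[symmetric] using add by (intro tensor_rel_add_left cl_carr) auto
    from trel_diff[OF trel_add[OF conjunct2[OF conjunct2[OF add(1)]] conjunct2[OF conjunct2[OF add(2)]]] this]
    show ?case using add Wa[of f "words V" f']
      by (simp add: box_simps pairs.add algebra_simps)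
  qed (rule single)
  then show ?thesis by simp
qed

text \<open>One factor of each spanning element is a relation, so it has the class of 0, and a pure
  tensor with a zero factor vanishes.\<close>

lemma pairs_box_rel: "t \<in> box_rel \<Longrightarrow> pairs t \<in> trel"
proof (rule lin_span[OF pairs.linear_axioms tensor_rel_subspace, rotated], unfold box_rel_def)
  fix t :: "'v word \<times> 'v word \<Rightarrow>\<^sub>0 'k"
  assume "t \<in> {box g (Poly_Mapping.single b 1) | g b. g \<in> sym_gens V \<and> b \<in> words V} \<union>
     {box (Poly_Mapping.single a 1) g | g a. g \<in> sym_gens V \<and> a \<in> words V}"
  then consider g b where "t = box g (Poly_Mapping.single b 1)" "g \<in> sym_gens V" "b \<in> words V"
    | g a where "t = box (Poly_Mapping.single a 1) g" "g \<in> sym_gens V" "a \<in> words V" by blast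
  then show "pairs t \<in> trel"
  proof cases
    case (1 g b)
    have b: "Poly_Mapping.keys (Poly_Mapping.single b (1 :: 'k)) \<subseteq> words V" using 1 by simp
    have "cl g = cl 0" unfolding cl_eq_iff using 1 by (simp add: sym_rel_gen)
    then show ?thesis
      using trel_add[OF pairs_box[OF sym_rel_words[OF sym_rel_gen[OF 1(2)]] b] trel_zero(1)[OF cl_carr[OF b]]]
      by (simp add: 1)
  next
    case (2 g a)
    have a: "Poly_Mapping.keys (Poly_Mapping.single a (1 :: 'k)) \<subseteq> words V" using 2 by simp
    have "cl g = cl 0" unfolding cl_eq_iff using 2 by (simp add: sym_rel_gen)
    then show ?thesis
      using trel_add[OF pairs_box[OF a sym_rel_words[OF sym_rel_gen[OF 2(2)]]] trel_zero(2)[OF cl_carr[OF a]]]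
      by (simp add: 2)
  qed
qed

lemma comult_cl: "comult V (cl f) = pairs (lin_ext comult_word f) +o trel"
  unfolding comult_def pairs_def[symmetric]
  by (rule the_elem_coset)
    (simp_all add: tensor_rel_subgrp le.add pairs.add pairs_box_rel comult_box_rel)

lemma diag_map_cl: "diag_map V (\<lambda>w. c (length w) (wdeg w)) (cl f) = cl (wt (\<lambda>w. c (length w) (wdeg w)) f)"
  unfolding diag_map_def wt_def[symmetric]
  by (rule the_elem_coset) (simp_all add: wt.add sym_rel_wt)

abbreviation len :: "nat \<Rightarrow> ('v word \<Rightarrow>\<^sub>0 'k) \<Rightarrow> ('v word \<Rightarrow>\<^sub>0 'k)" where
  "len k \<equiv> wt (\<lambda>w. of_bool (length w = k))"

lemma proj1_cl: "proj1 V (cl f) = cl (len 1 f)"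
  using diag_map_cl[of "\<lambda>n d. if n = 1 then 1 else 0" f]
  by (simp add: proj1_def of_bool_def)

lemma parity_cl: "parity V (cl f) = cl (wt (\<lambda>w. sg (wdeg w)) f)"
  using diag_map_cl[of "\<lambda>n d. sg d" f] by (simp add: parity_def)

lemma keys_wt: "Poly_Mapping.keys (wt c f) \<subseteq> Poly_Mapping.keys f"
  by (auto simp: in_keys_iff lookup_wt)

lemma parity_linear: "linear_on (Sym V) (Sym V) (parity V)"
  unfolding linear_on_def
proof (intro conjI ballI allI)
  fix X assume "X \<in> carr (Sym V)"
  then obtain f where f: "Poly_Mapping.keys f \<subseteq> words V" "X = cl f" by (auto simp: carr_Sym)
  show "parity V X \<in> carr (Sym V)"
    unfolding f(2) parity_cl by (rule cl_carr[OF subset_trans[OF keys_wt f(1)]])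
  show "parity V (scl (Sym V) c X) = scl (Sym V) c (parity V X)" for c
    by (simp add: f(2) parity_cl scl_Sym wt.scale)
  fix Y assume "Y \<in> carr (Sym V)"
  then obtain g where "Y = cl g" by (auto simp: carr_Sym)
  then show "parity V (X + Y) = parity V X + parity V Y"
    by (simp add: f(2) parity_cl cl_add wt.add)
qed

lemma id_linear: "linear_on (Sym V) (Sym V) id"
  by (simp add: linear_on_def)

section \<open>Weighted multiplication on tensors of classes\<close>

definition rep :: "('k, 'v) sym \<Rightarrow> ('v word \<Rightarrow>\<^sub>0 'k)" where
  "rep X = (SOME f. Poly_Mapping.keys f \<subseteq> words V \<and> X = cl f)"

lemma rep:
  assumes "X \<in> carr (Sym V)" shows "Poly_Mapping.keys (rep X) \<subseteq> words V" "cl (rep X) = X"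
proof -
  have "Poly_Mapping.keys (rep X) \<subseteq> words V \<and> X = cl (rep X)"
    unfolding rep_def by (rule someI_ex) (use assms in \<open>auto simp: carr_Sym\<close>)
  then show "Poly_Mapping.keys (rep X) \<subseteq> words V" "cl (rep X) = X" by auto
qed

text \<open>The operator \<open>mulw\<close> transported to tensors of classes. It depends on the
  chosen representatives, but only by relations.\<close>

definition unpair :: "(nat \<Rightarrow> nat \<Rightarrow> 'k) \<Rightarrow> (('k, 'v) sym \<times> ('k, 'v) sym \<Rightarrow>\<^sub>0 'k) \<Rightarrow> ('v word \<Rightarrow>\<^sub>0 'k)" where
  "unpair h = lin_ext (\<lambda>(X, Y). mulw h (box (rep X) (rep Y)))"

interpretation unpair: Vector_Spaces.linear fscale fscale "unpair h" for h
  unfolding unpair_def by (rule lin_ext_linear)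

text \<open>Telescoping: f \<otimes> g - f' \<otimes> g' = (f - f') \<otimes> g + f' \<otimes> (g -
  g').\<close>

lemma mulw_box_cong:
  assumes "cl f = cl f'" "cl g = cl g'"
    and "Poly_Mapping.keys f' \<subseteq> words V" "Poly_Mapping.keys g \<subseteq> words V"
  shows "mulw h (box f g) - mulw h (box f' g') \<in> sym_rel V"
proof -
  have "mulw h (box (f - f') g) + mulw h (box f' (g - g')) \<in> sym_rel V"
    using assms by (intro sym_rel_add mulw_box_left mulw_box_right) (auto simp: cl_eq_iff)
  then show ?thesis by (simp add: box_simps mulw.diff)
qed

lemma unpair_trel:
  assumes "t \<in> trel" shows "unpair h t \<in> sym_rel V"
  unfolding unpair_def
proof (rule tensor_rel_lift[OF sym_rel_subspace _ _ _ _ assms])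
  fix X X' Y assume *: "X \<in> carr (Sym V)" "X' \<in> carr (Sym V)" "Y \<in> carr (Sym V)"
  have XX: "X + X' \<in> carr (Sym V)" "cl (rep X + rep X') = X + X'"
    using rep[OF *(1)] rep[OF *(2)] fs.subspace_add[OF subspace_supp, of "rep X" "words V" "rep X'"]
      cl_carr[of "rep X + rep X'"] cl_add[of "rep X" "rep X'"] by auto
  have "mulw h (box (rep (X + X')) (rep Y)) - mulw h (box (rep X + rep X') (rep Y)) \<in> sym_rel V"
    using * XX rep fs.subspace_add[OF subspace_supp, of "rep X" "words V" "rep X'"]
    by (intro mulw_box_cong) auto
  then show "(case (X + X', Y) of (X, Y) \<Rightarrow> mulw h (box (rep X) (rep Y)))
    - (case (X, Y) of (X, Y) \<Rightarrow> mulw h (box (rep X) (rep Y)))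
    - (case (X', Y) of (X, Y) \<Rightarrow> mulw h (box (rep X) (rep Y))) \<in> sym_rel V"
    by (simp add: box_simps mulw.add algebra_simps)
next
  fix Y X X' assume *: "Y \<in> carr (Sym V)" "X \<in> carr (Sym V)" "X' \<in> carr (Sym V)"
  have XX: "X + X' \<in> carr (Sym V)" "cl (rep X + rep X') = X + X'"
    using rep[OF *(2)] rep[OF *(3)] fs.subspace_add[OF subspace_supp, of "rep X" "words V" "rep X'"]
      cl_carr[of "rep X + rep X'"] cl_add[of "rep X" "rep X'"] by auto
  have "mulw h (box (rep Y) (rep (X + X'))) - mulw h (box (rep Y) (rep X + rep X')) \<in> sym_rel V"
    using * XX rep fs.subspace_add[OF subspace_supp, of "rep X" "words V" "rep X'"]
    by (intro mulw_box_cong) auto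
  then show "(case (Y, X + X') of (X, Y) \<Rightarrow> mulw h (box (rep X) (rep Y)))
    - (case (Y, X) of (X, Y) \<Rightarrow> mulw h (box (rep X) (rep Y)))
    - (case (Y, X') of (X, Y) \<Rightarrow> mulw h (box (rep X) (rep Y))) \<in> sym_rel V"
    by (simp add: box_simps mulw.add algebra_simps)
next
  fix c X Y assume *: "X \<in> carr (Sym V)" "Y \<in> carr (Sym V)"
  have XX: "scl (Sym V) c X \<in> carr (Sym V)" "cl (fscale c (rep X)) = scl (Sym V) c X"
    using rep[OF *(1)] fs.subspace_scale[OF subspace_supp, of "rep X" "words V" c]
      cl_carr[of "fscale c (rep X)"] scl_Sym[of c "rep X"] by auto
  have "mulw h (box (rep (scl (Sym V) c X)) (rep Y)) - mulw h (box (fscale c (rep X)) (rep Y)) \<in> sym_rel V"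
    using * XX rep fs.subspace_scale[OF subspace_supp, of "rep X" "words V" c]
    by (intro mulw_box_cong) auto
  then show "(case (scl (Sym V) c X, Y) of (X, Y) \<Rightarrow> mulw h (box (rep X) (rep Y)))
    - fscale c (case (X, Y) of (X, Y) \<Rightarrow> mulw h (box (rep X) (rep Y))) \<in> sym_rel V"
    by (simp add: box_simps mulw.scale)
next
  fix c Y X assume *: "Y \<in> carr (Sym V)" "X \<in> carr (Sym V)"
  have XX: "scl (Sym V) c X \<in> carr (Sym V)" "cl (fscale c (rep X)) = scl (Sym V) c X"
    using rep[OF *(2)] fs.subspace_scale[OF subspace_supp, of "rep X" "words V" c]
      cl_carr[of "fscale c (rep X)"] scl_Sym[of c "rep X"] by auto
  have "mulw h (box (rep Y) (rep (scl (Sym V) c X))) - mulw h (box (rep Y) (fscale c (rep X))) \<in> sym_rel V"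
    using * XX rep fs.subspace_scale[OF subspace_supp, of "rep X" "words V" c]
    by (intro mulw_box_cong) auto
  then show "(case (Y, scl (Sym V) c X) of (X, Y) \<Rightarrow> mulw h (box (rep X) (rep Y)))
    - fscale c (case (Y, X) of (X, Y) \<Rightarrow> mulw h (box (rep X) (rep Y))) \<in> sym_rel V"
    by (simp add: box_simps mulw.scale)
qed

lemma unpair_single:
  assumes "Poly_Mapping.keys f \<subseteq> words V" "Poly_Mapping.keys g \<subseteq> words V"
  shows "unpair h (Poly_Mapping.single (cl f, cl g) 1) - mulw h (box f g) \<in> sym_rel V"
proof -
  have "mulw h (box (rep (cl f)) (rep (cl g))) - mulw h (box f g) \<in> sym_rel V"
    using rep[OF cl_carr] assms by (intro mulw_box_cong) auto
  then show ?thesis by (simp add: unpair_def lin_simps)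
qed

lemma unpair_sum:
  assumes "\<And>i. i \<in> I \<Longrightarrow> Poly_Mapping.keys (f i) \<subseteq> words V \<and> Poly_Mapping.keys (g i) \<subseteq> words V"
  shows "unpair h (\<Sum>i\<in>I. Poly_Mapping.single (cl (f i), cl (g i)) 1) -
    (\<Sum>i\<in>I. mulw h (box (f i) (g i))) \<in> sym_rel V"
  unfolding unpair.sum sum_subtractf[symmetric]
  using assms by (intro sym_rel_sum unpair_single) auto

lemma unpair_pairs:
  assumes "Poly_Mapping.keys t \<subseteq> words V \<times> words V"
  shows "unpair h (pairs t) - mulw h t \<in> sym_rel V"
  using assms
proof (induction rule: supp_induct)
  case (single x c)
  obtain a b where x: "x = (a, b)" by (cases x)
  have "unpair h (Poly_Mapping.single (monomial V a, monomial V b) 1)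
    - mulw h (Poly_Mapping.single (a, b) 1) \<in> sym_rel V"
    unfolding monomial_cl using unpair_single[of "Poly_Mapping.single a 1" "Poly_Mapping.single b 1" h] single
    by (simp add: x box_single)
  from sym_rel_scale[OF this, of c] show ?case
    by (simp add: x pairs_def lin_simps unpair.scale[symmetric] mulw.scale[symmetric] fs.scale_right_diff_distrib)
next
  case (add t t')
  from sym_rel_add[OF this] show ?case
    by (simp add: pairs.add unpair.add mulw.add algebra_simps)
qed (simp add: pairs.zero unpair.zero mulw.zero)

lemma keys_comult:
  "Poly_Mapping.keys f \<subseteq> words V \<Longrightarrow>
    Poly_Mapping.keys (lin_ext comult_word f :: _ \<Rightarrow>\<^sub>0 'k) \<subseteq> words V \<times> words V"
  by (intro lin_ext_in_subspace[OF subspace_supp, unfolded mem_Collect_eq] comult_word_words) blast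

text \<open>Weighted multiplication is applied to both sides of \<Delta> f = T; the left side
  becomes diagonal by \<open>mulw_comult\<close>. The weight 1 yields the primitive argument, the
  indicator of (1, 1) the Sym^2 component.\<close>

lemma decompose:
  assumes "Poly_Mapping.keys f \<subseteq> words V" "pairs (lin_ext comult_word f) - T \<in> trel"
  shows "wt (\<lambda>w. mulnum h (length w)) f - unpair h T \<in> sym_rel V"
proof -
  note 1 = unpair_trel[OF assms(2), of h]
  note 2 = unpair_pairs[OF keys_comult[OF assms(1)], of h]
  note 3 = mulw_comult[OF assms(1), of h]
  from sym_rel_diff[OF 1 sym_rel_add[OF 2 3]] show ?thesis
    by (simp add: unpair.diff algebra_simps)
qed

section \<open>Grouplike sequences and coderivations\<close>

lemma len_length: "Poly_Mapping.keys f \<subseteq> words V \<Longrightarrow> Poly_Mapping.keys (len k f) \<subseteq> words V"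
  using keys_wt[of _ f] by (rule subset_trans)

lemma sym_rel_len: "f \<in> sym_rel V \<Longrightarrow> len k f \<in> sym_rel V"
  using sym_rel_wt[of f "\<lambda>n d. of_bool (n = k)"] by simp

lemma len_cl: "cl f = cl g \<Longrightarrow> cl (len k f) = cl (len k g)"
  using sym_rel_len[of "f - g" k] by (simp add: cl_eq_iff wt.diff)

lemma proj1_linear: "linear_on (Sym V) (Sym V) (proj1 V)"
  unfolding linear_on_def
proof (intro conjI ballI allI)
  fix X assume "X \<in> carr (Sym V)"
  then obtain f where f: "Poly_Mapping.keys f \<subseteq> words V" "X = cl f" by (auto simp: carr_Sym)
  show "proj1 V X \<in> carr (Sym V)"
    unfolding f(2) proj1_cl by (rule cl_carr[OF subset_trans[OF keys_wt f(1)]])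
  show "proj1 V (scl (Sym V) c X) = scl (Sym V) c (proj1 V X)" for c
    by (simp add: f(2) proj1_cl scl_Sym wt.scale)
  fix Y assume "Y \<in> carr (Sym V)"
  then obtain g where "Y = cl g" by (auto simp: carr_Sym)
  then show "proj1 V (X + Y) = proj1 V X + proj1 V Y"
    by (simp add: f(2) proj1_cl cl_add wt.add)
qed

text \<open>The equation \<Delta> x = x \<otimes> x for the series x with coefficients
  \<open>x n\<close>, stated coefficientwise so that every tensor is finite.\<close>

definition grouplike :: "(nat \<Rightarrow> ('v word \<Rightarrow>\<^sub>0 'k)) \<Rightarrow> bool" where
  "grouplike x \<longleftrightarrow>
     (\<forall>n. Poly_Mapping.keys (x n) \<subseteq> words V \<and>
       pairs (lin_ext comult_word (x n))
         - (\<Sum>i\<le>n. Poly_Mapping.single (cl (x i), cl (x (n - i))) 1) \<in> trel) \<and>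
     cl (x 0) = cl (Poly_Mapping.single [] 1)"

lemma mulw_one:
  "mulw (\<lambda>p q. 1) (box f (Poly_Mapping.single [] 1)) = f"
  "mulw (\<lambda>p q. 1) (box (Poly_Mapping.single [] 1) f) = f"
proof -
  show "mulw (\<lambda>p q. 1) (box f (Poly_Mapping.single [] 1)) = f"
    using subset_refl[of "Poly_Mapping.keys f"]
    by (induction f rule: supp_induct) (simp_all add: box_simps mulw.zero mulw.add mulw_single)
  show "mulw (\<lambda>p q. 1) (box (Poly_Mapping.single [] 1) f) = f"
    using subset_refl[of "Poly_Mapping.keys f"]
    by (induction f rule: supp_induct) (simp_all add: box_simps mulw.zero mulw.add mulw_single)
qed

text \<open>Since \<open>2 ^ k \<noteq> 2\<close> for \<open>k \<noteq> 1\<close>, the eigenvalue equation forces \<open>f\<close> into \<open>Sym\<^sup>1\<close>.\<close>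

lemma primitive_zero:
  assumes "wt (\<lambda>w. 2 ^ length w) f - fscale 2 f \<in> sym_rel V" "len 1 f \<in> sym_rel V"
  shows "f \<in> sym_rel V"
proof -
  let ?c = "\<lambda>n. if n = 1 then 0 else inverse (2 ^ n - 2 :: 'k)"
  have ne: "(2::'k) ^ n \<noteq> 2" if "n \<noteq> 1" for n
  proof
    assume "(2::'k) ^ n = 2"
    then have "(of_nat (2 ^ n) :: 'k) = of_nat (2 ^ 1)" by simp
    then have "(2::nat) ^ n = 2 ^ 1" by (simp only: of_nat_eq_iff)
    then show False using that power_inject_exp[of "2::nat" n 1] by simp
  qed
  have "wt (\<lambda>w. ?c (length w)) (wt (\<lambda>w. 2 ^ length w) f - fscale 2 f) + len 1 f = f"
    by (rule poly_mapping_eqI)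
      (simp add: lookup_add lookup_minus lookup_wt lookup_fscale ne
        left_diff_distrib[symmetric] mult.assoc[symmetric])
  then show ?thesis
    using sym_rel_add[OF sym_rel_wt[OF assms(1), of "\<lambda>n d. ?c n"] assms(2)] by simp
qed

text \<open>Let y_n be the image of x_n. Then \<Delta> y_n is the sum of all y_i \<otimes> x_(n-i) +
  x_i \<otimes> y_(n-i), the sign being trivial by evenness. By induction only y_n \<otimes> 1 + 1
  \<otimes> y_n survives, so y_n is primitive with vanishing Sym^1 component.\<close>

lemma coderivation_vanishes:
  assumes Q: "coderivation V Q" and x: "grouplike x"
    and even: "\<And>n. parity V (cl (x n)) = cl (x n)"
    and proj: "\<And>n. proj1 V (Q (cl (x n))) = sym_rel V"
  shows "Q (cl (x n)) = sym_rel V"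
proof -
  have lin: "linear_on (Sym V) (Sym V) Q" using Q by (simp add: coderivation_def)
  have kx: "Poly_Mapping.keys (x n) \<subseteq> words V" for n using x by (simp add: grouplike_def)
  have "\<exists>g. Poly_Mapping.keys g \<subseteq> words V \<and> Q (cl (x n)) = cl g" for n
  proof -
    have "Q (cl (x n)) \<in> carr (Sym V)"
      using lin cl_carr[OF kx] by (simp add: linear_on_def)
    then show ?thesis by (auto simp only: carr_Sym)
  qed
  then obtain y where ky: "\<And>n. Poly_Mapping.keys (y n) \<subseteq> words V"
    and y: "\<And>n. Q (cl (x n)) = cl (y n)" by metis
  have "y n \<in> sym_rel V"
  proof (induction n rule: less_induct)
    case (less n)
    let ?S = "\<lambda>a b. \<Sum>i\<le>n. Poly_Mapping.single (cl (a i), cl (b (n - i))) (1 :: 'k)"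
    have cx: "comult V (cl (x n)) = ?S x x +o trel"
      unfolding comult_cl using x by (simp add: coset_eq_iff[OF tensor_rel_subgrp] grouplike_def)
    have 1: "tensor_map (Sym V) (Sym V) Q id (comult V (cl (x n))) = ?S y x +o trel"
      unfolding cx tensor_map_coset[OF lin id_linear] by (simp add: lin_simps y)
    have 2: "tensor_map (Sym V) (Sym V) (parity V) Q (comult V (cl (x n))) = ?S x y +o trel"
      unfolding cx tensor_map_coset[OF parity_linear lin] by (simp add: lin_simps y even)
    have "comult V (Q (cl (x n))) = tensor_map (Sym V) (Sym V) Q id (comult V (cl (x n)))
        + tensor_map (Sym V) (Sym V) (parity V) Q (comult V (cl (x n)))"
      using Q cl_carr[OF kx[of n]] unfolding coderivation_def by blast
    then have "comult V (cl (y n)) = (?S y x + ?S x y) +o trel"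
      unfolding 1 2 coset_add[OF tensor_rel_subgrp] y .
    then have "pairs (lin_ext comult_word (y n)) - (?S y x + ?S x y) \<in> trel"
      unfolding comult_cl coset_eq_iff[OF tensor_rel_subgrp] .
    note 3 = decompose[OF ky this, of "\<lambda>p q. 1"]
    let ?M = "\<lambda>a b. \<Sum>i\<le>n. mulw (\<lambda>p q. 1) (box (a i) (b (n - i)))"
    have 4: "unpair (\<lambda>p q. 1) (?S y x) - ?M y x \<in> sym_rel V"
      by (rule unpair_sum) (simp add: kx ky)
    have 5: "unpair (\<lambda>p q. 1) (?S x y) - ?M x y \<in> sym_rel V"
      by (rule unpair_sum) (simp add: kx ky)
    have k1: "Poly_Mapping.keys (Poly_Mapping.single [] (1 :: 'k)) \<subseteq> words V" by simp
    have x0: "cl (x 0) = cl (Poly_Mapping.single [] 1)" using x by (simp add: grouplike_def)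
    \<comment> \<open>The terms below \<open>n\<close> contain an earlier \<open>y i\<close>, a
      relation by induction; the last one is multiplication by the unit class.\<close>
    have "(\<Sum>i<n. mulw (\<lambda>p q. 1) (box (y i) (x (n - i)))) \<in> sym_rel V"
      by (intro sym_rel_sum mulw_box_left kx less) simp
    moreover have "mulw (\<lambda>p q. 1) (box (y n) (x 0)) - y n \<in> sym_rel V"
      using mulw_box_cong[OF refl x0 ky[of n] kx[of 0], of "\<lambda>p q. 1"] by (simp add: mulw_one)
    ultimately have 6: "?M y x - y n \<in> sym_rel V"
      by (simp add: lessThan_Suc_atMost[symmetric] add_diff_eq[symmetric] sym_rel_add)
    have "(\<Sum>i\<in>{1..n}. mulw (\<lambda>p q. 1) (box (x i) (y (n - i)))) \<in> sym_rel V"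
      by (intro sym_rel_sum mulw_box_right kx less) simp
    moreover have "mulw (\<lambda>p q. 1) (box (x 0) (y n)) - y n \<in> sym_rel V"
      using mulw_box_cong[OF x0 refl k1 ky[of n], of "\<lambda>p q. 1"] by (simp add: mulw_one)
    moreover have "{..n} = insert 0 {1..n}" by auto
    ultimately have 7: "?M x y - y n \<in> sym_rel V"
      by (simp add: add_diff_eq[symmetric] add.commute[of _ "sum _ _"] sym_rel_add)
    have "wt (\<lambda>w. 2 ^ length w) (y n) - fscale 2 (y n) \<in> sym_rel V"
    proof -
      have "fscale 2 (y n) = y n + y n"
        by (rule poly_mapping_eqI) (simp add: lookup_fscale lookup_add)
      with sym_rel_add[OF 3 sym_rel_add[OF sym_rel_add[OF 4 5] sym_rel_add[OF 6 7]]]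
      show ?thesis by (simp add: unpair.add mulnum_one algebra_simps)
    qed
    moreover have "len 1 (y n) \<in> sym_rel V"
      using proj[of n] unfolding y proj1_cl by (simp add: coset_zero_iff)
    ultimately show "y n \<in> sym_rel V" by (rule primitive_zero)
  qed
  then show ?thesis by (simp add: y coset_zero_iff)
qed

section \<open>Components of a grouplike sequence in Sym^1 and Sym^2\<close>

lemma mulw_11:
  "mulw (\<lambda>p q. of_bool (p = Suc 0 \<and> q = Suc 0)) (box f g) = mulw (\<lambda>p q. 1) (box (len 1 f) (len 1 g))"
  by (rule lin_induct2[of f UNIV g UNIV])
    (simp_all add: box_simps mulw.zero wt.zero mulw.add wt.add mulw_single wt_single)

text \<open>The weight is the indicator of (1, 1). On the left it leaves the words of length 2, each
  counted twice since either letter may go left; on the right it leaves products of Sym^1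
  components.\<close>

lemma grouplike_len2:
  assumes x: "grouplike x"
    and l0: "len 1 (x 0) \<in> sym_rel V"
    and p: "\<And>n. 1 \<le> n \<Longrightarrow> p n \<in> carr (V 0)"
    and l1: "\<And>n. 1 \<le> n \<Longrightarrow> len 1 (x n) - Poly_Mapping.single [(0, p n)] 1 \<in> sym_rel V"
  shows "fscale 2 (len 2 (x n)) - (\<Sum>i\<in>{1..<n}. Poly_Mapping.single [(0, p i), (0, p (n - i))] 1)
    \<in> sym_rel V"
proof -
  let ?h = "\<lambda>p q. of_bool (p = Suc 0 \<and> q = Suc 0) :: 'k"
  have kx: "Poly_Mapping.keys (x n) \<subseteq> words V" for n using x by (simp add: grouplike_def)
  let ?M = "\<lambda>i. mulw (\<lambda>p q. 1) (box (len 1 (x i)) (len 1 (x (n - i))))"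
  have "pairs (lin_ext comult_word (x n)) - (\<Sum>i\<le>n. Poly_Mapping.single (cl (x i), cl (x (n - i))) 1)
    \<in> trel" using x by (simp add: grouplike_def)
  note 1 = decompose[OF kx this, of ?h]
  have 2: "unpair ?h (\<Sum>i\<le>n. Poly_Mapping.single (cl (x i), cl (x (n - i))) 1) - (\<Sum>i\<le>n. ?M i) \<in> sym_rel V"
    unfolding mulw_11[symmetric] by (rule unpair_sum) (simp add: kx)
  have wt2: "wt (\<lambda>w. mulnum ?h (length w)) (x n) = fscale 2 (len 2 (x n))"
    unfolding mulnum_11 by (rule poly_mapping_eqI) (simp add: lookup_wt lookup_fscale)
  \<comment> \<open>The end terms contain the Sym^1 component of \<open>x 0\<close>, which is zero
    in the quotient.\<close>
  have "(\<Sum>i\<in>{..n} - {1..<n}. ?M i) \<in> sym_rel V"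
  proof (rule sym_rel_sum)
    fix i assume "i \<in> {..n} - {1..<n}"
    then have "i = 0 \<or> i = n" by auto
    then show "?M i \<in> sym_rel V"
      using mulw_box_left[OF l0 len_length[OF kx]] mulw_box_right[OF l0 len_length[OF kx]] by auto
  qed
  moreover have "(\<Sum>i\<le>n. ?M i) = (\<Sum>i\<in>{..n} - {1..<n}. ?M i) + (\<Sum>i\<in>{1..<n}. ?M i)"
    by (rule sum.subset_diff) auto
  moreover have "(\<Sum>i\<in>{1..<n}. ?M i - Poly_Mapping.single [(0, p i), (0, p (n - i))] 1) \<in> sym_rel V"
  proof (rule sym_rel_sum)
    fix i assume i: "i \<in> {1..<n}"
    let ?p = "\<lambda>i. Poly_Mapping.single [(0, p i)] (1 :: 'k)"
    have "?M i - mulw (\<lambda>p q. 1) (box (?p i) (?p (n - i))) \<in> sym_rel V"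
    proof (rule mulw_box_cong)
      have "1 \<le> i" "1 \<le> n - i" using i by auto
      then show "cl (len 1 (x i)) = cl (?p i)" "cl (len 1 (x (n - i))) = cl (?p (n - i))"
        "Poly_Mapping.keys (?p i) \<subseteq> words V"
        using l1 p by (simp_all only: cl_eq_iff) simp
    qed (rule len_length[OF kx])
    then show "?M i - Poly_Mapping.single [(0, p i), (0, p (n - i))] 1 \<in> sym_rel V"
      by (simp add: box_simps mulw_single)
  qed
  ultimately have "(\<Sum>i\<le>n. ?M i) - (\<Sum>i\<in>{1..<n}. Poly_Mapping.single [(0, p i), (0, p (n - i))] 1) \<in> sym_rel V"
    by (simp add: sum_subtractf add_diff_eq[symmetric] sym_rel_add)
  from sym_rel_add[OF 1 sym_rel_add[OF 2 this]] show ?thesis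
    by (simp add: wt2)
qed

text \<open>The projection of \<open>Q\<close> to Sym^1 sees just the words of length 1 and 2, and
  both components of a grouplike sequence are determined by its Sym^1 part.\<close>

lemma proj1_coderivation:
  assumes Q: "linear_on (Sym V) (Sym V) Q" and q: "has_projection V q1 q2 Q"
    and x: "grouplike x"
    and l0: "len 1 (x 0) \<in> sym_rel V"
    and p: "\<And>n. 1 \<le> n \<Longrightarrow> p n \<in> carr (V 0)"
    and l1: "\<And>n. 1 \<le> n \<Longrightarrow> len 1 (x n) - Poly_Mapping.single [(0, p n)] 1 \<in> sym_rel V"
  shows "proj1 V (Q (cl (x n))) = cl ((if n = 0 then 0 else Poly_Mapping.single [(1, q1 0 (p n))] 1)
    + fscale (1 / 2) (\<Sum>i\<in>{1..<n}. Poly_Mapping.single [(1, q2 0 0 (p i) (p (n - i)))] 1))"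
proof -
  have kx: "Poly_Mapping.keys (x n) \<subseteq> words V" for n using x by (simp add: grouplike_def)
  obtain K where K: "\<And>f. Poly_Mapping.keys f \<subseteq> words V \<Longrightarrow> proj1 V (Q (cl f)) = cl (lin_ext K f)"
    by (rule linear_on_Sym_lift[OF gvs_axioms gvs_axioms linear_on_comp[OF Q proj1_linear]])
      (simp only: o_apply)
  have K0: "lin_ext K f \<in> sym_rel V" if f: "f \<in> sym_rel V" for f
  proof -
    have "cl f = cl 0" unfolding cl_eq_iff using f by simp
    then have "cl (lin_ext K f) = cl (lin_ext K 0)"
      using K[OF sym_rel_words[OF f]] K[of 0] by simp
    then show ?thesis unfolding cl_eq_iff by (simp add: le.zero)
  qed
  have Kmon: "lin_ext K (Poly_Mapping.single w 1) - Poly_Mapping.single [(k, u)] 1 \<in> sym_rel V"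
    if "w \<in> words V" "proj1 V (Q (monomial V w)) = monomial V [(k, u)]" for w k u
    using that K[of "Poly_Mapping.single w 1"] by (simp add: monomial_cl cl_eq_iff)
  have q1: "\<forall>u\<in>carr (V i). proj1 V (Q (monomial V [(i, u)])) = monomial V [(i + 1, q1 i u)]" for i
    using q unfolding has_projection_def by (elim conjE) (erule spec)
  have q2: "\<forall>u\<in>carr (V i). \<forall>v\<in>carr (V j).
      proj1 V (Q (monomial V [(i, u), (j, v)])) = monomial V [(i + j + 1, q2 i j u v)]" for i j
    by (rule q[unfolded has_projection_def, THEN conjunct2, THEN conjunct1, THEN spec, THEN spec])
  have K1: "lin_ext K (Poly_Mapping.single [(0, p i)] 1) - Poly_Mapping.single [(1, q1 0 (p i))] 1 \<in> sym_rel V"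
    if "1 \<le> i" for i
  proof (rule Kmon)
    show "[(0, p i)] \<in> words V" using p[OF that] by simp
    show "proj1 V (Q (monomial V [(0, p i)])) = monomial V [(1, q1 0 (p i))]"
      using q1[of 0] p[OF that] by simp
  qed
  have K2: "lin_ext K (Poly_Mapping.single [(0, p i), (0, p j)] 1)
      - Poly_Mapping.single [(1, q2 0 0 (p i) (p j))] 1 \<in> sym_rel V" if "1 \<le> i" "1 \<le> j" for i j
  proof (rule Kmon)
    show "[(0, p i), (0, p j)] \<in> words V" using p[OF that(1)] p[OF that(2)] by simp
    show "proj1 V (Q (monomial V [(0, p i), (0, p j)])) = monomial V [(1, q2 0 0 (p i) (p j))]"
      using q2[of 0 0] p[OF that(1)] p[OF that(2)] by simp
  qed
  have Krest: "lin_ext K f \<in> sym_rel V"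
    if "Poly_Mapping.keys f \<subseteq> {w \<in> words V. length w \<notin> {1, 2}}" for f
    using that
  proof (induction rule: supp_induct)
    case (single w c)
    then have "proj1 V (Q (monomial V w)) = sym_rel V"
      using q unfolding has_projection_def by blast
    moreover have "Poly_Mapping.keys (Poly_Mapping.single w (1 :: 'k)) \<subseteq> words V" using single by simp
    ultimately have "cl (lin_ext K (Poly_Mapping.single w 1)) = sym_rel V"
      unfolding monomial_cl by (simp only: K)
    then have "lin_ext K (Poly_Mapping.single w 1) \<in> sym_rel V"
      by (simp only: coset_zero_iff[OF sym_rel_subgrp])
    from sym_rel_scale[OF this, of c] show ?case by (simp add: lin_simps)
  qed (simp_all add: le.zero le.add sym_rel_add)
  let ?r = "wt (\<lambda>w. of_bool (length w \<notin> {1, 2})) (x n)"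
  have kr: "Poly_Mapping.keys ?r \<subseteq> {w \<in> words V. length w \<notin> {1, 2}}"
  proof
    fix w assume "w \<in> Poly_Mapping.keys ?r"
    moreover from this have "w \<in> words V" by (rule subsetD[OF subset_trans[OF keys_wt kx]])
    ultimately show "w \<in> {w \<in> words V. length w \<notin> {1, 2}}"
      by (simp add: in_keys_iff lookup_wt)
  qed
  \<comment> \<open>The factors 1/2 and 2 are kept apart because \<open>grouplike_len2\<close>
    describes twice the length 2 part. The remainder includes the empty word.\<close>
  have split: "x n = len 1 (x n) + fscale (1 / 2) (fscale 2 (len 2 (x n))) + ?r"
    by (rule poly_mapping_eqI) (simp add: lookup_add lookup_wt lookup_fscale)
  let ?L = "if n = 0 then 0 else Poly_Mapping.single [(0, p n)] (1 :: 'k)"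
  let ?L' = "if n = 0 then 0 else Poly_Mapping.single [(1, q1 0 (p n))] (1 :: 'k)"
  let ?B = "\<Sum>i\<in>{1..<n}. Poly_Mapping.single [(0, p i), (0, p (n - i))] (1 :: 'k)"
  let ?B' = "\<Sum>i\<in>{1..<n}. Poly_Mapping.single [(1, q2 0 0 (p i) (p (n - i)))] (1 :: 'k)"
  have "len 1 (x n) - ?L \<in> sym_rel V" using l0 l1[of n] by simp
  from K0[OF this] have 1: "lin_ext K (len 1 (x n)) - lin_ext K ?L \<in> sym_rel V" by (simp only: le.diff)
  have 2: "lin_ext K ?L - ?L' \<in> sym_rel V" using K1[of n] by (simp add: le.zero)
  from K0[OF grouplike_len2[OF x l0 p l1, of n]]
  have 3: "lin_ext K (fscale 2 (len 2 (x n))) - lin_ext K ?B \<in> sym_rel V" by (simp only: le.diff)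
  have 4: "lin_ext K ?B - ?B' \<in> sym_rel V"
    unfolding le.sum sum_subtractf[symmetric] by (intro sym_rel_sum K2) auto
  have e: "lin_ext K (x n) = lin_ext K (len 1 (x n)) + fscale (1 / 2) (lin_ext K (fscale 2 (len 2 (x n)))) + lin_ext K ?r"
    by (subst split) (simp only: le.add le.scale)
  have "(lin_ext K (len 1 (x n)) - lin_ext K ?L) + (lin_ext K ?L - ?L') +
    fscale (1/2) ((lin_ext K (fscale 2 (len 2 (x n))) - lin_ext K ?B) + (lin_ext K ?B - ?B'))
    + lin_ext K ?r \<in> sym_rel V"
    by (intro sym_rel_add sym_rel_scale 1 2 3 4 Krest kr)
  moreover have "(lin_ext K (len 1 (x n)) - lin_ext K ?L) + (lin_ext K ?L - ?L') +
    fscale (1/2) ((lin_ext K (fscale 2 (len 2 (x n))) - lin_ext K ?B) + (lin_ext K ?B - ?B'))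
    + lin_ext K ?r = lin_ext K (x n) - (?L' + fscale (1/2) ?B')"
    unfolding e by (simp add: fs.scale_right_diff_distrib)
  ultimately show ?thesis
    unfolding K[OF kx] cl_eq_iff by (simp only:)
qed

section \<open>The exponential as a grouplike sequence of degree 0\<close>

lemma grouplike_expw:
  assumes "\<And>k. p k \<in> carr (V 0)"
  shows "grouplike (expw (\<lambda>k. (0, p k)))"
  unfolding grouplike_def
proof (intro conjI allI)
  let ?e = "expw (\<lambda>k. (0, p k)) :: nat \<Rightarrow> _ \<Rightarrow>\<^sub>0 'k"
  show k: "Poly_Mapping.keys (?e n) \<subseteq> words V" for n
    by (rule subset_trans[OF keys_expw[of p V, OF assms]]) auto
  show "pairs (lin_ext comult_word (?e n))
    - (\<Sum>i\<le>n. Poly_Mapping.single (cl (?e i), cl (?e (n - i))) 1) \<in> trel" for n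
    unfolding comult_expw pairs.sum sum_subtractf[symmetric]
    by (intro fs.subspace_sum[OF tensor_rel_subspace] pairs_box k)
qed simp

lemma parity_even:
  assumes "Poly_Mapping.keys f \<subseteq> {w \<in> words V. wdeg w = 0}"
  shows "parity V (cl f) = cl f"
proof -
  have "wt (\<lambda>w. sg (wdeg w)) f = fscale 1 f"
    using subsetD[OF assms] by (intro wt_const) simp
  then show ?thesis by (simp add: parity_cl)
qed

lemma len_ext: "len (Suc k) (pad [v] [] f) = pad [v] [] (len k f)"
  using subset_refl[of "Poly_Mapping.keys f"]
  by (induction f rule: supp_induct) (simp_all add: pad.zero wt.zero pad.add wt.add pad_single wt_single)

lemma len_0_ext: "len 0 (pad [v] [] f) = 0"
  using subset_refl[of "Poly_Mapping.keys f"]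
  by (induction f rule: supp_induct) (simp_all add: pad.zero wt.zero pad.add wt.add pad_single wt_single)

lemma len_0_expw: "len 0 (expw p n) = (if n = 0 then Poly_Mapping.single [] 1 else 0)"
  by (cases n) (simp_all add: expw.simps(2) wt.sum wt.scale len_0_ext wt_single del: length_0_conv)

text \<open>A word of length 1 arises only by prefixing a letter to the empty word, which occurs
  only in the coefficient of index 0. So \<open>k = n\<close>, and the weight \<open>Suc n\<close>
  cancels the denominator.\<close>

lemma len_1_expw: "len 1 (expw p (Suc n)) = Poly_Mapping.single [p n] 1"
proof -
  have "(\<Sum>k\<le>n. fscale (of_nat (Suc k)) (pad [p k] [] (len 0 (expw p (n - k)))))
    = (\<Sum>k\<le>n. if k = n then Poly_Mapping.single [p k] (of_nat (Suc k)) else 0)"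
    by (rule sum.cong) (auto simp: len_0_expw pad.zero pad_single fscale_single simp del: length_0_conv of_nat_Suc)
  then have "len 1 (expw p (Suc n)) = fscale (1 / of_nat (Suc n)) (Poly_Mapping.single [p n] (of_nat (Suc n)))"
    by (simp add: expw.simps(2) wt.sum wt.scale len_ext del: of_nat_Suc length_0_conv)
  moreover have "(of_nat (Suc n) :: 'k) \<noteq> 0" by (rule of_nat_neq_0)
  ultimately show ?thesis by (simp add: fscale_single del: of_nat_Suc)
qed

end

text \<open>Representatives of the images are chosen of degree 0, which \<open>has_degree\<close>
  allows; in C[2] their single letters are then 2-cochains.\<close>

lemma coalgebra_morphism_grouplike:
  fixes V :: "('k::field_char_0, 'v::plus) gvspace" and W :: "('k, 'w::plus) gvspace"
  assumes V: "gvs V" and W: "gvs W" and F: "coalgebra_morphism V W F" and x: "gvs.grouplike V x"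
    and even: "\<And>n. Poly_Mapping.keys (x n) \<subseteq> {w \<in> words V. wdeg w = 0}"
  obtains y where "gvs.grouplike W y" "\<And>n. Poly_Mapping.keys (y n) \<subseteq> {w \<in> words W. wdeg w = 0}"
    "\<And>n. F (x n +o sym_rel V) = y n +o sym_rel W"
proof -
  interpret V: gvs V by fact
  interpret W: gvs W by fact
  have lin: "linear_on (Sym V) (Sym W) F" using F by (simp add: coalgebra_morphism_def)
  have "\<exists>g. Poly_Mapping.keys g \<subseteq> {w \<in> words W. wdeg w = 0} \<and> F (V.cl (x n)) = W.cl g" for n
  proof -
    have "V.cl (x n) \<in> Sym_deg V 0"
      unfolding Sym_deg_def using even[of n] by (intro imageI) simp
    then have "F (V.cl (x n)) \<in> Sym_deg W (0 + 0)"
      using F unfolding coalgebra_morphism_def has_degree_def by blast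
    then show ?thesis unfolding Sym_deg_def add_0
      by (elim imageE CollectE) (rule exI, rule conjI, assumption, assumption)
  qed
  from choice[OF allI[OF this]] obtain y
    where y': "\<forall>n. Poly_Mapping.keys (y n) \<subseteq> {w \<in> words W. wdeg w = 0} \<and> F (V.cl (x n)) = W.cl (y n)" ..
  have ky: "Poly_Mapping.keys (y n) \<subseteq> {w \<in> words W. wdeg w = 0}"
    and y: "F (V.cl (x n)) = W.cl (y n)" for n using spec[OF y', of n] by simp_all
  have kx: "Poly_Mapping.keys (x n) \<subseteq> words V" for n using x by (simp add: V.grouplike_def)
  have "W.grouplike y"
    unfolding W.grouplike_def
  proof (intro conjI allI)
    show "Poly_Mapping.keys (y n) \<subseteq> words W" for n by (rule subset_trans[OF ky]) auto
    have "W.cl (y 0) = F (monomial V [])"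
      using x unfolding y[symmetric] by (simp add: V.grouplike_def V.monomial_cl)
    then show "W.cl (y 0) = W.cl (Poly_Mapping.single [] 1)"
      using F by (simp add: coalgebra_morphism_def W.monomial_cl)
    fix n
    have cx: "comult V (V.cl (x n)) =
        (\<Sum>i\<le>n. Poly_Mapping.single (V.cl (x i), V.cl (x (n - i))) 1) +o tensor_rel (Sym V) (Sym V)"
      unfolding V.comult_cl using x by (simp add: coset_eq_iff[OF tensor_rel_subgrp] V.grouplike_def)
    have "tensor_map (Sym W) (Sym W) F F (comult V (V.cl (x n))) = comult W (F (V.cl (x n)))"
      using F V.cl_carr[OF kx] unfolding coalgebra_morphism_def by blast
    then have "W.pairs (lin_ext comult_word (y n)) +o tensor_rel (Sym W) (Sym W) =
      (\<Sum>i\<le>n. Poly_Mapping.single (W.cl (y i), W.cl (y (n - i))) 1) +o tensor_rel (Sym W) (Sym W)"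
      unfolding cx tensor_map_coset[OF lin lin] y W.comult_cl by (simp add: lin_simps y)
    then show "W.pairs (lin_ext comult_word (y n))
      - (\<Sum>i\<le>n. Poly_Mapping.single (W.cl (y i), W.cl (y (n - i))) 1) \<in> W.trel"
      by (simp only: coset_eq_iff[OF tensor_rel_subgrp])
  qed
  then show ?thesis using ky y by (rule that)
qed

section \<open>Cochain complexes\<close>

lemma vector_space_cscale: "vector_space s \<Longrightarrow> vector_space (cscale s)"
  unfolding vector_space_def cscale_def by (auto simp: fun_eq_iff)

lemma gcirc_add_left:
  assumes "vector_space s"
  shows "gcirc s k l (f + f') g = gcirc s k l f g + gcirc s k l f' g"
proof -
  interpret vector_space s by fact
  show ?thesis by (auto simp: gcirc_def fun_eq_iff scale_right_distrib sum.distrib)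
qed

lemma gcirc_scale_left:
  assumes "vector_space s"
  shows "gcirc s k l (cscale s c f) g = cscale s c (gcirc s k l f g)"
proof -
  interpret vector_space s by fact
  show ?thesis by (auto simp: gcirc_def fun_eq_iff cscale_def scale_sum_right mult.commute)
qed

lemma gcirc_add_right:
  assumes "vector_space s" "h \<in> CHoch s n"
  shows "gcirc s k l h (f + f') = gcirc s k l h f + gcirc s k l h f'"
proof -
  interpret vector_space s by fact
  have "h (xs @ (u + v) # ys) = h (xs @ u # ys) + h (xs @ v # ys)" for xs ys u v
    using assms(2) unfolding CHoch_def by blast
  then show ?thesis by (auto simp: gcirc_def fun_eq_iff scale_right_distrib sum.distrib)
qed

lemma gcirc_scale_right:
  assumes "vector_space s" "h \<in> CHoch s n"
  shows "gcirc s k l h (cscale s c f) = cscale s c (gcirc s k l h f)"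
proof -
  interpret vector_space s by fact
  have "h (xs @ s c u # ys) = s c (h (xs @ u # ys))" for xs ys u
    using assms(2) unfolding CHoch_def by blast
  then show ?thesis by (auto simp: gcirc_def fun_eq_iff cscale_def scale_sum_right mult.commute)
qed

lemma cochain2_Cons [simp]: "cochain2 f [x, y] = f x y"
  by (simp add: cochain2_def)

lemma cochain2_length: "length xs \<noteq> 2 \<Longrightarrow> cochain2 f xs = 0"
  by (auto simp: cochain2_def split: list.splits)

lemma cochain2_CHoch:
  fixes s :: "'k::field \<Rightarrow> 'a::ab_group_add \<Rightarrow> 'a"
  assumes "bilinear_map s f" shows "cochain2 f \<in> CHoch s 2"
proof -
  have lin: "Vector_Spaces.linear s s (\<lambda>y. f x y)" "Vector_Spaces.linear s s (\<lambda>x. f x y)" for x y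
    using assms by (auto simp: bilinear_map_def)
  interpret vector_space s by (rule Vector_Spaces.linear.axioms(1)[OF lin(1)])
  have cases: "(xs = [] \<and> (\<exists>y. ys = [y])) \<or> (\<exists>x. xs = [x] \<and> ys = []) \<or> length xs + length ys \<noteq> 1"
    for xs ys :: "'a list"
    by (cases xs; cases ys) auto
  have "cochain2 f (xs @ (u + v) # ys) = cochain2 f (xs @ u # ys) + cochain2 f (xs @ v # ys)"
    for xs ys u v
    using cases[of xs ys] lin[THEN Vector_Spaces.linear.axioms(3), THEN module_hom.add] by (auto simp: cochain2_length)
  moreover have "cochain2 f (xs @ s c u # ys) = s c (cochain2 f (xs @ u # ys))" for xs ys c u
    using cases[of xs ys] lin[THEN Vector_Spaces.linear.axioms(3), THEN module_hom.scale] by (auto simp: cochain2_length)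
  ultimately show ?thesis by (auto simp: CHoch_def cochain2_length)
qed

text \<open>Common setting for the Hochschild and Harrison cochains, so that formality is
  transported once for both.\<close>

locale subcomplex = vector_space s
  for s :: "'k::field_char_0 \<Rightarrow> 'a::ab_group_add \<Rightarrow> 'a" +
  fixes m :: "'a \<Rightarrow> 'a \<Rightarrow> 'a" and C :: "int \<Rightarrow> 'a cochain set"
  assumes bilinear: "bilinear_map s m"
    and C_zero: "0 \<in> C k"
    and C_add: "f \<in> C k \<Longrightarrow> g \<in> C k \<Longrightarrow> f + g \<in> C k"
    and C_scale: "f \<in> C k \<Longrightarrow> cscale s c f \<in> C k"
begin

sublocale cs: vector_space "cscale s"
  by (rule vector_space_cscale) (rule vector_space_axioms)

lemma hdiff_add: "hdiff s m k (f + g) = hdiff s m k f + hdiff s m k g"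
  by (simp add: hdiff_def gbracket_def gcirc_add_left[OF vector_space_axioms]
      gcirc_add_right[OF vector_space_axioms cochain2_CHoch[OF bilinear]] cs.scale_right_distrib)

lemma hdiff_scale: "hdiff s m k (cscale s c f) = cscale s c (hdiff s m k f)"
  by (simp add: hdiff_def gbracket_def gcirc_scale_left[OF vector_space_axioms]
      gcirc_scale_right[OF vector_space_axioms cochain2_CHoch[OF bilinear]]
      cs.scale_right_diff_distrib mult.commute)

lemma cobound_subspace: "cs.subspace (coboundaries s m C k)"
proof (rule cs.subspaceI)
  show "0 \<in> coboundaries s m C k"
    unfolding coboundaries_def using hdiff_scale[of "k - 1" 0 0] C_zero
    by (intro image_eqI[of _ _ 0]) simp_all
  show "f + g \<in> coboundaries s m C k" if "f \<in> coboundaries s m C k" "g \<in> coboundaries s m C k" for f g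
    using that C_add unfolding coboundaries_def by (auto simp: hdiff_add[symmetric])
  show "cscale s c f \<in> coboundaries s m C k" if "f \<in> coboundaries s m C k" for c f
    using that C_scale unfolding coboundaries_def by (auto simp: hdiff_scale[symmetric])
qed

lemma cobound_subgrp [simp]: "subgrp (coboundaries s m C k)"
  by (simp add: subgrp_def cs.subspace_0[OF cobound_subspace] cs.subspace_diff[OF cobound_subspace])

lemma cocycles_closed:
  "f \<in> cocycles s m C k \<Longrightarrow> g \<in> cocycles s m C k \<Longrightarrow> f + g \<in> cocycles s m C k"
  "f \<in> cocycles s m C k \<Longrightarrow> cscale s c f \<in> cocycles s m C k"
  "0 \<in> cocycles s m C k"
  using hdiff_scale[of k 0 0]
  by (auto simp: cocycles_def hdiff_add hdiff_scale C_add C_scale C_zero)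

abbreviation "VC \<equiv> shift 2 (cochain_complex s C)"
abbreviation "VH \<equiv> shift 2 (cohomology s m C)"

lemma VC_simps: "carr (VC i) = C (i + 2)" "scl (VC i) = cscale s"
  by (simp_all add: shift_def cochain_complex_def)

lemma VH_carr: "carr (VH i) = (\<lambda>x. x +o coboundaries s m C (i + 2)) ` cocycles s m C (i + 2)"
  by (simp add: shift_def cohomology_def quot_def)

lemma VH_scl: "scl (VH i) c X = cscale s c ` X + coboundaries s m C (i + 2)"
  by (simp add: shift_def cohomology_def quot_def)

lemma VH_scl_coset:
  "scl (VH i) c (x +o coboundaries s m C (i + 2)) = cscale s c x +o coboundaries s m C (i + 2)"
  unfolding VH_scl
  by (rule coset_scale)
    (auto simp: cs.scale_right_distrib cs.subspace_scale[OF cobound_subspace] mult.commute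
      intro!: Vector_Spaces.linear.intro module_hom.intro cs.vector_space_axioms cs.module_axioms module_hom_axioms.intro)

lemma gvs_VC: "gvs VC"
  by unfold_locales (simp_all add: VC_simps C_add C_scale)

lemma gvs_VH: "gvs VH"
proof
  fix X Y :: "'a cochain set" and i c
  assume "X \<in> carr (VH i)"
  then obtain x where x: "x \<in> cocycles s m C (i + 2)" "X = x +o coboundaries s m C (i + 2)"
    by (auto simp: VH_carr)
  then show "scl (VH i) c X \<in> carr (VH i)"
    by (simp add: VH_scl_coset) (simp add: VH_carr cocycles_closed)
  assume "Y \<in> carr (VH i)"
  then obtain y where y: "y \<in> cocycles s m C (i + 2)" "Y = y +o coboundaries s m C (i + 2)"
    by (auto simp: VH_carr)
  show "X + Y \<in> carr (VH i)"
    unfolding x(2) y(2) coset_add[OF cobound_subgrp] VH_carr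
    by (intro imageI cocycles_closed x y)
qed

sublocale VC: gvs VC by (rule gvs_VC)
sublocale VH: gvs VH by (rule gvs_VH)

section \<open>Reading cochains off Sym (C[2])\<close>

definition letter :: "int \<Rightarrow> 'a cochain word \<Rightarrow> 'a cochain" where
  "letter k w = (if length w = 1 \<and> fst (hd w) = k then snd (hd w) else 0)"

text \<open>A linear left inverse of the map from cochains to one-letter monomials. Since it kills
  all relations, an equality in the quotient becomes an equality of cochains.\<close>

definition vpart :: "int \<Rightarrow> ('a cochain word \<Rightarrow>\<^sub>0 'k) \<Rightarrow> 'a cochain" where
  "vpart k = lift (cscale s) (letter k)"

interpretation vpart: Vector_Spaces.linear fscale "cscale s" "vpart k" for k
  unfolding vpart_def by (rule cs.lift_linear)

lemma vpart_single: "vpart k (Poly_Mapping.single w c) = cscale s c (letter k w)"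
  unfolding vpart_def by (rule cs.lift_single)

lemma letter_append: "letter k (xs @ l # ys) = (if xs = [] \<and> ys = [] \<and> fst l = k then snd l else 0)"
  by (cases xs) (auto simp: letter_def)

text \<open>Swaps have at least two letters and are sent to 0; on one-letter words the other
  generators express linearity, which holds exactly for cochains.\<close>

lemma vpart_sym_rel: assumes "f \<in> sym_rel VC" shows "vpart k f = 0"
  using assms unfolding sym_rel_span
proof (induction rule: fs.span_induct_alt)
  case (step c g h)
  from step(1) have "vpart k g = 0"
    by (cases rule: sym_gens_cases)
      (simp_all add: vpart.diff vpart_single letter_append VC_simps)
  then show ?case using step by (simp add: vpart.add vpart.scale)
qed (simp add: vpart.zero)

lemma vpart_cl: "VC.cl f = VC.cl g \<Longrightarrow> vpart k f = vpart k g"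
  unfolding VC.cl_eq_iff using vpart_sym_rel[of "f - g" k] by (simp add: vpart.diff)

lemma VC_rels:
  "u \<in> C (i + 2) \<Longrightarrow> Poly_Mapping.single [(i, cscale s c u)] 1 - Poly_Mapping.single [(i, u)] c \<in> sym_rel VC"
  "u \<in> C (i + 2) \<Longrightarrow> v \<in> C (i + 2) \<Longrightarrow> Poly_Mapping.single [(i, u + v)] 1
    - Poly_Mapping.single [(i, u)] 1 - Poly_Mapping.single [(i, v)] 1 \<in> sym_rel VC"
  "Poly_Mapping.single [(i, 0)] 1 \<in> sym_rel VC"
proof -
  show 1: "Poly_Mapping.single [(i, cscale s c u)] 1 - Poly_Mapping.single [(i, u)] c \<in> sym_rel VC"
    if "u \<in> C (i + 2)" for u c
    using VC.sym_rel_gen[OF gen_scl[of "[]" VC "[]" u i c]] that by (simp add: VC_simps)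
  show "Poly_Mapping.single [(i, u + v)] 1
    - Poly_Mapping.single [(i, u)] 1 - Poly_Mapping.single [(i, v)] 1 \<in> sym_rel VC"
    if "u \<in> C (i + 2)" "v \<in> C (i + 2)"
    using VC.sym_rel_gen[OF gen_add[of "[]" VC "[]" u i v]] that by (simp add: VC_simps)
  show "Poly_Mapping.single [(i, 0)] 1 \<in> sym_rel VC"
    using 1[OF C_zero, of 0] by simp
qed

text \<open>Multilinearity merges all one-letter words of degree 0 into one letter, the sum of their
  cochains with coefficients.\<close>

lemma len1_vpart:
  assumes "Poly_Mapping.keys f \<subseteq> {w \<in> words VC. wdeg w = 0}"
  shows "vpart 0 f \<in> C 2 \<and> VC.len 1 f - Poly_Mapping.single [(0, vpart 0 f)] 1 \<in> sym_rel VC"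
  using assms
proof (induction rule: supp_induct)
  case zero
  show ?case
    using VC.sym_rel_neg[OF VC_rels(3)[of 0]] by (simp add: vpart.zero wt.zero C_zero del: zero_fun_apply)
next
  case (single w c)
  show ?case
  proof (cases "length w = 1")
    case True
    then obtain i u where w: "w = [(i, u)]" by (cases w) auto
    have i: "i = 0" using single w by simp
    have u: "u \<in> C 2" using single w unfolding i by (simp add: VC_simps)
    show ?thesis
      using VC.sym_rel_neg[OF VC_rels(1)[of u 0 c]] u
      by (simp add: w i vpart_single wt_single letter_def C_scale)
  next
    case False
    then show ?thesis
      using VC.sym_rel_neg[OF VC_rels(3)[of 0]]
      by (simp add: vpart_single wt_single letter_def C_zero del: zero_fun_apply)
  qed
next
  case (add f g)
  have "Poly_Mapping.single [(0, vpart 0 f + vpart 0 g)] 1 - Poly_Mapping.single [(0, vpart 0 f)] 1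
     - Poly_Mapping.single [(0, vpart 0 g)] 1 \<in> sym_rel VC"
    using add by (intro VC_rels) simp_all
  from VC.sym_rel_diff[OF VC.sym_rel_add[OF conjunct2[OF add(1)] conjunct2[OF add(2)]] this]
  show ?case using add by (simp add: vpart.add wt.add C_add algebra_simps del: plus_fun_apply)
qed

section \<open>The zero class and finite sums in H[2]\<close>

lemma zero_class:
  "coboundaries s m C (i + 2) \<in> carr (VH i)"
  "Poly_Mapping.single [(i, coboundaries s m C (i + 2))] 1 \<in> sym_rel VH"
proof -
  let ?B = "coboundaries s m C (i + 2)"
  have B: "0 +o ?B = ?B" by simp
  then show c: "?B \<in> carr (VH i)"
    unfolding VH_carr using cocycles_closed(3) by (intro image_eqI[of _ _ 0]) simp_all
  have "scl (VH i) 0 ?B = ?B"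
    using VH_scl_coset[of i 0 0] by simp
  moreover have "Poly_Mapping.single ([] @ (i, scl (VH i) 0 ?B) # []) 1
      - Poly_Mapping.single ([] @ (i, ?B) # []) 0 \<in> sym_gens VH"
    by (rule gen_scl) (simp_all add: c)
  ultimately show "Poly_Mapping.single [(i, ?B)] 1 \<in> sym_rel VH"
    using VH.sym_rel_gen by simp
qed

text \<open>\<open>I\<close> is nonempty because the empty sum of sets is \<open>{0}\<close>,
  whereas the zero class is the set of coboundaries.\<close>

lemma letter_sum_VH:
  assumes "finite I" "I \<noteq> {}" "\<And>j. j \<in> I \<Longrightarrow> X j \<in> carr (VH i)"
  shows "sum X I \<in> carr (VH i) \<and> (\<Sum>j\<in>I. Poly_Mapping.single [(i, X j)] 1)
    - Poly_Mapping.single [(i, sum X I)] 1 \<in> sym_rel VH"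
  using assms
proof (induction I rule: finite_ne_induct)
  case (insert j I)
  then have X: "X j \<in> carr (VH i)" "sum X I \<in> carr (VH i)" by simp_all
  have "Poly_Mapping.single ([] @ (i, X j + sum X I) # []) 1 - Poly_Mapping.single ([] @ (i, X j) # []) 1
     - Poly_Mapping.single ([] @ (i, sum X I) # []) 1 \<in> sym_gens VH"
    by (rule gen_add) (simp_all add: X)
  from VH.sym_rel_gen[OF this] have 1: "Poly_Mapping.single [(i, X j + sum X I)] 1 - Poly_Mapping.single [(i, X j)] 1
     - Poly_Mapping.single [(i, sum X I)] 1 \<in> sym_rel VH" by simp
  have "(\<Sum>j\<in>I. Poly_Mapping.single [(i, X j)] 1)
    - Poly_Mapping.single [(i, sum X I)] 1 \<in> sym_rel VH" using insert by simp
  from VH.sym_rel_diff[OF this 1] show ?case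
    using insert X VH.carr_add by (simp add: algebra_simps)
qed simp

text \<open>The sign in d is trivial in cochain degree 2, but scaling in the quotient still adds the
  coboundaries; this extra summand persists in the sums below.\<close>

lemma scl_cohomology_one: "scl (cohomology s m C k) (sg 2) X = X + coboundaries s m C k"
  by (simp add: cohomology_def quot_def sg_def)

lemma cobound_plus: "coboundaries s m C k + coboundaries s m C k = coboundaries s m C k"
  using coset_add[OF cobound_subgrp, of 0 k 0] by simp

lemma sum_plus_cobound:
  assumes "finite I" "I \<noteq> {}"
  shows "(\<Sum>i\<in>I. S i + coboundaries s m C k) = (\<Sum>i\<in>I. S i) + coboundaries s m C k"
  using assms
proof (induction I rule: finite_ne_induct)
  case (insert i I)
  have "S i + coboundaries s m C k + (sum S I + coboundaries s m C k)
    = S i + sum S I + (coboundaries s m C k + coboundaries s m C k)"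
    by (simp only: ac_simps)
  then show ?case using insert by (simp add: cobound_plus)
qed simp

section \<open>Transport of the Maurer-Cartan series along the formality morphism\<close>

theorem formal_lift:
  assumes "formal s m C" and mc: "maurer_cartan s m C \<pi>"
  obtains \<nu> :: "nat \<Rightarrow> 'a cochain" where "\<And>n. \<nu> n \<in> C 2" "\<nu> 1 \<in> \<pi> 0"
    "\<And>n. 1 \<le> n \<Longrightarrow> hdiff s m 2 (\<nu> n)
      + cscale s (1 / 2) (\<Sum>i\<in>{1..<n}. gbracket s 2 2 (\<nu> i) (\<nu> (n - i))) = 0"
proof -
  from assms(1)[unfolded formal_def] obtain QH QC \<Phi> where QH: "codiff_H s m C QH"
    and QC: "codiff_C s m C QC" and mor: "coalgebra_morphism VH VC \<Phi>"
    and comm: "\<forall>X\<in>carr (Sym VH). QC (\<Phi> X) = \<Phi> (QH X)"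
    and rep: "\<forall>i. \<forall>X\<in>carr (VH i). \<exists>z\<in>X. \<Phi> (monomial VH [(i, X)]) = monomial VC [(i, z)]"
    by (elim exE conjE) (rule that)
  have \<pi>: "\<pi> k \<in> carr (VH 0)" for k
    using mc[unfolded maurer_cartan_def, THEN conjunct1, THEN spec, of k]
    by (simp only: shift_def add_0)
  let ?e = "expw (\<lambda>k. (0 :: int, \<pi> k)) :: nat \<Rightarrow> _ \<Rightarrow>\<^sub>0 'k"
  \<comment> \<open>The coefficient of order \<open>n\<close> in \<lambda> \<pi> is the coefficient
    of order \<open>n - 1\<close> in \<pi>.\<close>
  define p where "p n = \<pi> (n - 1)" for n
  have p: "p n \<in> carr (VH 0)" for n unfolding p_def by (rule \<pi>)
  have ge: "VH.grouplike ?e" by (rule VH.grouplike_expw) (rule \<pi>)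
  have ke: "Poly_Mapping.keys (?e n) \<subseteq> {w \<in> words VH. wdeg w = 0}" for n
    by (rule keys_expw) (rule \<pi>)
  have ke': "Poly_Mapping.keys (?e n) \<subseteq> words VH" for n
    by (rule ge[unfolded VH.grouplike_def, THEN conjunct1, THEN spec, THEN conjunct1])
  have e0: "VH.len 1 (?e 0) \<in> sym_rel VH" by (simp add: wt_single)
  have e1: "VH.len 1 (?e n) - Poly_Mapping.single [(0, p n)] 1 \<in> sym_rel VH" if n: "1 \<le> n" for n
  proof -
    obtain N where "n = Suc N" using n by (cases n) auto
    then show ?thesis by (simp only: VH.len_1_expw p_def diff_Suc_1 diff_self VH.sym_rel_0)
  qed
  obtain x where gx: "VC.grouplike x" and kx: "\<And>n. Poly_Mapping.keys (x n) \<subseteq> {w \<in> words VC. wdeg w = 0}"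
    and x: "\<And>n. \<Phi> (VH.cl (?e n)) = VC.cl (x n)"
    by (rule coalgebra_morphism_grouplike[OF gvs_VH gvs_VC mor ge ke]) (rule that)

  let ?B = "coboundaries s m C 3"
  let ?q1 = "\<lambda>i X. coboundaries s m C (i + 3)"
  let ?q2 = "\<lambda>i j X Y. scl (cohomology s m C (i + j + 3)) (sg (i + 2))
    (sbracket s m C (i + 2) (j + 2) X Y)"
  let ?S = "\<lambda>X Y. sbracket s m C 2 2 X Y"
  have codH: "coderivation VH QH" and projH: "has_projection VH ?q1 ?q2 QH"
    by (rule QH[unfolded codiff_H_def, THEN conjunct1], rule QH[unfolded codiff_H_def, THEN conjunct2])
  have linH: "linear_on (Sym VH) (Sym VH) QH" by (rule codH[unfolded coderivation_def, THEN conjunct1])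
  have q2: "?q2 0 0 X Y = ?S X Y + ?B" for X Y
    by (simp only: add_0 scl_cohomology_one)
  \<comment> \<open>That brackets of cocycles are cocycles, independently of representatives, need not be proved: the
    \<open>\<S>\<^sup>1\<close>-projection of \<open>QH\<close> lies in \<open>\<S>(H[2])\<close>, and a monomial in it has its letters in the carriers.\<close>
  have Y: "?S X Y + ?B \<in> carr (VH 1)" if "X \<in> carr (VH 0)" "Y \<in> carr (VH 0)" for X Y
  proof -
    have "monomial VH [(0, X), (0, Y)] \<in> carr (Sym VH)"
      unfolding VH.monomial_cl using that by (intro VH.cl_carr) simp
    from linH[unfolded linear_on_def, THEN conjunct1, THEN bspec, OF this]
    have "proj1 VH (QH (monomial VH [(0, X), (0, Y)])) \<in> carr (Sym VH)"
      by (rule VH.proj1_linear[unfolded linear_on_def, THEN conjunct1, THEN bspec])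
    also have "proj1 VH (QH (monomial VH [(0, X), (0, Y)])) = monomial VH [(0 + 0 + 1, ?q2 0 0 X Y)]"
      by (rule projH[unfolded has_projection_def, THEN conjunct2, THEN conjunct1, THEN spec,
            THEN spec, THEN bspec, OF that(1), THEN bspec, OF that(2)])
    finally have "Poly_Mapping.keys (Poly_Mapping.single [(0 + 0 + 1, ?S X Y + ?B)] (1 :: 'k)) \<subseteq> words VH"
      unfolding q2 VH.monomial_cl by (rule VH.cl_mem_carr_iff[THEN iffD1])
    then show ?thesis by (simp only: keys_single words_simps) simp
  qed
  have B1: "Poly_Mapping.single [(1, ?B)] 1 \<in> sym_rel VH"
    using zero_class(2)[of 1] by simp
  have "(\<Sum>i\<in>{1..<n}. Poly_Mapping.single [(1, ?q2 0 0 (p i) (p (n - i)))] 1) \<in> sym_rel VH" for n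
  proof (cases "{1..<n} = {}")
    case False
    \<comment> \<open>Order \<open>n\<close> of [\<lambda> \<pi>, \<lambda> \<pi>] is order
      \<open>n - 2\<close> of [\<pi>, \<pi>], so the Maurer-Cartan equation applies with
      \<open>N\<close>.\<close>
    define N where "N = n - 2"
    have n: "n = N + 2" using False by (simp add: N_def)
    have "(\<Sum>i\<in>{1..<n}. ?S (p i) (p (n - i))) = (\<Sum>j\<le>N. ?S (\<pi> j) (\<pi> (N - j)))"
      by (rule sum.reindex_bij_witness[of _ Suc "\<lambda>i. i - 1"]) (auto simp: p_def n)
    also have "\<dots> = ?B"
      using mc unfolding maurer_cartan_def by (elim conjE) (erule spec)
    finally have "(\<Sum>i\<in>{1..<n}. ?S (p i) (p (n - i)) + ?B) = ?B"
      by (simp only: sum_plus_cobound[OF finite_atLeastLessThan False] cobound_plus)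
    moreover have "(\<Sum>i\<in>{1..<n}. Poly_Mapping.single [(1, ?S (p i) (p (n - i)) + ?B)] 1)
      - Poly_Mapping.single [(1, \<Sum>i\<in>{1..<n}. ?S (p i) (p (n - i)) + ?B)] 1 \<in> sym_rel VH"
      by (rule conjunct2[OF letter_sum_VH]) (use False in \<open>simp_all add: Y p\<close>)
    ultimately have "(\<Sum>i\<in>{1..<n}. Poly_Mapping.single [(1, ?S (p i) (p (n - i)) + ?B)] 1)
      - Poly_Mapping.single [(1, ?B)] 1 \<in> sym_rel VH"
      by (simp only:)
    from VH.sym_rel_add[OF this B1] show ?thesis
      unfolding q2 by (simp only: diff_add_cancel)
  qed simp
  note YS = this
  have "proj1 VH (QH (VH.cl (?e n))) = sym_rel VH" for n
  proof -
    let ?X = "(if n = 0 then 0 else Poly_Mapping.single [(1, ?q1 0 (p n))] 1)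
      + fscale (1 / 2) (\<Sum>i\<in>{1..<n}. Poly_Mapping.single [(1, ?q2 0 0 (p i) (p (n - i)))] 1)"
    have "proj1 VH (QH (VH.cl (?e n))) = VH.cl ?X"
      by (rule VH.proj1_coderivation[OF linH projH ge e0 p e1])
    moreover have "?X \<in> sym_rel VH"
      using B1 by (intro VH.sym_rel_add VH.sym_rel_scale YS) simp
    ultimately show ?thesis by (simp only: coset_zero_iff[OF VH.sym_rel_subgrp])
  qed
  then have QHe: "QH (VH.cl (?e n)) = sym_rel VH" for n
    by (intro VH.coderivation_vanishes[OF codH ge] VH.parity_even ke)

  have lin\<Phi>: "linear_on (Sym VH) (Sym VC) \<Phi>" by (rule mor[unfolded coalgebra_morphism_def, THEN conjunct1])
  have \<Phi>0: "\<Phi> (sym_rel VH) = sym_rel VC"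
  proof -
    obtain G where G: "\<And>f. Poly_Mapping.keys f \<subseteq> words VH \<Longrightarrow> \<Phi> (VH.cl f) = VC.cl (lin_ext G f)"
      by (rule linear_on_Sym_lift[OF gvs_VH gvs_VC lin\<Phi>]) (rule that)
    from G[of 0] show ?thesis by (simp add: le.zero)
  qed
  have QCx: "QC (VC.cl (x n)) = sym_rel VC" for n
    using bspec[OF comm VH.cl_carr[OF ke'[of n]]] by (simp only: x QHe \<Phi>0)

  define \<nu> where "\<nu> n = vpart 0 (x n)" for n
  have \<nu>: "\<nu> n \<in> C 2" and x1: "VC.len 1 (x n) - Poly_Mapping.single [(0, \<nu> n)] 1 \<in> sym_rel VC" for n
    using len1_vpart[OF kx, of n] by (simp_all only: \<nu>_def)
  have \<nu>': "\<nu> n \<in> carr (VC 0)" for n using \<nu> by (simp add: VC_simps)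
  \<comment> \<open>The constant term has the class of the empty word, which has no one-letter
    part.\<close>
  have "VC.cl (VC.len 1 (x 0)) = VC.cl (VC.len 1 (Poly_Mapping.single [] 1))"
    using gx by (intro VC.len_cl) (simp add: VC.grouplike_def)
  then have x0: "VC.len 1 (x 0) \<in> sym_rel VC"
    unfolding VC.cl_eq_iff by (simp add: wt_single)
  let ?r1 = "\<lambda>i f. hdiff s m (i + 2) f"
  let ?r2 = "\<lambda>i j f g. cscale s (sg (i + 2)) (gbracket s (i + 2) (j + 2) f g)"
  have codC: "coderivation VC QC" and projC: "has_projection VC ?r1 ?r2 QC"
    by (rule QC[unfolded codiff_C_def, THEN conjunct1], rule QC[unfolded codiff_C_def, THEN conjunct2])
  have linC: "linear_on (Sym VC) (Sym VC) QC" by (rule codC[unfolded coderivation_def, THEN conjunct1])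
  have "hdiff s m 2 (\<nu> n) + cscale s (1 / 2) (\<Sum>i\<in>{1..<n}. gbracket s 2 2 (\<nu> i) (\<nu> (n - i))) = 0"
    if n: "1 \<le> n" for n
  proof -
    let ?X = "(if n = 0 then 0 else Poly_Mapping.single [(1, ?r1 0 (\<nu> n))] 1)
      + fscale (1 / 2) (\<Sum>i\<in>{1..<n}. Poly_Mapping.single [(1, ?r2 0 0 (\<nu> i) (\<nu> (n - i)))] 1)"
    have "proj1 VC (QC (VC.cl (x n))) = VC.cl ?X"
      by (rule VC.proj1_coderivation[OF linC projC gx x0 \<nu>' x1])
    then have "VC.cl ?X = proj1 VC (VC.cl 0)"
      unfolding QCx by simp
    then have "?X \<in> sym_rel VC"
      unfolding VC.proj1_cl VC.cl_eq_iff by (simp only: wt.zero diff_zero)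
    \<comment> \<open>Degree 1 in C[2] is cochain degree 3: the vanishing class turns into an
      equation of 3-cochains.\<close>
    from vpart_sym_rel[OF this, of 1] show ?thesis
      using n by (simp add: vpart.add vpart.scale vpart.sum vpart_single letter_def sg_def
        del: plus_fun_apply zero_fun_apply)
  qed
  moreover have "\<nu> 1 \<in> \<pi> 0"
  proof -
    obtain z where z: "z \<in> \<pi> 0" "\<Phi> (monomial VH [(0, \<pi> 0)]) = monomial VC [(0, z)]"
      using bspec[OF spec[OF rep] \<pi>] by (rule bexE)
    \<comment> \<open>At order one the exponential is the single letter \<open>\<pi> 0\<close>, so
      the section property of \<Phi> identifies \<open>\<nu> 1\<close> with a representing
      cocycle.\<close>
    have "?e 1 = Poly_Mapping.single [(0, \<pi> 0)] 1"
      by (simp add: expw.simps(2) pad_single)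
    then have "VC.cl (x 1) = VC.cl (Poly_Mapping.single [(0, z)] 1)"
      using x[of 1] z(2) by (simp only: VH.monomial_cl VC.monomial_cl)
    from vpart_cl[OF this, of 0] have "\<nu> 1 = z"
      by (simp add: \<nu>_def vpart_single letter_def)
    then show ?thesis using z by simp
  qed
  ultimately show ?thesis using \<nu> by (intro that[of \<nu>])
qed

end

section \<open>Associativity of the deformed product\<close>

text \<open>Insertion into the second slot carries the sign -1, so composing a bilinear map with
  itself gives its associator.\<close>

lemma gcirc_22:
  assumes "vector_space s"
  shows "gcirc s 2 2 f g [a, b, c] = f [g [a, b], c] - f [a, g [b, c]]"
proof -
  interpret vector_space s by fact
  have "{..<2} = {0, 1 :: nat}" by auto
  then show ?thesis by (simp add: gcirc_def sg_def numeral_2_eq_2)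
qed

lemma CHoch2_bilinear:
  assumes "f \<in> CHoch s 2"
  shows "f [u + v, y] = f [u, y] + f [v, y]" "f [x, u + v] = f [x, u] + f [x, v]"
proof -
  have *: "f (xs @ (u + v) # ys) = f (xs @ u # ys) + f (xs @ v # ys)" for xs ys
    using assms unfolding CHoch_def by blast
  show "f [u + v, y] = f [u, y] + f [v, y]" using *[of "[]" "[y]"] by simp
  show "f [x, u + v] = f [x, u] + f [x, v]" using *[of "[x]" "[]"] by simp
qed

lemma cochain2_CHoch2:
  assumes "f \<in> CHoch s 2" shows "cochain2 (\<lambda>x y. f [x, y]) = f"
proof
  fix xs
  have "f xs = 0" if "length xs \<noteq> 2" using assms that by (simp add: CHoch_def)
  then show "cochain2 (\<lambda>x y. f [x, y]) xs = f xs"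
    by (auto simp: cochain2_def split: list.splits)
qed

text \<open>Both sides expand into sums over r + t + i + j + k = n. Grouping by the orders (i, j, k)
  of the three coefficients leaves an inner sum that is the hypothesis at order n - i - j -
  k.\<close>

lemma star_assoc:
  fixes \<mu> :: "nat \<Rightarrow> 'a \<Rightarrow> 'a \<Rightarrow> 'a::ab_group_add"
  assumes add: "\<And>r u v y. \<mu> r (u + v) y = \<mu> r u y + \<mu> r v y" "\<And>r u v x. \<mu> r x (u + v) = \<mu> r x u + \<mu> r x v"
    and assoc: "\<And>n a b c. (\<Sum>i\<le>n. \<mu> i (\<mu> (n - i) a b) c - \<mu> i a (\<mu> (n - i) b c)) = 0"
  shows "star \<mu> (star \<mu> x y) z = star \<mu> x (star \<mu> y z)"
proof (rule fps_ext)
  fix n :: nat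
  \<comment> \<open>Additivity at 0 + 0 provides the case of the empty sum.\<close>
  have sum_left: "\<mu> r (sum g A) w = (\<Sum>i\<in>A. \<mu> r (g i) w)" if "finite A" for r g w and A :: "'i set"
    using that add(1)[of r 0 0 w] by (induction A rule: finite_induct) (simp_all add: add)
  have sum_right: "\<mu> r w (sum g A) = (\<Sum>i\<in>A. \<mu> r w (g i))" if "finite A" for r g w and A :: "'i set"
    using that add(2)[of r w 0 0] by (induction A rule: finite_induct) (simp_all add: add)
  let ?x = "fps_nth x" and ?y = "fps_nth y" and ?z = "fps_nth z"
  define D where "D = {(r, t, i, j, k). r + t + i + j + k = n}"
  define E where "E = {(i, j, k). i + j + k \<le> n}"
  have E: "finite E" by (rule finite_subset[of _ "{..n} \<times> {..n} \<times> {..n}"]) (auto simp: E_def)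
  have "fps_nth (star \<mu> (star \<mu> x y) z) n = (\<Sum>r\<le>n. \<Sum>l\<le>n - r. \<Sum>t\<le>l. \<Sum>i\<le>l - t.
      \<mu> r (\<mu> t (?x i) (?y (l - t - i))) (?z (n - r - l)))"
    by (simp add: star_def sum_left)
  also have "\<dots> = (\<Sum>(r, t, i, j, k)\<in>D. \<mu> r (\<mu> t (?x i) (?y j)) (?z k))"
    by (simp add: sum.Sigma split_def, rule sum.reindex_bij_witness[of _ "\<lambda>(r, t, i, j, k). (r, t + i + j, t, i)"
          "\<lambda>(r, l, t, i). (r, t, i, l - t - i, n - r - l)"]) (auto simp: D_def)
  finally have 1: "fps_nth (star \<mu> (star \<mu> x y) z) n =
      (\<Sum>(r, t, i, j, k)\<in>D. \<mu> r (\<mu> t (?x i) (?y j)) (?z k))" .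
  have "fps_nth (star \<mu> x (star \<mu> y z)) n = (\<Sum>r\<le>n. \<Sum>i\<le>n - r. \<Sum>t\<le>n - r - i. \<Sum>j\<le>n - r - i - t.
      \<mu> r (?x i) (\<mu> t (?y j) (?z (n - r - i - t - j))))"
    by (simp add: star_def sum_right add.assoc)
  also have "\<dots> = (\<Sum>(r, t, i, j, k)\<in>D. \<mu> r (?x i) (\<mu> t (?y j) (?z k)))"
    by (simp add: sum.Sigma split_def, rule sum.reindex_bij_witness[of _ "\<lambda>(r, t, i, j, k). (r, i, t, j)"
          "\<lambda>(r, i, t, j). (r, t, i, j, n - r - i - t - j)"]) (auto simp: D_def)
  finally have 2: "fps_nth (star \<mu> x (star \<mu> y z)) n =
      (\<Sum>(r, t, i, j, k)\<in>D. \<mu> r (?x i) (\<mu> t (?y j) (?z k)))" .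
  have "(\<Sum>(r, t, i, j, k)\<in>D. \<mu> r (\<mu> t (?x i) (?y j)) (?z k) - \<mu> r (?x i) (\<mu> t (?y j) (?z k))) =
    (\<Sum>(i, j, k)\<in>E. \<Sum>r\<le>n - i - j - k. \<mu> r (\<mu> (n - i - j - k - r) (?x i) (?y j)) (?z k)
      - \<mu> r (?x i) (\<mu> (n - i - j - k - r) (?y j) (?z k)))"
    by (simp add: sum.Sigma split_def E, rule sum.reindex_bij_witness[of _ "\<lambda>((i, j, k), r). (r, n - i - j - k - r, i, j, k)"
          "\<lambda>(r, t, i, j, k). ((i, j, k), r)"]) (auto simp: D_def E_def)
  also have "\<dots> = 0"
    by (simp only: assoc split_def sum.neutral_const)
  finally show "fps_nth (star \<mu> (star \<mu> x y) z) n = fps_nth (star \<mu> x (star \<mu> y z)) n"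
    unfolding 1 2 by (simp add: split_def sum_subtractf)
qed

lemma star_commute:
  fixes \<mu> :: "nat \<Rightarrow> 'a \<Rightarrow> 'a \<Rightarrow> 'a::ab_group_add"
  assumes "\<And>r x y. \<mu> r x y = \<mu> r y x"
  shows "star \<mu> x y = star \<mu> y x"
proof (rule fps_ext)
  fix n :: nat
  have "(\<Sum>i\<le>l. \<mu> r (fps_nth x i) (fps_nth y (l - i))) = (\<Sum>i\<le>l. \<mu> r (fps_nth y i) (fps_nth x (l - i)))"
    for r l
    by (rule sum.reindex_bij_witness[of _ "\<lambda>i. l - i" "\<lambda>i. l - i"]) (auto intro: assms)
  then show "fps_nth (star \<mu> x y) n = fps_nth (star \<mu> y x) n"
    unfolding star_def by (simp only: fps_nth_Abs_fps)
qed

section \<open>Shuffles of two letters and symmetry\<close>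

lemma Sh_1_1: "Sh 1 1 = {id, Transposition.transpose 0 1}"
proof -
  have "{..<1 + 1} = {0, 1 :: nat}" "{..<1} = {0 :: nat}" "{1..<1 + 1} = {1 :: nat}" by auto
  moreover have "strict_mono_on {a} \<sigma>" for a :: nat and \<sigma> :: "nat \<Rightarrow> nat"
    by (auto intro: strict_mono_onI)
  ultimately have "Sh 1 1 = {\<sigma>. \<sigma> permutes {0, 1}}"
    by (simp only: Sh_def simp_thms)
  then show ?thesis by (simp only: permutes_doubleton_iff) blast
qed

text \<open>For p = q = 1 both permutations are shuffles, and the transposition has sign -1.\<close>

lemma CHarr2_symmetric:
  assumes "vector_space s" "f \<in> CHarr s 2"
  shows "f [x, y] = f [y, x]"
proof -
  interpret vector_space s by fact
  have "\<forall>p q xs. 1 \<le> p \<and> 1 \<le> q \<and> int (p + q) = 2 \<and> length xs = p + q \<longrightarrow>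
       (\<Sum>\<sigma>\<in>Sh p q. s (of_int (sign \<sigma>)) (f (permute_list (inv \<sigma>) xs))) = 0"
    using assms(2)[unfolded CHarr_def mem_Collect_eq] by (rule conjunct2)
  from this[THEN spec, THEN spec, THEN spec, of 1 1 "[x, y]"]
  have "(\<Sum>\<sigma>\<in>Sh 1 1. s (of_int (sign \<sigma>)) (f (permute_list (inv \<sigma>) [x, y]))) = 0"
    by simp
  moreover have "id \<noteq> Transposition.transpose 0 (1 :: nat)"
    by (metis id_apply transpose_apply_first zero_neq_one)
  ultimately show ?thesis
    unfolding Sh_1_1
    by (simp add: sign_swap_id permute_list_def sign_id)
qed

section \<open>From the Maurer-Cartan equation to an associative deformation\<close>

locale subcomplex_CHoch = subcomplex s m C + assoc_algebra s m
  for s :: "'k::field_char_0 \<Rightarrow> 'a::ab_group_add \<Rightarrow> 'a" and m C +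
  assumes C_CHoch: "C k \<subseteq> CHoch s k"
begin

theorem formal_deformation:
  assumes "formal s m C" and mc: "maurer_cartan s m C \<pi>"
  shows "\<exists>\<mu>. \<mu> 0 = m \<and> (\<forall>r\<ge>1. cochain2 (\<mu> r) \<in> C 2) \<and>
    (\<forall>x y z. star \<mu> (star \<mu> x y) z = star \<mu> x (star \<mu> y z)) \<and>
    cochain2 (\<mu> 1) \<in> cocycles s m C 2 \<and> cochain2 (\<mu> 1) +o coboundaries s m C 2 = \<pi> 0"
proof -
  obtain \<nu> :: "nat \<Rightarrow> 'a cochain" where \<nu>: "\<And>n. \<nu> n \<in> C 2" and \<nu>1: "\<nu> 1 \<in> \<pi> 0"
    and eq: "\<And>n. 1 \<le> n \<Longrightarrow> hdiff s m 2 (\<nu> n)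
      + cscale s (1 / 2) (\<Sum>i\<in>{1..<n}. gbracket s 2 2 (\<nu> i) (\<nu> (n - i))) = 0"
    by (rule formal_lift[OF assms]) (rule that)
  have \<nu>H: "\<nu> n \<in> CHoch s 2" for n using C_CHoch \<nu> by (rule subsetD)
  define \<mu> where "\<mu> r = (if r = 0 then m else (\<lambda>x y. \<nu> r [x, y]))" for r
  have c2: "cochain2 (\<mu> r) = \<nu> r" if "1 \<le> r" for r
    using that cochain2_CHoch2[OF \<nu>H] by (simp add: \<mu>_def)
  have \<mu>H: "cochain2 (\<mu> r) \<in> CHoch s 2" for r
    using cochain2_CHoch[OF bilinear] c2[of r] \<nu>H[of r] by (cases r) (simp_all add: \<mu>_def)
  \<comment> \<open>The sign for two 2-cochains is -1, which turns the commutator into a symmetric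
    sum.\<close>
  have brac: "gbracket s 2 2 f g = gcirc s 2 2 f g + gcirc s 2 2 g f" for f g
  proof -
    have "cscale s (- 1) f = - f" for f by (simp add: cscale_def fun_eq_iff)
    then show ?thesis by (simp add: gbracket_def sg_def)
  qed
  let ?G = "\<lambda>i j. gcirc s 2 2 (cochain2 (\<mu> i)) (cochain2 (\<mu> j))"
  have G: "(\<Sum>i\<le>n. ?G i (n - i)) = 0" if n: "1 \<le> n" for n
  proof -
    have "(\<Sum>i\<in>{1..<n}. gbracket s 2 2 (\<nu> i) (\<nu> (n - i))) = (\<Sum>i\<in>{1..<n}. ?G i (n - i)) + (\<Sum>i\<in>{1..<n}. ?G (n - i) i)"
      unfolding brac sum.distrib[symmetric]
    proof (rule sum.cong[OF refl])
      fix i assume "i \<in> {1..<n}"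
      then have "1 \<le> i" "1 \<le> n - i" by auto
      then show "gcirc s 2 2 (\<nu> i) (\<nu> (n - i)) + gcirc s 2 2 (\<nu> (n - i)) (\<nu> i) = ?G i (n - i) + ?G (n - i) i"
        by (simp only: c2)
    qed
    \<comment> \<open>Reversing the index identifies the two halves of the bracket sum, so the
      factor 1/2 disappears.\<close>
    also have "(\<Sum>i\<in>{1..<n}. ?G (n - i) i) = (\<Sum>i\<in>{1..<n}. ?G i (n - i))"
      by (rule sum.reindex_bij_witness[of _ "\<lambda>i. n - i" "\<lambda>i. n - i"]) auto
    finally have "cscale s (1 / 2) (\<Sum>i\<in>{1..<n}. gbracket s 2 2 (\<nu> i) (\<nu> (n - i))) =
      cscale s (1 / 2 + 1 / 2) (\<Sum>i\<in>{1..<n}. ?G i (n - i))"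
      by (simp only: cs.scale_left_distrib cs.scale_right_distrib)
    then have "cscale s (1 / 2) (\<Sum>i\<in>{1..<n}. gbracket s 2 2 (\<nu> i) (\<nu> (n - i))) = (\<Sum>i\<in>{1..<n}. ?G i (n - i))"
      by simp
    moreover have "hdiff s m 2 (\<nu> n) = ?G 0 n + ?G n 0"
      using c2[OF n] by (simp only: hdiff_def brac) (simp add: \<mu>_def)
    \<comment> \<open>The end terms i = 0 and i = n are the Hochschild differential of
      \<open>\<nu> n\<close>, the inner ones half the bracket sum.\<close>
    moreover have "{..n} = insert 0 (insert n {1..<n})" using n by auto
    ultimately show ?thesis using eq[OF n] n by (simp add: add.assoc)
  qed
  have assoc0: "(\<Sum>i\<le>n. \<mu> i (\<mu> (n - i) a b) c - \<mu> i a (\<mu> (n - i) b c)) = 0" for n a b c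
  proof (cases "n = 0")
    case True
    then show ?thesis by (simp add: \<mu>_def assoc)
  next
    case False
    have sum_app: "(\<Sum>i\<in>A. F i) x = (\<Sum>i\<in>A. F i x)" for F :: "nat \<Rightarrow> 'a cochain" and A x
      by (induction A rule: infinite_finite_induct) simp_all
    have "(\<Sum>i\<le>n. ?G i (n - i)) [a, b, c] = 0" using G[of n] False by simp
    then show ?thesis
      unfolding sum_app gcirc_22[OF vector_space_axioms] cochain2_Cons .
  qed
  have "star \<mu> (star \<mu> x y) z = star \<mu> x (star \<mu> y z)" for x y z
  proof (rule star_assoc)
    show "\<mu> r (u + v) y = \<mu> r u y + \<mu> r v y" "\<mu> r x (u + v) = \<mu> r x u + \<mu> r x v" for r u v x y
      using CHoch2_bilinear[OF \<mu>H[of r]] by simp_all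
  qed (rule assoc0)
  \<comment> \<open>At order 1 the bracket sum is empty, and the equation says that
    \<open>\<nu> 1\<close> is closed.\<close>
  moreover have "\<nu> 1 \<in> cocycles s m C 2"
    using eq[of 1] \<nu> by (simp add: cocycles_def)
  moreover have "\<nu> 1 +o coboundaries s m C 2 = \<pi> 0"
  proof -
    have "\<pi> 0 \<in> carr (cohomology s m C 2)" using mc unfolding maurer_cartan_def by (elim conjE) (erule spec)
    then obtain x where x: "\<pi> 0 = x +o coboundaries s m C 2"
      unfolding cohomology_def quot_def by auto
    then show ?thesis
      using \<nu>1 by (simp add: coset_eq_iff mem_coset)
  qed
  ultimately show ?thesis
    using \<nu> by (intro exI[of _ \<mu>]) (simp add: c2 \<mu>_def[of 0])
qed

end

section \<open>The Hochschild and Harrison instances\<close>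

lemma CHoch_closed:
  assumes "vector_space s"
  shows "0 \<in> CHoch s k" "f \<in> CHoch s k \<Longrightarrow> g \<in> CHoch s k \<Longrightarrow> f + g \<in> CHoch s k"
    "f \<in> CHoch s k \<Longrightarrow> cscale s c f \<in> CHoch s k"
proof -
  interpret vector_space s by fact
  show "0 \<in> CHoch s k" by (simp add: CHoch_def)
  show "f + g \<in> CHoch s k" if "f \<in> CHoch s k" "g \<in> CHoch s k"
    using that by (simp add: CHoch_def scale_right_distrib)
  show "cscale s c f \<in> CHoch s k" if "f \<in> CHoch s k"
    using that by (simp add: CHoch_def cscale_def scale_right_distrib mult.commute)
qed

lemma CHarr_closed:
  assumes "vector_space s"
  shows "0 \<in> CHarr s k" "f \<in> CHarr s k \<Longrightarrow> g \<in> CHarr s k \<Longrightarrow> f + g \<in> CHarr s k"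
    "f \<in> CHarr s k \<Longrightarrow> cscale s c f \<in> CHarr s k"
proof -
  interpret vector_space s by fact
  show "0 \<in> CHarr s k" by (simp add: CHarr_def CHoch_closed[OF assms])
  show "f + g \<in> CHarr s k" if "f \<in> CHarr s k" "g \<in> CHarr s k"
    using that by (simp add: CHarr_def CHoch_closed[OF assms] scale_right_distrib sum.distrib)
  show "cscale s c f \<in> CHarr s k" if f: "f \<in> CHarr s k"
  proof -
    have "(\<Sum>\<sigma>\<in>A. s (a \<sigma>) (cscale s c f (F \<sigma>))) = s c (\<Sum>\<sigma>\<in>A. s (a \<sigma>) (f (F \<sigma>)))"
      for A :: "(nat \<Rightarrow> nat) set" and a F
      by (simp add: cscale_def scale_sum_right mult.commute)
    then show ?thesis using f by (simp add: CHarr_def CHoch_closed[OF assms])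
  qed
qed

lemma subcomplex_CHoch_CHoch:
  fixes s :: "'k::field_char_0 \<Rightarrow> 'a::ab_group_add \<Rightarrow> 'a"
  assumes "assoc_algebra s m" shows "subcomplex_CHoch s m (CHoch s)"
proof -
  interpret assoc_algebra s m by fact
  show ?thesis
    by unfold_locales (simp_all add: bilinear CHoch_closed[OF vector_space_axioms])
qed

lemma subcomplex_CHoch_CHarr:
  fixes s :: "'k::field_char_0 \<Rightarrow> 'a::ab_group_add \<Rightarrow> 'a"
  assumes "assoc_algebra s m" shows "subcomplex_CHoch s m (CHarr s)"
proof -
  interpret assoc_algebra s m by fact
  show ?thesis
    by unfold_locales
      (simp_all add: bilinear CHarr_closed[OF vector_space_axioms], simp add: CHarr_def)
qed

theorem theorem5p4:
  fixes s :: "'k::field_char_0 \<Rightarrow> 'a::ab_group_add \<Rightarrow> 'a"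
    and m :: "'a \<Rightarrow> 'a \<Rightarrow> 'a"
  shows
    "(assoc_algebra s m \<and> formal s m (CHoch s) \<longrightarrow>
       (\<forall>\<pi>. maurer_cartan s m (CHoch s) \<pi> \<longrightarrow>
         (\<exists>\<mu>. \<mu> 0 = m \<and>
            (\<forall>r\<ge>1. cochain2 (\<mu> r) \<in> CHoch s 2) \<and>
            (\<forall>x y z. star \<mu> (star \<mu> x y) z = star \<mu> x (star \<mu> y z)) \<and>
            cochain2 (\<mu> 1) \<in> cocycles s m (CHoch s) 2 \<and>
            cochain2 (\<mu> 1) +o coboundaries s m (CHoch s) 2 = \<pi> 0)))
     \<and>
     (comm_assoc_algebra s m \<and> formal s m (CHarr s) \<longrightarrow>
       (\<forall>\<pi>. maurer_cartan s m (CHarr s) \<pi> \<longrightarrow>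
         (\<exists>\<mu>. \<mu> 0 = m \<and>
            (\<forall>r\<ge>1. cochain2 (\<mu> r) \<in> CHarr s 2) \<and>
            (\<forall>x y z. star \<mu> (star \<mu> x y) z = star \<mu> x (star \<mu> y z)) \<and>
            (\<forall>x y. star \<mu> x y = star \<mu> y x) \<and>
            cochain2 (\<mu> 1) \<in> cocycles s m (CHarr s) 2 \<and>
            cochain2 (\<mu> 1) +o coboundaries s m (CHarr s) 2 = \<pi> 0)))"
proof (intro conjI impI allI)
  fix \<pi> assume "assoc_algebra s m \<and> formal s m (CHoch s)" and mc: "maurer_cartan s m (CHoch s) \<pi>"
  then have A: "assoc_algebra s m" and F: "formal s m (CHoch s)" by simp_all
  show "\<exists>\<mu>. \<mu> 0 = m \<and>
            (\<forall>r\<ge>1. cochain2 (\<mu> r) \<in> CHoch s 2) \<and>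
            (\<forall>x y z. star \<mu> (star \<mu> x y) z = star \<mu> x (star \<mu> y z)) \<and>
            cochain2 (\<mu> 1) \<in> cocycles s m (CHoch s) 2 \<and>
            cochain2 (\<mu> 1) +o coboundaries s m (CHoch s) 2 = \<pi> 0"
    by (rule subcomplex_CHoch.formal_deformation[OF subcomplex_CHoch_CHoch[OF A] F mc])
next
  fix \<pi> assume "comm_assoc_algebra s m \<and> formal s m (CHarr s)" and mc: "maurer_cartan s m (CHarr s) \<pi>"
  then have A: "comm_assoc_algebra s m" and F: "formal s m (CHarr s)" by simp_all
  interpret comm_assoc_algebra s m by (rule A)
  obtain \<mu> where \<mu>0: "\<mu> 0 = m" and \<mu>: "\<forall>r\<ge>1. cochain2 (\<mu> r) \<in> CHarr s 2"
    and rest: "\<forall>x y z. star \<mu> (star \<mu> x y) z = star \<mu> x (star \<mu> y z)"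
      "cochain2 (\<mu> 1) \<in> cocycles s m (CHarr s) 2"
      "cochain2 (\<mu> 1) +o coboundaries s m (CHarr s) 2 = \<pi> 0"
    using subcomplex_CHoch.formal_deformation[OF subcomplex_CHoch_CHarr[OF assoc_algebra_axioms] F mc]
    by (elim exE conjE) (rule that)
  \<comment> \<open>Order 0 is the commutative product itself; the higher orders are Harrison
    2-cochains, hence symmetric.\<close>
  have "\<mu> r x y = \<mu> r y x" for r x y
  proof (cases "r = 0")
    case True
    then show ?thesis by (simp add: \<mu>0 commute)
  next
    case False
    then have "cochain2 (\<mu> r) \<in> CHarr s 2" using \<mu> by simp
    from CHarr2_symmetric[OF vector_space_axioms this, of x y] show ?thesis by simp
  qed
  then have "\<forall>x y. star \<mu> x y = star \<mu> y x" by (intro allI star_commute)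
  with \<mu>0 \<mu> rest show "\<exists>\<mu>. \<mu> 0 = m \<and>
            (\<forall>r\<ge>1. cochain2 (\<mu> r) \<in> CHarr s 2) \<and>
            (\<forall>x y z. star \<mu> (star \<mu> x y) z = star \<mu> x (star \<mu> y z)) \<and>
            (\<forall>x y. star \<mu> x y = star \<mu> y x) \<and>
            cochain2 (\<mu> 1) \<in> cocycles s m (CHarr s) 2 \<and>
            cochain2 (\<mu> 1) +o coboundaries s m (CHarr s) 2 = \<pi> 0"
    by (intro exI conjI)
qed

end
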